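(* Let $K$ be an algebraically closed field of characteristic $0$ or $\ge 3$. Any genus-$4$ double cover of a genus-$1$ curve over $K$ (that is, any nonsingular projective curve of genus $4$ over $K$ admitting a morphism of degree $2$ to a nonsingular projective curve of genus $1$) is non-hyperelliptic. *)

theory Defs
  imports
    "HOL-Analysis.Finite_Cartesian_Product"
    "HOL-Analysis.Abstract_Topology"
    "HOL-Computational_Algebra.Polynomial"
    "HOL-Library.Poly_Mapping"
    "HOL-Algebra.Embedded_Algebras"
    "HOL-Algebra.Ideal_Product"
begin

text \<open>
  Projective curves over an algebraically closed field in the classical language of varieties:
  irreducible Zariski-closed subsets of projective space, regular functions as functions that are
  locally quotients of forms of equal degree, morphisms as continuous maps preserving regular
  functions (Hartshorne, Chapter I). The projective space of dimension
  \<open>CARD('n) - 1\<close> has its homogeneous coordinates indexed by the finite type \<open>'n\<close>.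
\<close>

section \<open>Projective space and its Zariski topology\<close>

type_synonym ('k, 'n) mpoly = "('n \<Rightarrow>\<^sub>0 nat) \<Rightarrow>\<^sub>0 'k"

definition monom_eval :: "('n::finite \<Rightarrow>\<^sub>0 nat) \<Rightarrow> 'k::comm_ring_1 ^ 'n \<Rightarrow> 'k" where
  "monom_eval m x = (\<Prod>i\<in>UNIV. x $ i ^ Poly_Mapping.lookup m i)"

definition mpoly_eval :: "('k::comm_ring_1, 'n::finite) mpoly \<Rightarrow> 'k ^ 'n \<Rightarrow> 'k" where
  "mpoly_eval p x = (\<Sum>m\<in>Poly_Mapping.keys p. Poly_Mapping.lookup p m * monom_eval m x)"

definition homogeneous :: "nat \<Rightarrow> ('k::comm_ring_1, 'n::finite) mpoly \<Rightarrow> bool" where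
  "homogeneous d p \<longleftrightarrow>
     (\<forall>m\<in>Poly_Mapping.keys p. (\<Sum>i\<in>UNIV. Poly_Mapping.lookup m i) = d)"

definition proportional :: "('k::field ^ 'n) rel" where
  "proportional = {(x, y). x \<noteq> 0 \<and> y \<noteq> 0 \<and> (\<exists>c. y = c *s x)}"

type_synonym ('k, 'n) point = "('k ^ 'n) set"

definition proj_space :: "('k::field, 'n::finite) point set" where
  "proj_space = {x. x \<noteq> 0} // proportional"

definition zero_locus :: "('k::field, 'n::finite) mpoly set \<Rightarrow> ('k, 'n) point set" where
  "zero_locus T = {P \<in> proj_space. \<forall>p\<in>T. \<forall>x\<in>P. mpoly_eval p x = 0}"

definition zariski :: "('k::field, 'n::finite) point topology" where
  "zariski = topology (\<lambda>U. \<exists>T. (\<forall>p\<in>T. \<exists>d. homogeneous d p) \<and> U = proj_space - zero_locus T)"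

lemma monom_eval_add: "monom_eval (m + m') x = monom_eval m x * monom_eval m' x"
  by (simp add: monom_eval_def lookup_add power_add prod.distrib)

lemma mpoly_eval_superset:
  assumes "finite A" "Poly_Mapping.keys p \<subseteq> A"
  shows "mpoly_eval p x = (\<Sum>m\<in>A. Poly_Mapping.lookup p m * monom_eval m x)"
  unfolding mpoly_eval_def
  using assms by (intro sum.mono_neutral_left) (auto simp: in_keys_iff)

lemma mpoly_eval_add: "mpoly_eval (p + q) x = mpoly_eval p x + mpoly_eval q x"
proof -
  let ?A = "Poly_Mapping.keys p \<union> Poly_Mapping.keys q"
  have A: "finite ?A" by simp
  show ?thesis
    by (simp add: mpoly_eval_superset[OF A] keys_add lookup_add sum.distrib distrib_right)
qed

lemma mpoly_eval_single: "mpoly_eval (Poly_Mapping.single m c) x = c * monom_eval m x"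
  by (simp add: mpoly_eval_def)

lemma mpoly_induct [case_names zero single add]:
  fixes p :: "'a \<Rightarrow>\<^sub>0 'b::comm_monoid_add"
  assumes "P 0" "\<And>m c. P (Poly_Mapping.single m c)" "\<And>p q. P p \<Longrightarrow> P q \<Longrightarrow> P (p + q)"
  shows "P p"
proof -
  have "P (\<Sum>m\<in>A. Poly_Mapping.single m (Poly_Mapping.lookup p m))" if "finite A" for A
    using that by (induction A) (auto intro: assms)
  moreover have "p = (\<Sum>m\<in>Poly_Mapping.keys p. Poly_Mapping.single m (Poly_Mapping.lookup p m))"
    by (rule poly_mapping_eqI) (auto simp: lookup_sum lookup_single when_def in_keys_iff)
  ultimately show ?thesis by (metis finite_keys)
qed

lemma mpoly_eval_mult: "mpoly_eval (p * q) x = mpoly_eval p x * mpoly_eval q x"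
proof (induction p rule: mpoly_induct)
  case zero
  show ?case by (simp add: mpoly_eval_def)
next
  case (single m c)
  show ?case
    by (induction q rule: mpoly_induct)
      (simp_all add: mpoly_eval_def[of 0] mult_single mpoly_eval_single monom_eval_add
        mpoly_eval_add distrib_left)
next
  case (add p q)
  then show ?case by (simp add: distrib_right mpoly_eval_add)
qed

lemma homogeneous_mult:
  assumes "homogeneous d p" "homogeneous e q"
  shows "homogeneous (d + e) (p * q)"
  unfolding homogeneous_def
proof
  fix m assume "m \<in> Poly_Mapping.keys (p * q)"
  then obtain a b where "m = a + b" "a \<in> Poly_Mapping.keys p" "b \<in> Poly_Mapping.keys q"
    using keys_mult[of p q] by blast
  then show "(\<Sum>i\<in>UNIV. Poly_Mapping.lookup m i) = d + e"
    using assms by (simp add: homogeneous_def lookup_add sum.distrib)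
qed

lemma mpoly_eval_scale:
  assumes "homogeneous d p"
  shows "mpoly_eval p (c *s x) = c ^ d * mpoly_eval p x"
proof -
  have "monom_eval m (c *s x) = c ^ d * monom_eval m x" if "m \<in> Poly_Mapping.keys p" for m
    using assms that by (simp add: monom_eval_def homogeneous_def power_mult_distrib prod.distrib
        power_sum[symmetric])
  then show ?thesis
    by (simp add: mpoly_eval_def sum_distrib_left mult_ac)
qed

lemma mpoly_eval_eq_0_cong:
  assumes "homogeneous d p" "P \<in> proj_space" "x \<in> P" "y \<in> P" "mpoly_eval p x = 0"
  shows "mpoly_eval p y = 0"
proof -
  obtain z where z: "z \<noteq> 0" "P = proportional `` {z}"
    using assms(2) by (auto simp: proj_space_def quotient_def)
  then obtain a b where a: "x = a *s z" "x \<noteq> 0" and b: "y = b *s z"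
    using assms(3,4) by (auto simp: proportional_def)
  from a have "a \<noteq> 0" by auto
  with a assms(5) have "mpoly_eval p z = 0" by (simp add: mpoly_eval_scale[OF assms(1)])
  then show ?thesis by (simp add: b mpoly_eval_scale[OF assms(1)])
qed

lemma zero_locus_Un:
  assumes "\<forall>p\<in>S. \<exists>d. homogeneous d p" "\<forall>p\<in>T. \<exists>d. homogeneous d p"
  shows "zero_locus S \<union> zero_locus T = zero_locus {p * q | p q. p \<in> S \<and> q \<in> T}"
proof (intro equalityI subsetI)
  fix P assume "P \<in> zero_locus S \<union> zero_locus T"
  then show "P \<in> zero_locus {p * q | p q. p \<in> S \<and> q \<in> T}"
    by (auto simp: zero_locus_def mpoly_eval_mult)
next
  fix P assume P: "P \<in> zero_locus {p * q | p q. p \<in> S \<and> q \<in> T}"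
  show "P \<in> zero_locus S \<union> zero_locus T"
  proof (rule ccontr)
    assume "\<not> ?thesis"
    then obtain p x q y where pq: "p \<in> S" "x \<in> P" "mpoly_eval p x \<noteq> 0"
        "q \<in> T" "y \<in> P" "mpoly_eval q y \<noteq> 0"
      using P by (auto simp: zero_locus_def)
    have "P \<in> proj_space" using P by (simp add: zero_locus_def)
    with pq assms have "mpoly_eval q x \<noteq> 0" using mpoly_eval_eq_0_cong by blast
    moreover have "mpoly_eval (p * q) x = 0" using P pq by (auto simp: zero_locus_def)
    ultimately show False using pq by (simp add: mpoly_eval_mult)
  qed
qed

lemma istopology_zariski:
  "istopology (\<lambda>U :: ('k::field, 'n::finite) point set.
     \<exists>T. (\<forall>p\<in>T. \<exists>d. homogeneous d p) \<and> U = proj_space - zero_locus T)"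
  (is "istopology ?L")
  unfolding istopology_def
proof (intro conjI allI impI)
  fix U V :: "('k, 'n) point set" assume "?L U" "?L V"
  then obtain S T where S: "\<forall>p\<in>S. \<exists>d. homogeneous d p" "U = proj_space - zero_locus S"
    and T: "\<forall>p\<in>T. \<exists>d. homogeneous d p" "V = proj_space - zero_locus T" by blast
  have "U \<inter> V = proj_space - zero_locus {p * q | p q. p \<in> S \<and> q \<in> T}"
    using S T zero_locus_Un[OF S(1) T(1)] by blast
  moreover have "\<forall>r\<in>{p * q | p q. p \<in> S \<and> q \<in> T}. \<exists>d. homogeneous d r"
    using S T homogeneous_mult by blast
  ultimately show "?L (U \<inter> V)" by blast
next
  fix \<K> :: "('k, 'n) point set set" assume "\<forall>K\<in>\<K>. ?L K"
  then obtain T where T: "\<And>K. K \<in> \<K> \<Longrightarrow> (\<forall>p\<in>T K. \<exists>d. homogeneous d p) \<and> K = proj_space - zero_locus (T K)"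
    by metis
  have "\<Union>\<K> = proj_space - zero_locus (\<Union>(T ` \<K>))"
  proof (intro equalityI subsetI)
    fix P assume "P \<in> \<Union>\<K>"
    then show "P \<in> proj_space - zero_locus (\<Union>(T ` \<K>))" using T by (force simp: zero_locus_def)
  next
    fix P assume "P \<in> proj_space - zero_locus (\<Union>(T ` \<K>))"
    then obtain K where "K \<in> \<K>" "P \<in> proj_space - zero_locus (T K)"
      by (auto simp: zero_locus_def)
    then show "P \<in> \<Union>\<K>" using T by blast
  qed
  then show "?L (\<Union>\<K>)" using T by (intro exI[of _ "\<Union>(T ` \<K>)"]) blast
qed

lemma openin_zariski:
  "openin zariski U \<longleftrightarrow> (\<exists>T. (\<forall>p\<in>T. \<exists>d. homogeneous d p) \<and> U = proj_space - zero_locus T)"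
  unfolding zariski_def by (simp add: istopology_zariski)

lemma topspace_zariski: "topspace zariski = proj_space"
proof
  show "topspace zariski \<subseteq> proj_space"
    by (auto simp: topspace_def openin_zariski)
  have one: "homogeneous 0 1" by (simp add: homogeneous_def)
  have eval1: "mpoly_eval 1 x = 1" for x :: "'a ^ 'b"
    by (simp add: mpoly_eval_def monom_eval_def)
  have ne: "P \<noteq> {}" if "P \<in> proj_space" for P :: "('a, 'b) point"
  proof -
    obtain z where z: "z \<noteq> 0" "P = proportional `` {z}"
      using \<open>P \<in> proj_space\<close> by (auto simp: proj_space_def quotient_def)
    have "z = 1 *s z" by (simp add: vec_eq_iff)
    then have "z \<in> P" using z unfolding proportional_def by blast
    then show ?thesis by blast
  qed
  have "openin zariski (proj_space :: ('a, 'b) point set)"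
    unfolding openin_zariski using one ne by (intro exI[of _ "{1}"]) (auto simp: zero_locus_def eval1)
  then show "(proj_space :: ('a, 'b) point set) \<subseteq> topspace zariski"
    by (rule openin_subset)
qed

section \<open>Curves, regular functions and morphisms\<close>

definition irreducible_space :: "'a topology \<Rightarrow> bool" where
  "irreducible_space T \<longleftrightarrow> topspace T \<noteq> {} \<and>
     (\<forall>A B. closedin T A \<longrightarrow> closedin T B \<longrightarrow> A \<union> B = topspace T \<longrightarrow>
        A = topspace T \<or> B = topspace T)"

definition irreducible_closed_chain :: "'a topology \<Rightarrow> nat \<Rightarrow> (nat \<Rightarrow> 'a set) \<Rightarrow> bool" where
  "irreducible_closed_chain T d Z \<longleftrightarrow>
     (\<forall>i\<le>d. closedin T (Z i) \<and> irreducible_space (subtopology T (Z i))) \<and>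
     (\<forall>i<d. Z i \<subset> Z (Suc i))"

text \<open>Krull dimension; truncating a longer chain shows that excluding length \<open>d + 1\<close> suffices.\<close>

definition has_dimension :: "'a topology \<Rightarrow> nat \<Rightarrow> bool" where
  "has_dimension T d \<longleftrightarrow>
     (\<exists>Z. irreducible_closed_chain T d Z) \<and> \<not> (\<exists>Z. irreducible_closed_chain T (Suc d) Z)"

definition projective_curve :: "('k::field, 'n::finite) point set \<Rightarrow> bool" where
  "projective_curve X \<longleftrightarrow> closedin zariski X \<and>
     irreducible_space (subtopology zariski X) \<and> has_dimension (subtopology zariski X) 1"

abbreviation open_in :: "('k::field, 'n::finite) point set \<Rightarrow> ('k, 'n) point set \<Rightarrow> bool" where
  "open_in X \<equiv> openin (subtopology zariski X)"

text \<open>Only the values of \<open>f\<close> on \<open>U\<close> matter.\<close>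

definition regular_on ::
    "('k::field, 'n::finite) point set \<Rightarrow> ('k, 'n) point set \<Rightarrow> (('k, 'n) point \<Rightarrow> 'k) \<Rightarrow> bool" where
  "regular_on X U f \<longleftrightarrow> (\<forall>P\<in>U. \<exists>V. open_in X V \<and> P \<in> V \<and> V \<subseteq> U \<and>
     (\<exists>d g h. homogeneous d g \<and> homogeneous d h \<and>
        (\<forall>Q\<in>V. \<forall>x\<in>Q. mpoly_eval h x \<noteq> 0 \<and> f Q = mpoly_eval g x / mpoly_eval h x)))"

definition curve_morphism ::
    "('k::field, 'n::finite) point set \<Rightarrow> ('k, 'm::finite) point set \<Rightarrow>
     (('k, 'n) point \<Rightarrow> ('k, 'm) point) \<Rightarrow> bool" where
  "curve_morphism X Y \<phi> \<longleftrightarrow>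
     continuous_map (subtopology zariski X) (subtopology zariski Y) \<phi> \<and>
     (\<forall>V f. open_in Y V \<longrightarrow> regular_on Y V f \<longrightarrow> regular_on X {P \<in> X. \<phi> P \<in> V} (f \<circ> \<phi>))"

section \<open>The function field\<close>

text \<open>
  A rational function is a class of pairs \<open>(U, f)\<close> with \<open>f\<close> regular on the nonempty open set
  \<open>U\<close>, two pairs being identified when the functions agree on the intersection of their domains.
\<close>

definition rational_reps ::
    "('k::field, 'n::finite) point set \<Rightarrow> (('k, 'n) point set \<times> (('k, 'n) point \<Rightarrow> 'k)) set" where
  "rational_reps X = {(U, f). open_in X U \<and> U \<noteq> {} \<and> regular_on X U f}"

definition rational_rel ::
    "('k::field, 'n::finite) point set \<Rightarrow> (('k, 'n) point set \<times> (('k, 'n) point \<Rightarrow> 'k)) rel" where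
  "rational_rel X = {((U, f), (V, g)). (U, f) \<in> rational_reps X \<and> (V, g) \<in> rational_reps X \<and>
     (\<forall>P\<in>U \<inter> V. f P = g P)}"

type_synonym ('k, 'n) rational = "(('k, 'n) point set \<times> (('k, 'n) point \<Rightarrow> 'k)) set"

definition rational_class ::
    "('k::field, 'n::finite) point set \<Rightarrow> ('k, 'n) point set \<Rightarrow> (('k, 'n) point \<Rightarrow> 'k) \<Rightarrow>
     ('k, 'n) rational" where
  "rational_class X U f = rational_rel X `` {(U, f)}"

definition function_field :: "('k::field, 'n::finite) point set \<Rightarrow> ('k, 'n) rational ring" where
  "function_field X =
     \<lparr>carrier = rational_reps X // rational_rel X,
      mult = (\<lambda>a b. \<Union>(U, f)\<in>a. \<Union>(V, g)\<in>b. rational_class X (U \<inter> V) (\<lambda>P. f P * g P)),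
      one = rational_class X X (\<lambda>_. 1),
      zero = rational_class X X (\<lambda>_. 0),
      add = (\<lambda>a b. \<Union>(U, f)\<in>a. \<Union>(V, g)\<in>b. rational_class X (U \<inter> V) (\<lambda>P. f P + g P))\<rparr>"

definition constants :: "('k::field, 'n::finite) point set \<Rightarrow> ('k, 'n) rational set" where
  "constants X = {rational_class X X (\<lambda>_. c) | c. True}"

definition pullback ::
    "('k::field, 'n::finite) point set \<Rightarrow> (('k, 'n) point \<Rightarrow> ('k, 'm::finite) point) \<Rightarrow>
     ('k, 'm) rational \<Rightarrow> ('k, 'n) rational" where
  "pullback X \<phi> a = (\<Union>(V, f)\<in>a. rational_class X {P \<in> X. \<phi> P \<in> V} (f \<circ> \<phi>))"

definition dominant ::
    "('k::field, 'n::finite) point set \<Rightarrow> ('k, 'm::finite) point set \<Rightarrow>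
     (('k, 'n) point \<Rightarrow> ('k, 'm) point) \<Rightarrow> bool" where
  "dominant X Y \<phi> \<longleftrightarrow> (\<forall>V. open_in Y V \<longrightarrow> V \<noteq> {} \<longrightarrow> (\<exists>P\<in>X. \<phi> P \<in> V))"

text \<open>The degree is the degree of the extension \<open>\<phi>\<^sup>* K(Y) \<subseteq> K(X)\<close> of function fields.\<close>

definition morphism_of_degree ::
    "nat \<Rightarrow> ('k::field, 'n::finite) point set \<Rightarrow> ('k, 'm::finite) point set \<Rightarrow>
     (('k, 'n) point \<Rightarrow> ('k, 'm) point) \<Rightarrow> bool" where
  "morphism_of_degree d X Y \<phi> \<longleftrightarrow> curve_morphism X Y \<phi> \<and> dominant X Y \<phi> \<and>
     ring.dimension (function_field X) d
       (pullback X \<phi> ` carrier (function_field Y)) (carrier (function_field X))"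

section \<open>Local rings and nonsingularity\<close>

definition local_ring ::
    "('k::field, 'n::finite) point set \<Rightarrow> ('k, 'n) point \<Rightarrow> ('k, 'n) rational set" where
  "local_ring X P = {a \<in> carrier (function_field X). \<exists>(U, f)\<in>a. P \<in> U}"

definition max_ideal ::
    "('k::field, 'n::finite) point set \<Rightarrow> ('k, 'n) point \<Rightarrow> ('k, 'n) rational set" where
  "max_ideal X P = {a \<in> carrier (function_field X). \<exists>(U, f)\<in>a. P \<in> U \<and> f P = 0}"

text \<open>
  The local ring of a curve at a point has Krull dimension 1 and residue field \<open>K\<close>; it is regular
  iff the \<open>K\<close>-vector space \<open>\<mm>/\<mm>\<^sup>2\<close> has dimension 1, i.e. is spanned by
  one nonzero class.
\<close>

definition nonsingular_at ::
    "('k::field, 'n::finite) point set \<Rightarrow> ('k, 'n) point \<Rightarrow> bool" where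
  "nonsingular_at X P \<longleftrightarrow>
     (let F = function_field X; M = max_ideal X P; M2 = ideal_prod F M M
      in \<exists>t\<in>M. t \<notin> M2 \<and> M = ring.line_extension F (constants X) t M2)"

definition nonsingular_projective_curve :: "('k::field, 'n::finite) point set \<Rightarrow> bool" where
  "nonsingular_projective_curve X \<longleftrightarrow> projective_curve X \<and> (\<forall>P\<in>X. nonsingular_at X P)"

section \<open>Divisors, genus and hyperelliptic curves\<close>

definition uniformizer ::
    "('k::field, 'n::finite) point set \<Rightarrow> ('k, 'n) point \<Rightarrow> ('k, 'n) rational \<Rightarrow> bool" where
  "uniformizer X P t \<longleftrightarrow> t \<in> max_ideal X P \<and>
     max_ideal X P = {t \<otimes>\<^bsub>function_field X\<^esub> a | a. a \<in> local_ring X P}"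

text \<open>The order of vanishing at \<open>P\<close> of a nonzero rational function on a nonsingular curve.\<close>

definition ord_at ::
    "('k::field, 'n::finite) point set \<Rightarrow> ('k, 'n) point \<Rightarrow> ('k, 'n) rational \<Rightarrow> int" where
  "ord_at X P a = (THE k :: int. \<exists>t u. uniformizer X P t \<and> u \<in> local_ring X P - max_ideal X P \<and>
     a = u \<otimes>\<^bsub>function_field X\<^esub> (t [^]\<^bsub>function_field X\<^esub> k))"

definition divisors :: "('k::field, 'n::finite) point set \<Rightarrow> (('k, 'n) point \<Rightarrow>\<^sub>0 int) set" where
  "divisors X = {D. Poly_Mapping.keys D \<subseteq> X}"

definition divisor_degree :: "('p \<Rightarrow>\<^sub>0 int) \<Rightarrow> int" where
  "divisor_degree D = (\<Sum>P\<in>Poly_Mapping.keys D. Poly_Mapping.lookup D P)"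

definition riemann_roch_space ::
    "('k::field, 'n::finite) point set \<Rightarrow> (('k, 'n) point \<Rightarrow>\<^sub>0 int) \<Rightarrow> ('k, 'n) rational set" where
  "riemann_roch_space X D = {a \<in> carrier (function_field X).
     a = \<zero>\<^bsub>function_field X\<^esub> \<or> (\<forall>P\<in>X. ord_at X P a \<ge> - Poly_Mapping.lookup D P)}"

text \<open>
  The genus of a nonsingular projective curve is the smallest \<open>g\<close> with
  \<open>l(D) \<ge> deg D + 1 - g\<close> for all divisors \<open>D\<close>, i.e. the maximum of \<open>deg D + 1 - l(D)\<close>
  (Fulton, Algebraic Curves, 8.3; Stichtenoth, Algebraic Function Fields and Codes, 1.4.15).
  Here \<open>l(D)\<close> is the dimension over the constants of the (always finite-dimensional)
  Riemann-Roch space of \<open>D\<close>. The genus is a relation, not a function, so that the definition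
  does not presuppose that the maximum exists (Riemann's theorem).
\<close>

definition has_genus :: "('k::field, 'n::finite) point set \<Rightarrow> int \<Rightarrow> bool" where
  "has_genus X g \<longleftrightarrow>
     (\<exists>D l. D \<in> divisors X \<and>
        ring.dimension (function_field X) l (constants X) (riemann_roch_space X D) \<and>
        divisor_degree D + 1 - int l = g) \<and>
     (\<forall>D l. D \<in> divisors X \<longrightarrow>
        ring.dimension (function_field X) l (constants X) (riemann_roch_space X D) \<longrightarrow>
        divisor_degree D + 1 - int l \<le> g)"

text \<open>The target of the degree-2 morphism is the projective line.\<close>

definition hyperelliptic :: "('k::field, 'n::finite) point set \<Rightarrow> bool" where
  "hyperelliptic X \<longleftrightarrow> nonsingular_projective_curve X \<and> (\<exists>g\<ge>2. has_genus X g) \<and>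
     (\<exists>\<phi>. morphism_of_degree 2 X (proj_space :: ('k, 2) point set) \<phi>)"

end

theory Submission
  imports Defs
begin

text \<open>
  Suppose \<open>X\<close> is hyperelliptic. Then \<open>F = K(X)\<close> has degree 2 over both \<open>K(E)\<close> and a rational subfield
  \<open>K(x)\<close>. If \<open>x\<close> is not in \<open>K(E)\<close>, then for every large effective divisor \<open>A\<close> on \<open>E\<close> the space of
  \<open>D' = \<phi>\<^sup>*A + (x)\<^sub>\<infinity>\<close> contains \<open>L(A) \<oplus> L(A) x\<close>, so \<open>l(D') \<ge> 2 deg A \<ge> deg D' - 2\<close> and the genus
  of \<open>X\<close> is at most 3 (the argument of Castelnuovo and Severi). Otherwise \<open>K(E) = K(x)\<close>, and \<open>E\<close> has
  genus 0. In both cases only \<open>\<Sum> e\<^sub>P \<le> [F : K(E)]\<close> is needed of the theory of ramification, and the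
  finiteness of \<open>l(D)\<close> is inherited from the divisors realising the genera, so that the completeness
  of projective curves plays no role. That \<open>ord_at\<close> is a discrete valuation follows from Nakayama's
  lemma and from \<open>F\<close> having transcendence degree 1.
\<close>

\<comment> \<open>The genus bounds only those divisors whose Riemann-Roch space has a dimension, so
  nothing can be read off at an arbitrary divisor. Each genus does supply one divisor where the
  dimension is finite, and adding a point raises the dimension by at most one. So degree minus
  dimension never drops when a divisor grows: the value 4, reached at some \<open>D\<close> on
  \<open>X\<close>, persists up to a larger \<open>D'\<close> that is suited to the count. The
  numbers in that count have three sources: genus 1 gives \<open>l(A) \<ge> deg A\<close>, a
  pullback at most doubles the degree, and \<open>x\<close> has at most two poles because
  \<open>F\<close> has degree 2 over \<open>K(x)\<close>. Geometry enters through functions alone: a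
  valuation at each point, functions separating finitely many points, and one ramification factor
  per point of \<open>X\<close>. Krull's intersection theorem for the local rings is obtained by
  counting: an element divisible by every power of a uniformizer would be algebraically independent
  of it, which the degree 2 over \<open>K(x)\<close> excludes.\<close>
alias lookup = Poly_Mapping.lookup
alias keys = Poly_Mapping.keys
alias single = Poly_Mapping.single

section \<open>Fields over a field of constants\<close>

text \<open>The constants come as a map from the type \<open>'k\<close>, not as a subset of the
  carrier, so that polynomials of type \<open>'k poly\<close> can be evaluated in \<open>R\<close>.
  The subfield over which dimensions are taken is \<open>range \<iota>\<close>
  (\<open>subfield_const\<close>).\<close>

locale field_over = field R for R (structure) +
  fixes \<iota> :: "'k::field \<Rightarrow> 'a"
  assumes const_closed [simp, intro]: "\<iota> c \<in> carrier R"
    and const_one [simp]: "\<iota> 1 = \<one>"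
    and const_add: "\<iota> (c + d) = \<iota> c \<oplus> \<iota> d"
    and const_mult: "\<iota> (c * d) = \<iota> c \<otimes> \<iota> d"
begin

lemma const_zero [simp]: "\<iota> 0 = \<zero>"
  by (metis add.l_cancel_one' add_0 const_add const_closed)

lemma const_uminus: "\<iota> (- c) = \<ominus> \<iota> c"
  by (metis add.inv_equality ab_left_minus const_add const_closed const_zero)

lemma const_eq_zero_iff [simp]: "\<iota> c = \<zero> \<longleftrightarrow> c = 0"
proof
  assume "\<iota> c = \<zero>"
  then have "\<iota> (inverse c * c) = \<zero>" by (simp add: const_mult)
  then show "c = 0" by (metis const_one left_inverse one_not_zero)
qed simp

lemma const_inverse: "c \<noteq> 0 \<Longrightarrow> \<iota> (inverse c) = inv (\<iota> c)"
  by (metis comm_inv_char const_closed const_mult const_one right_inverse)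

lemma nonzero_Units: "a \<in> carrier R \<Longrightarrow> a \<noteq> \<zero> \<Longrightarrow> a \<in> Units R"
  by (simp add: field_Units)

lemma inv_closed' [simp, intro]: "a \<in> carrier R \<Longrightarrow> a \<noteq> \<zero> \<Longrightarrow> inv a \<in> carrier R"
  by (simp add: nonzero_Units)

lemma inv_nonzero [simp]: "a \<in> carrier R \<Longrightarrow> a \<noteq> \<zero> \<Longrightarrow> inv a \<noteq> \<zero>"
  by (metis Units_inv_Units field_Units nonzero_Units Diff_iff singletonI)

lemma r_inv' [simp]: "a \<in> carrier R \<Longrightarrow> a \<noteq> \<zero> \<Longrightarrow> a \<otimes> inv a = \<one>"
  by (simp add: nonzero_Units)

lemma l_inv' [simp]: "a \<in> carrier R \<Longrightarrow> a \<noteq> \<zero> \<Longrightarrow> inv a \<otimes> a = \<one>"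
  by (simp add: nonzero_Units)

lemma subfield_const: "subfield (range \<iota>) R"
proof (rule subfieldI')
  show "subring (range \<iota>) R"
    by (rule subringI) (auto simp flip: const_one const_uminus const_add const_mult)
  show "inv k \<in> range \<iota>" if "k \<in> range \<iota> - {\<zero>}" for k
    using that by (auto simp flip: const_inverse)
qed

lemma nat_pow_eq_zero_iff: "a \<in> carrier R \<Longrightarrow> a [^] (n::nat) = \<zero> \<Longrightarrow> a = \<zero>"
  by (induction n) (auto simp: integral_iff)

lemma nat_pow_nonzero [simp]: "a \<in> carrier R \<Longrightarrow> a \<noteq> \<zero> \<Longrightarrow> a [^] (n::nat) \<noteq> \<zero>"
  using nat_pow_eq_zero_iff by blast

end

subsection \<open>Evaluation of polynomials\<close>

context field_over
begin

text \<open>Horner evaluation of polynomials over the type \<open>'k\<close>, whose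
  \<open>degree\<close> and root \<open>order\<close> describe the values of a valuation in
  \<open>peval_pole\<close> and \<open>peval_zero\<close>.\<close>

definition peval :: "'a \<Rightarrow> 'k poly \<Rightarrow> 'a" where
  "peval x p = fold_coeffs (\<lambda>c s. \<iota> c \<oplus> x \<otimes> s) p \<zero>"

lemma peval_0 [simp]: "peval x 0 = \<zero>"
  by (simp add: peval_def)

lemma peval_pCons: "x \<in> carrier R \<Longrightarrow> peval x (pCons c p) = \<iota> c \<oplus> x \<otimes> peval x p"
  by (cases "c = 0 \<and> p = 0") (auto simp: peval_def)

lemma peval_closed [simp, intro]: "x \<in> carrier R \<Longrightarrow> peval x p \<in> carrier R"
  by (induction p) (auto simp: peval_pCons)

lemma peval_1 [simp]: "x \<in> carrier R \<Longrightarrow> peval x 1 = \<one>"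
  by (simp add: one_pCons peval_pCons)

lemma peval_const: "x \<in> carrier R \<Longrightarrow> peval x [:c:] = \<iota> c"
  by (simp add: peval_pCons)

lemma peval_X: "x \<in> carrier R \<Longrightarrow> peval x [:0, 1:] = x"
  by (simp add: peval_pCons)

lemma peval_add: "x \<in> carrier R \<Longrightarrow> peval x (p + q) = peval x p \<oplus> peval x q"
proof (induction p arbitrary: q)
  case (pCons c p)
  obtain d q' where q: "q = pCons d q'" by (cases q)
  show ?case using pCons.prems pCons.IH[of q']
    by (simp add: q peval_pCons const_add r_distr a_ac)
qed simp

lemma peval_smult: "x \<in> carrier R \<Longrightarrow> peval x (Polynomial.smult c p) = \<iota> c \<otimes> peval x p"
  by (induction p) (auto simp: peval_pCons const_mult r_distr m_ac)

lemma peval_mult: "x \<in> carrier R \<Longrightarrow> peval x (p * q) = peval x p \<otimes> peval x q"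
  by (induction p) (auto simp: peval_pCons peval_add peval_smult l_distr m_assoc)

lemma peval_power: "x \<in> carrier R \<Longrightarrow> peval x (p ^ n) = peval x p [^] n"
  by (induction n) (auto simp: peval_mult m_ac)

end

subsection \<open>Discrete valuations\<close>

text \<open>The value at zero is left open, since \<open>int\<close> has no infinity; hence the
  nonzero side conditions. \<open>val_residue\<close> says that the residue field is K, as at a
  point of a classical variety.\<close>

locale discrete_valuation = field_over R \<iota> for R (structure) and \<iota> :: "'k::field \<Rightarrow> 'a" +
  fixes v :: "'a \<Rightarrow> int"
  assumes val_mult: "\<lbrakk>a \<in> carrier R; a \<noteq> \<zero>; b \<in> carrier R; b \<noteq> \<zero>\<rbrakk> \<Longrightarrow> v (a \<otimes> b) = v a + v b"
    and val_add: "\<lbrakk>a \<in> carrier R; a \<noteq> \<zero>; b \<in> carrier R; b \<noteq> \<zero>; a \<oplus> b \<noteq> \<zero>\<rbrakk> \<Longrightarrow>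
      min (v a) (v b) \<le> v (a \<oplus> b)"
    and val_const: "c \<noteq> 0 \<Longrightarrow> v (\<iota> c) = 0"
    and val_uniformizer: "\<exists>t \<in> carrier R - {\<zero>}. v t = 1"
    and val_residue: "\<lbrakk>a \<in> carrier R; a \<noteq> \<zero>; 0 \<le> v a\<rbrakk> \<Longrightarrow>
      \<exists>c. a \<ominus> \<iota> c = \<zero> \<or> 0 < v (a \<ominus> \<iota> c)"
begin

text \<open>The fractional ideal of order \<open>n\<close>, with zero put in by hand: the valuation
  axioms become closure properties without case distinctions on zero.\<close>

definition vset :: "int \<Rightarrow> 'a set" where
  "vset n = {a \<in> carrier R. a = \<zero> \<or> n \<le> v a}"

lemma vset_carrier: "a \<in> vset n \<Longrightarrow> a \<in> carrier R"
  by (simp add: vset_def)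

lemma zero_vset [simp, intro]: "\<zero> \<in> vset n"
  by (simp add: vset_def)

lemma vsetI: "a \<in> carrier R \<Longrightarrow> (a \<noteq> \<zero> \<Longrightarrow> n \<le> v a) \<Longrightarrow> a \<in> vset n"
  by (auto simp: vset_def)

lemma vset_mono: "a \<in> vset n \<Longrightarrow> m \<le> n \<Longrightarrow> a \<in> vset m"
  by (auto simp: vset_def)

lemma vset_add: "a \<in> vset n \<Longrightarrow> b \<in> vset n \<Longrightarrow> a \<oplus> b \<in> vset n"
  using val_add[of a b] by (fastforce simp: vset_def)

lemma vset_mult: "a \<in> vset n \<Longrightarrow> b \<in> vset m \<Longrightarrow> a \<otimes> b \<in> vset (n + m)"
  using val_mult[of a b] by (fastforce simp: vset_def)

lemma const_vset [simp, intro]: "\<iota> c \<in> vset 0"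
  by (rule vsetI) (auto simp: val_const)

lemma vset_const_mult: "a \<in> vset n \<Longrightarrow> \<iota> c \<otimes> a \<in> vset n"
  using vset_mult[of "\<iota> c" 0 a n] by simp

lemma vset_uminus: "a \<in> vset n \<Longrightarrow> \<ominus> a \<in> vset n"
  using vset_const_mult[of a n "- 1"] by (simp add: const_uminus l_minus vset_carrier)

lemma vset_minus: "a \<in> vset n \<Longrightarrow> b \<in> vset n \<Longrightarrow> a \<ominus> b \<in> vset n"
  by (simp add: minus_eq vset_add vset_uminus)

lemma val_one [simp]: "v \<one> = 0"
  using val_const[of 1] by simp

lemma val_inv: "a \<in> carrier R \<Longrightarrow> a \<noteq> \<zero> \<Longrightarrow> v (inv a) = - v a"
  using val_mult[of a "inv a"] by simp

lemma val_pow: "a \<in> carrier R \<Longrightarrow> a \<noteq> \<zero> \<Longrightarrow> v (a [^] (n::nat)) = int n * v a"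
  by (induction n) (auto simp: val_mult algebra_simps)

text \<open>From \<open>a = (a \<oplus> b) \<ominus> b\<close>: if the sum were zero or of larger
  order, \<open>a\<close> would lie in a \<open>vset\<close> beyond its own order.\<close>

lemma val_add_strict:
  assumes "a \<in> carrier R" "a \<noteq> \<zero>" "v a < n" "b \<in> vset n"
  shows "a \<oplus> b \<noteq> \<zero>" "v (a \<oplus> b) = v a"
proof -
  have b: "b \<in> carrier R" using assms(4) by (rule vset_carrier)
  have *: "a = (a \<oplus> b) \<ominus> b" using assms(1) b by algebra
  show ne: "a \<oplus> b \<noteq> \<zero>"
  proof
    assume "a \<oplus> b = \<zero>"
    then have "a = \<zero> \<ominus> b" using * by simp
    then have "a \<in> vset n" using vset_minus[of \<zero> n b] assms(4) by simp
    then show False using assms by (auto simp: vset_def)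
  qed
  show "v (a \<oplus> b) = v a"
  proof (rule antisym)
    have "a \<oplus> b \<in> vset (v a)"
      using assms b by (intro vset_add) (auto intro: vset_mono vsetI)
    then show "v a \<le> v (a \<oplus> b)" using ne by (auto simp: vset_def)
    show "v (a \<oplus> b) \<le> v a"
    proof (rule ccontr)
      assume *: "\<not> ?thesis"
      define m where "m = min n (v (a \<oplus> b))"
      have "a \<in> vset m" unfolding m_def
        by (subst \<open>a = (a \<oplus> b) \<ominus> b\<close>, rule vset_minus)
           (use assms b in \<open>auto simp: vset_def\<close>)
      then show False using assms * by (auto simp: vset_def m_def)
    qed
  qed
qed

lemma vset_residue:
  assumes "a \<in> vset 0" shows "\<exists>c. a \<ominus> \<iota> c \<in> vset 1"
proof (cases "a = \<zero>")
  case True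
  then show ?thesis by (intro exI[of _ 0]) (simp add: minus_eq)
next
  case False
  then obtain c where "a \<ominus> \<iota> c = \<zero> \<or> 0 < v (a \<ominus> \<iota> c)"
    using assms val_residue[of a] by (auto simp: vset_def)
  then show ?thesis using assms by (intro exI[of _ c]) (auto simp: vset_def)
qed

lemma peval_vset: "x \<in> vset 0 \<Longrightarrow> peval x p \<in> vset 0"
proof (induction p)
  case (pCons c p)
  then show ?case using vset_add[of "\<iota> c" 0] vset_mult[of x 0 "peval x p" 0]
    by (simp add: peval_pCons vset_carrier)
qed auto

text \<open>In the Horner recursion the summand \<open>x \<otimes> peval x p\<close> has negative
  order as long as \<open>p \<noteq> 0\<close>, so adding a constant cannot change its order: the
  leading term decides.\<close>

lemma peval_pole:
  assumes "x \<in> carrier R" "x \<noteq> \<zero>" "v x < 0" "p \<noteq> 0"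
  shows "peval x p \<noteq> \<zero>" "v (peval x p) = int (degree p) * v x"
  using assms(4)
proof (induction p)
  case (pCons c p)
  show "peval x (pCons c p) \<noteq> \<zero>" "v (peval x (pCons c p)) = int (degree (pCons c p)) * v x"
  proof (atomize (full), cases "p = 0")
    case True
    then show "peval x (pCons c p) \<noteq> \<zero> \<and> v (peval x (pCons c p)) = int (degree (pCons c p)) * v x"
      using pCons assms by (simp add: peval_pCons val_const)
  next
    case False
    let ?a = "x \<otimes> peval x p"
    have a: "?a \<in> carrier R" "?a \<noteq> \<zero>" using pCons False assms by (auto simp: integral_iff)
    have va: "v ?a = int (degree (pCons c p)) * v x"
      using pCons False assms by (simp add: val_mult algebra_simps)
    also have "\<dots> < 0" using assms False by (simp add: mult_pos_neg)
    finally have "v ?a < 0" .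
    from val_add_strict[OF a this const_vset[of c]] va
    show "peval x (pCons c p) \<noteq> \<zero> \<and> v (peval x (pCons c p)) = int (degree (pCons c p)) * v x"
      using assms by (simp add: peval_pCons a_comm)
  qed
qed auto

text \<open>Split off the full power of X - c. The cofactor satisfies q(x) = q(c) + (x - c) r(x)
  with q(c) nonzero, hence has order 0.\<close>

lemma peval_zero:
  assumes "x \<in> carrier R" "x \<ominus> \<iota> c \<in> vset 1" "x \<ominus> \<iota> c \<noteq> \<zero>" "p \<noteq> 0"
  shows "peval x p \<noteq> \<zero>" "v (peval x p) = int (Polynomial.order c p) * v (x \<ominus> \<iota> c)"
proof -
  obtain q where q: "p = [:-c, 1:] ^ Polynomial.order c p * q" "\<not> [:-c, 1:] dvd q"
    using order_decomp[OF assms(4)] by blast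
  have x0: "x \<in> vset 0"
  proof -
    have "x = (x \<ominus> \<iota> c) \<oplus> \<iota> c" using assms(1) const_closed[of c] by algebra
    then show ?thesis using assms(2) by (metis const_vset vset_add vset_mono zero_le_one)
  qed
  have qc: "poly q c \<noteq> 0" using q(2) by (simp add: poly_eq_0_iff_dvd)
  have lin: "peval x [:-c, 1:] = x \<ominus> \<iota> c"
    using assms(1) by (simp add: peval_pCons const_uminus minus_eq a_comm)
  obtain r where "q - [:poly q c:] = [:-c, 1:] * r"
    by (metis poly_eq_0_iff_dvd dvdE poly_diff poly_pCons poly_0 mult_zero_right add_0_right diff_self)
  then have r: "q = [:poly q c:] + [:-c, 1:] * r" by (metis add.commute diff_add_cancel)
  have "peval x q = \<iota> (poly q c) \<oplus> (x \<ominus> \<iota> c) \<otimes> peval x r"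
    using assms(1) by (subst r) (simp add: peval_add peval_mult lin peval_const del: mult_pCons_left)
  moreover have "(x \<ominus> \<iota> c) \<otimes> peval x r \<in> vset 1"
    using vset_mult[OF assms(2) peval_vset[OF x0], of r] by simp
  ultimately have pq: "peval x q \<noteq> \<zero>" "v (peval x q) = 0"
    using val_add_strict[of "\<iota> (poly q c)" 1 "(x \<ominus> \<iota> c) \<otimes> peval x r"] qc by (auto simp: val_const)
  have p: "peval x p = (x \<ominus> \<iota> c) [^] Polynomial.order c p \<otimes> peval x q"
    using assms(1) by (subst q(1)) (simp add: peval_mult peval_power lin)
  show "peval x p \<noteq> \<zero>" using p pq assms by (auto simp: integral_iff)
  show "v (peval x p) = int (Polynomial.order c p) * v (x \<ominus> \<iota> c)"
    unfolding p using pq assms by (simp add: val_mult val_pow)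
qed

end

context discrete_valuation
begin

text \<open>A single term of order below \<open>n\<close> cannot be cancelled by terms of order at
  least \<open>n\<close>. Only indices below both lengths matter, because \<open>combine\<close>
  stops at the end of the shorter list.\<close>

lemma val_combine_strict:
  assumes "set Ks \<subseteq> carrier R" "set Us \<subseteq> carrier R" "j < length Ks" "j < length Us"
    and "Ks ! j \<otimes> Us ! j \<noteq> \<zero>" "v (Ks ! j \<otimes> Us ! j) < n"
    and "\<And>i. \<lbrakk>i < length Ks; i < length Us; i \<noteq> j\<rbrakk> \<Longrightarrow> Ks ! i \<otimes> Us ! i \<in> vset n"
  shows "combine Ks Us \<noteq> \<zero> \<and> v (combine Ks Us) = v (Ks ! j \<otimes> Us ! j)"
  using assms
proof (induction Ks Us arbitrary: j rule: combine.induct)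
  case (1 k Ks u Us)
  have car: "k \<in> carrier R" "u \<in> carrier R" "combine Ks Us \<in> carrier R" using "1.prems" by auto
  show ?case
  proof (cases j)
    case 0
    have "combine Ks Us \<in> vset n"
    proof -
      have "\<And>i. \<lbrakk>i < length Ks; i < length Us\<rbrakk> \<Longrightarrow> Ks ! i \<otimes> Us ! i \<in> vset n"
        using "1.prems"(7)[of "Suc i" for i] 0 by auto
      then show ?thesis
      proof (induction Ks Us rule: combine.induct)
        case (1 k Ks u Us)
        from "1.prems"[of 0] have "k \<otimes> u \<in> vset n" by simp
        moreover have "combine Ks Us \<in> vset n"
          using "1.prems"[of "Suc i" for i] by (intro "1.IH") auto
        ultimately show ?case by (simp add: vset_add)
      qed auto
    qed
    then show ?thesis using val_add_strict[of "k \<otimes> u" n "combine Ks Us"] "1.prems" car 0 by auto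
  next
    case (Suc j')
    have "combine Ks Us \<noteq> \<zero> \<and> v (combine Ks Us) = v (Ks ! j' \<otimes> Us ! j')"
      using "1.prems" "1.prems"(7)[of "Suc i" for i] Suc by (intro "1.IH") auto
    moreover have "k \<otimes> u \<in> vset n" using "1.prems"(7)[of 0] Suc by simp
    ultimately show ?thesis
      using val_add_strict[of "combine Ks Us" n "k \<otimes> u"] "1.prems" car Suc by (simp add: a_comm)
  qed
qed auto

end

section \<open>Families of valuations\<close>

text \<open>What is kept of a nonsingular curve: one valuation per point, and functions that are
  units at one point of a finite set and vanish at its other points.
  \<open>curve_model_ord_at\<close> supplies the instances.\<close>

locale curve_model = field_over R \<iota> for R (structure) and \<iota> :: "'k::field \<Rightarrow> 'a" +
  fixes Pts :: "'p set" and \<nu> :: "'p \<Rightarrow> 'a \<Rightarrow> int"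
  assumes val: "P \<in> Pts \<Longrightarrow> discrete_valuation R \<iota> (\<nu> P)"
    and separation: "\<lbrakk>finite S; S \<subseteq> Pts; P \<in> S\<rbrakk> \<Longrightarrow>
      \<exists>u \<in> carrier R - {\<zero>}. \<nu> P u = 0 \<and> (\<forall>Q \<in> S - {P}. 1 \<le> \<nu> Q u)"
begin

text \<open>A uniformizer \<open>t\<close> at \<open>P\<close> contributes the order
  \<open>j\<close> there; a high power of the separating function \<open>u\<close>, a unit at
  \<open>P\<close>, outweighs any poles of \<open>t [^] j\<close> at the other points.\<close>

lemma approximation:
  assumes "finite S" "S \<subseteq> Pts" "P \<in> S"
  shows "\<exists>y \<in> carrier R - {\<zero>}. \<nu> P y = int j \<and> (\<forall>Q \<in> S - {P}. N \<le> \<nu> Q y)"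
proof -
  interpret P: discrete_valuation R \<iota> "\<nu> P" using assms val by blast
  obtain t where t: "t \<in> carrier R" "t \<noteq> \<zero>" "\<nu> P t = 1" using P.val_uniformizer by auto
  obtain u where u: "u \<in> carrier R" "u \<noteq> \<zero>" "\<nu> P u = 0" "\<And>Q. Q \<in> S - {P} \<Longrightarrow> 1 \<le> \<nu> Q u"
    using separation[OF assms] by auto
  \<comment> \<open>Summing over \<open>S\<close> gives one exponent that covers the deficit at
    every single point \<open>Q\<close>.\<close>
  define m where "m = nat (\<Sum>Q\<in>S. \<bar>N - int j * \<nu> Q t\<bar>)"
  have "N \<le> \<nu> Q (t [^] j \<otimes> u [^] m)" if Q: "Q \<in> S - {P}" for Q
  proof -
    interpret Q: discrete_valuation R \<iota> "\<nu> Q" using assms val Q by blast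
    have "\<bar>N - int j * \<nu> Q t\<bar> \<le> int m"
      unfolding m_def using Q assms(1) member_le_sum[of Q S "\<lambda>Q. \<bar>N - int j * \<nu> Q t\<bar>"]
      by (simp add: sum_nonneg)
    moreover have "int m * 1 \<le> int m * \<nu> Q u"
      using u(4)[OF Q] by (intro mult_left_mono) auto
    moreover have "\<nu> Q (t [^] j \<otimes> u [^] m) = int j * \<nu> Q t + int m * \<nu> Q u"
      using t u by (simp add: Q.val_mult Q.val_pow)
    ultimately show ?thesis by linarith
  qed
  moreover have "\<nu> P (t [^] j \<otimes> u [^] m) = int j"
    using t u by (simp add: P.val_mult P.val_pow)
  moreover have "t [^] j \<otimes> u [^] m \<in> carrier R - {\<zero>}"
    using t u by (simp add: integral_iff)
  ultimately show ?thesis by blast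
qed

text \<open>The easy half of \<open>\<Sum> e\<^sub>P f\<^sub>P = n\<close>: elements \<open>y\<^bsub>P,j\<^esub>\<close> of order \<open>j < e\<^sub>P\<close> at \<open>P\<close>
  and of order at least \<open>e\<^sub>Q\<close> at the other points \<open>Q\<close> are linearly independent over \<open>L\<close>.\<close>

lemma sum_ramification_le:
  assumes L: "subfield L R" and S: "finite S" "S \<subseteq> Pts"
    and ram: "\<And>a. a \<in> L - {\<zero>} \<Longrightarrow> \<exists>k::int. \<forall>P\<in>S. \<nu> P a = k * int (e P)"
    and dim: "dimension n L (carrier R)"
  shows "(\<Sum>P\<in>S. e P) \<le> n"
proof -
  define I where "I = (SIGMA P:S. {..<e P})"
  \<comment> \<open>A common bound for all \<open>e P\<close>: an order of at least \<open>B\<close>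
    at \<open>P\<close> exceeds every \<open>j < e P\<close>.\<close>
  define B where "B = (\<Sum>P\<in>S. e P)"
  have eB: "e P \<le> B" if "P \<in> S" for P
    unfolding B_def using that S by (simp add: member_le_sum)
  have "\<forall>i\<in>I. \<exists>y \<in> carrier R - {\<zero>}. \<nu> (fst i) y = int (snd i) \<and>
      (\<forall>Q \<in> S - {fst i}. int B \<le> \<nu> Q y)"
    using approximation[OF S] by (auto simp: I_def)
  then obtain y where y: "\<And>i. i \<in> I \<Longrightarrow> y i \<in> carrier R - {\<zero>}"
      "\<And>i. i \<in> I \<Longrightarrow> \<nu> (fst i) (y i) = int (snd i)"
      "\<And>i Q. i \<in> I \<Longrightarrow> Q \<in> S - {fst i} \<Longrightarrow> int B \<le> \<nu> Q (y i)"
    by metis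
  \<comment> \<open>One factor \<open>k a\<close> serves all points of \<open>S\<close>: over a
    fibre it is the order of \<open>a\<close> at the point below.\<close>
  obtain k :: "'a \<Rightarrow> int" where k: "\<And>a P. a \<in> L - {\<zero>} \<Longrightarrow> P \<in> S \<Longrightarrow> \<nu> P a = k a * int (e P)"
    using ram by metis
  have "finite I" unfolding I_def using S by auto
  then obtain Is where Is: "set Is = I" "distinct Is" using finite_distinct_list by blast
  have LR: "L \<subseteq> carrier R" using L by (rule subfieldE(3))
  have yR: "set (map y Is) \<subseteq> carrier R" using y(1) Is by auto
  have "independent L (map y Is)"
  proof (rule trivial_combine_imp_independent[OF L yR], rule ccontr)
    fix Ks assume Ks: "set Ks \<subseteq> L" "combine Ks (map y Is) = \<zero>"
      and nz: "\<not> set (take (length (map y Is)) Ks) \<subseteq> {\<zero>}"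
    define J where "J = {i. i < length Is \<and> i < length Ks \<and> Ks ! i \<noteq> \<zero>}"
    have "J \<noteq> {}" using nz by (auto simp: J_def set_conv_nth)
    moreover have "finite J" by (simp add: J_def)
    \<comment> \<open>Since \<open>j < e P \<le> B\<close>, minimising \<open>f\<close> minimises
      the pair of \<open>k\<close> and \<open>j\<close> lexicographically. At the point belonging to
      a minimising index \<open>m\<close>, the term with index \<open>m\<close> has strictly smaller
      order than all other nonzero terms.\<close>
    moreover define f where "f i = k (Ks ! i) * int B + int (snd (Is ! i))" for i
    ultimately have "Min (f ` J) \<in> f ` J" "\<And>i. i \<in> J \<Longrightarrow> Min (f ` J) \<le> f i" by auto
    then obtain m where m: "m \<in> J" "\<And>i. i \<in> J \<Longrightarrow> f m \<le> f i" by (metis imageE)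
    define P j where "P = fst (Is ! m)" and "j = snd (Is ! m)"
    have mI: "Is ! m \<in> I" using m(1) Is by (auto simp: J_def)
    then have P: "P \<in> S" "j < e P" by (auto simp: I_def P_def j_def)
    interpret P: discrete_valuation R \<iota> "\<nu> P" using P S val by blast
    have trm: "Ks ! i \<in> L - {\<zero>} \<and> y (Is ! i) \<in> carrier R - {\<zero>} \<and> Ks ! i \<in> carrier R \<and>
        \<nu> P (Ks ! i \<otimes> y (Is ! i)) = k (Ks ! i) * int (e P) + \<nu> P (y (Is ! i))" if "i \<in> J" for i
    proof -
      have "Ks ! i \<in> L - {\<zero>}" using that Ks by (auto simp: J_def)
      moreover have "y (Is ! i) \<in> carrier R - {\<zero>}" using that Is nth_mem[of i Is] by (intro y(1)) (auto simp: J_def)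
      ultimately show ?thesis using LR k P(1) by (auto simp: P.val_mult)
    qed
    have val_m: "\<nu> P (Ks ! m \<otimes> y (Is ! m)) = k (Ks ! m) * int (e P) + int j"
      using trm[OF m(1)] y(2)[OF mI] by (simp add: P_def j_def)
    have "combine Ks (map y Is) \<noteq> \<zero> \<and>
        \<nu> P (combine Ks (map y Is)) = \<nu> P (Ks ! m \<otimes> map y Is ! m)"
    proof (rule P.val_combine_strict[where n = "k (Ks ! m) * int (e P) + int j + 1"])
      show "set Ks \<subseteq> carrier R" "set (map y Is) \<subseteq> carrier R" using Ks LR yR by auto
      show "m < length Ks" "m < length (map y Is)" using m by (auto simp: J_def)
      show "Ks ! m \<otimes> map y Is ! m \<noteq> \<zero>" using trm[OF m(1)] m(1) by (auto simp: integral_iff J_def)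
      show "\<nu> P (Ks ! m \<otimes> map y Is ! m) < k (Ks ! m) * int (e P) + int j + 1"
        using val_m m(1) by (simp add: J_def)
      show "Ks ! i \<otimes> map y Is ! i \<in> P.vset (k (Ks ! m) * int (e P) + int j + 1)"
        if i: "i < length Ks" "i < length (map y Is)" "i \<noteq> m" for i
      proof (cases "Ks ! i = \<zero>")
        case True
        have "y (Is ! i) \<in> carrier R" using i y(1)[of "Is ! i"] Is nth_mem[of i Is] by auto
        then show ?thesis using True i by simp
      next
        case False
        then have iJ: "i \<in> J" using i by (simp add: J_def)
        have iI: "Is ! i \<in> I" using i Is nth_mem[of i Is] by auto
        define Q j' where "Q = fst (Is ! i)" and "j' = snd (Is ! i)"
        have Q: "Q \<in> S" "j' < e Q" using iI by (auto simp: I_def Q_def j'_def)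
        have neq: "Is ! i \<noteq> Is ! m"
          using i m(1) Is by (auto simp: J_def nth_eq_iff_index_eq)
        have le: "k (Ks ! m) * int B + int j \<le> k (Ks ! i) * int B + int j'"
          using m(2)[OF iJ] by (simp add: f_def j_def j'_def)
        have "k (Ks ! m) \<le> k (Ks ! i)"
        proof (rule ccontr)
          assume "\<not> ?thesis"
          then have "(k (Ks ! i) + 1) * int B \<le> k (Ks ! m) * int B"
            by (intro mult_right_mono) auto
          then show False using le Q eB[OF Q(1)] by (simp add: algebra_simps)
        qed
        then consider "k (Ks ! m) = k (Ks ! i)" | "k (Ks ! m) + 1 \<le> k (Ks ! i)" by linarith
        \<comment> \<open>Equal \<open>k\<close>: at the same point \<open>j < j'\<close>, while at
          another point the order of \<open>y\<close> is at least \<open>B\<close>, hence above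
          \<open>j\<close>. Larger \<open>k\<close>: the gain of \<open>e P\<close> alone exceeds
          \<open>j\<close>.\<close>
        then have "k (Ks ! m) * int (e P) + int j + 1 \<le> k (Ks ! i) * int (e P) + \<nu> P (y (Is ! i))"
        proof cases
          case 1
          show ?thesis
          proof (cases "Q = P")
            case True
            then have "j \<noteq> j'" using neq by (auto simp: P_def Q_def j_def j'_def prod_eq_iff)
            then have "j < j'" using le 1 by simp
            then show ?thesis using 1 y(2)[OF iI] True by (simp add: Q_def j'_def)
          next
            case False
            then have "int B \<le> \<nu> P (y (Is ! i))" using y(3)[OF iI, of P] P by (simp add: Q_def)
            then show ?thesis using 1 eB[OF P(1)] P by simp
          qed
        next
          case 2
          then have "(k (Ks ! m) + 1) * int (e P) \<le> k (Ks ! i) * int (e P)"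
            by (intro mult_right_mono) auto
          moreover have "0 \<le> \<nu> P (y (Is ! i))"
          proof (cases "Q = P")
            case True
            then show ?thesis using y(2)[OF iI] by (simp add: Q_def)
          next
            case False
            then have "int B \<le> \<nu> P (y (Is ! i))" using y(3)[OF iI, of P] P by (simp add: Q_def)
            then show ?thesis by simp
          qed
          ultimately show ?thesis using P by (simp add: algebra_simps)
        qed
        then show ?thesis using trm[OF iJ] i by (auto intro!: P.vsetI)
      qed
    qed
    then show False using Ks by simp
  qed
  then have "length (map y Is) \<le> n"
    using independent_length_le_dimension[OF L dim] yR by blast
  moreover have "length Is = (\<Sum>P\<in>S. e P)"
    using Is distinct_card[of Is] S by (simp add: I_def)
  ultimately show ?thesis by simp
qed

text \<open>Every index is at least 1, so \<open>Suc n\<close> points would already violate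
  \<open>sum_ramification_le\<close>; an infinite \<open>S\<close> contains that many.\<close>

lemma fibre_finite:
  assumes L: "subfield L R" and S: "S \<subseteq> Pts"
    and e: "\<And>P. P \<in> S \<Longrightarrow> 1 \<le> e P"
    and ram: "\<And>a. a \<in> L - {\<zero>} \<Longrightarrow> \<exists>k::int. \<forall>P\<in>S. \<nu> P a = k * int (e P)"
    and dim: "dimension n L (carrier R)"
  shows "finite S" "(\<Sum>P\<in>S. e P) \<le> n"
proof -
  show "finite S"
  proof (rule ccontr)
    assume "infinite S"
    then obtain T where T: "T \<subseteq> S" "finite T" "card T = Suc n" by (meson infinite_arbitrarily_large)
    have "(\<Sum>P\<in>T. e P) \<le> n"
      using T S ram by (intro sum_ramification_le[OF L _ _ _ dim]) (auto, meson subsetD)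
    moreover have "(\<Sum>P\<in>T. 1) \<le> (\<Sum>P\<in>T. e P)" using T e by (intro sum_mono) auto
    ultimately show False using T by simp
  qed
  then show "(\<Sum>P\<in>S. e P) \<le> n" by (rule sum_ramification_le[OF L _ S ram dim])
qed

end

section \<open>Degrees of divisors and induction over effective divisors\<close>

lemma divisor_degree_superset:
  assumes "finite A" "keys D \<subseteq> A"
  shows "divisor_degree D = (\<Sum>P\<in>A. lookup D P)"
  unfolding divisor_degree_def
  using assms by (intro sum.mono_neutral_left) (auto simp: in_keys_iff)

lemma divisor_degree_add: "divisor_degree (C + D) = divisor_degree C + divisor_degree D"
  using divisor_degree_superset[of "keys C \<union> keys D"]
  by (simp add: keys_add lookup_add sum.distrib)

lemma divisor_degree_single [simp]: "divisor_degree (single P k) = k"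
  by (simp add: divisor_degree_def)

lemma divisor_degree_0 [simp]: "divisor_degree 0 = 0"
  by (simp add: divisor_degree_def)

lemma divisor_degree_nonneg: "(\<And>P. 0 \<le> lookup D P) \<Longrightarrow> 0 \<le> divisor_degree D"
  by (simp add: divisor_degree_def sum_nonneg)

text \<open>Induction on the degree: a point of the support has coefficient at least 1, so it can be
  taken off once without losing effectivity.\<close>

lemma effective_divisor_induct [consumes 2, case_names zero add_point]:
  fixes D :: "'p \<Rightarrow>\<^sub>0 int"
  assumes "\<And>P. 0 \<le> lookup D P" "keys D \<subseteq> X"
    and "Q 0"
    and step: "\<And>D P. \<lbrakk>\<And>P. 0 \<le> lookup D P; keys D \<subseteq> X; P \<in> X; Q D\<rbrakk> \<Longrightarrow>
      Q (D + single P 1)"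
  shows "Q D"
  using assms(1,2)
proof (induction "nat (divisor_degree D)" arbitrary: D rule: less_induct)
  case less
  show ?case
  proof (cases "D = 0")
    case True
    then show ?thesis using assms(3) by simp
  next
    case False
    then obtain P where P: "P \<in> keys D" by (metis keys_eq_empty ex_in_conv)
    define C where "C = D - single P 1"
    have DC: "D = C + single P 1" by (simp add: C_def)
    have ge: "1 \<le> lookup D P"
      using P less.prems(1)[of P] by (simp add: in_keys_iff)
    have C0: "0 \<le> lookup C R" for R
      using ge less.prems(1)[of R] by (simp add: C_def lookup_minus lookup_single when_def)
    moreover have CX: "keys C \<subseteq> X"
      using P less.prems(2) unfolding C_def
      by (auto simp: in_keys_iff lookup_minus lookup_single when_def split: if_splits)
    moreover have "nat (divisor_degree C) < nat (divisor_degree D)"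
      using divisor_degree_nonneg[of C] C0 DC by (simp add: divisor_degree_add)
    ultimately have "Q C" by (intro less.hyps)
    then show ?thesis unfolding DC using C0 CX P less.prems(2) by (intro step) auto
  qed
qed

section \<open>Riemann-Roch spaces\<close>

context curve_model
begin

definition RR :: "('p \<Rightarrow>\<^sub>0 int) \<Rightarrow> 'a set" where
  "RR D = {a \<in> carrier R. a = \<zero> \<or> (\<forall>P\<in>Pts. - lookup D P \<le> \<nu> P a)}"

lemma RR_iff:
  "a \<in> RR D \<longleftrightarrow> a \<in> carrier R \<and>
     (\<forall>P\<in>Pts. a \<in> discrete_valuation.vset R (\<nu> P) (- lookup D P))"
  using discrete_valuation.vset_def[OF val] by (auto simp: RR_def)

lemma RR_add:
  assumes "a \<in> RR D" "b \<in> RR D"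
  shows "a \<oplus> b \<in> RR D"
  using assms discrete_valuation.vset_add[OF val] by (auto simp: RR_iff)

lemma RR_const_mult:
  assumes "a \<in> RR D"
  shows "\<iota> c \<otimes> a \<in> RR D"
  using assms discrete_valuation.vset_const_mult[OF val] by (auto simp: RR_iff)

lemma RR_mono:
  assumes "a \<in> RR D" "\<And>P. P \<in> Pts \<Longrightarrow> lookup D P \<le> lookup D' P"
  shows "a \<in> RR D'"
  using assms by (force simp: RR_def)

lemma RR_add_point_mono: "RR D \<subseteq> RR (D + single P 1)"
  by (auto intro!: RR_mono[of _ D] simp: lookup_add lookup_single when_def)

lemma Span_RR: "set Us \<subseteq> RR D \<Longrightarrow> Span (range \<iota>) Us \<subseteq> RR D"
proof (induction Us)
  case Nil
  then show ?case by (simp add: RR_def)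
next
  case (Cons u Us)
  then show ?case by (auto simp: line_extension_mem_iff intro!: RR_add RR_const_mult)
qed

text \<open>If the space grows, a new element \<open>z\<close> has at \<open>P\<close> exactly one
  order less than was allowed before. For any \<open>a\<close> of the larger space the quotient of
  \<open>a\<close> by \<open>z\<close> has a residue \<open>c\<close> at \<open>P\<close>, and
  \<open>a \<ominus> \<iota> c \<otimes> z\<close> falls back into the old space.\<close>

lemma dimension_RR_add_point:
  assumes P: "P \<in> Pts" and dim: "dimension n (range \<iota>) (RR D)"
  shows "\<exists>m\<le>Suc n. dimension m (range \<iota>) (RR (D + single P 1))"
proof (cases "RR (D + single P 1) \<subseteq> RR D")
  case True
  moreover note RR_add_point_mono[of D P]
  ultimately have "RR (D + single P 1) = RR D" by blast
  then show ?thesis using dim by (intro exI[of _ n]) simp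
next
  case False
  let ?D = "D + single P 1"
  interpret P: discrete_valuation R \<iota> "\<nu> P" by (rule val[OF P])
  from False obtain z where z: "z \<in> RR ?D" "z \<notin> RR D" by blast
  have zR: "z \<in> carrier R" "z \<noteq> \<zero>" using z by (auto simp: RR_def)
  have vz: "\<nu> P z = - lookup D P - 1"
  proof -
    have ge: "- lookup ?D Q \<le> \<nu> Q z" if "Q \<in> Pts" for Q
      using z(1) zR that by (auto simp: RR_def)
    obtain Q where Q: "Q \<in> Pts" "\<nu> Q z < - lookup D Q"
      using z(2) zR by (force simp: RR_def)
    then have "Q = P" using ge[of Q] by (auto simp: lookup_add lookup_single when_def split: if_splits)
    then show ?thesis using Q ge[of P] P by (simp add: lookup_add)
  qed
  have "RR ?D = line_extension (range \<iota>) z (RR D)"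
  proof
    show "line_extension (range \<iota>) z (RR D) \<subseteq> RR ?D"
      using z(1) subsetD[OF RR_add_point_mono]
      by (auto simp: line_extension_mem_iff intro!: RR_add RR_const_mult)
    show "RR ?D \<subseteq> line_extension (range \<iota>) z (RR D)"
    proof
      fix a assume a: "a \<in> RR ?D"
      then have aR: "a \<in> carrier R" by (simp add: RR_def)
      have aP: "a \<in> P.vset (- lookup D P - 1)"
        using a P by (auto simp: RR_iff lookup_add)
      have "inv z \<in> P.vset (lookup D P + 1)"
        using zR vz by (auto intro!: P.vsetI simp: P.val_inv)
      from P.vset_mult[OF aP this] obtain c where c: "a \<otimes> inv z \<ominus> \<iota> c \<in> P.vset 1"
        using P.vset_residue[of "a \<otimes> inv z"] by auto
      let ?b = "a \<ominus> \<iota> c \<otimes> z"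
      have "?b = (a \<otimes> inv z \<ominus> \<iota> c) \<otimes> z"
      proof -
        have "(a \<otimes> inv z \<ominus> \<iota> c) \<otimes> z = a \<otimes> (inv z \<otimes> z) \<ominus> \<iota> c \<otimes> z"
          using aR zR(1) inv_closed'[OF zR] const_closed[of c] by algebra
        then show ?thesis using aR zR by simp
      qed
      moreover have "z \<in> P.vset (- lookup D P - 1)"
        using zR vz by (auto intro: P.vsetI)
      ultimately have bP: "?b \<in> P.vset (- lookup D P)"
        using P.vset_mult[OF c, of z "- lookup D P - 1"] by simp
      have "?b = a \<oplus> \<iota> (- c) \<otimes> z" using aR zR
        by (simp add: const_uminus l_minus minus_eq)
      then have "?b \<in> RR ?D" using a z(1) by (simp add: RR_add RR_const_mult)
      then have "?b \<in> RR D"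
        using bP by (auto simp: RR_iff lookup_add lookup_single when_def split: if_splits)
      moreover have "a = \<iota> c \<otimes> z \<oplus> ?b" using aR zR(1) const_closed[of c] by algebra
      ultimately show "a \<in> line_extension (range \<iota>) z (RR D)"
        unfolding line_extension_mem_iff by blast
    qed
  qed
  then show ?thesis using Suc_dim[OF zR(1) z(2) dim] by auto
qed

text \<open>Carries finite dimension from \<open>D\<close> to every larger divisor and shows that
  degree minus dimension does not decrease on the way. This is how a divisor realising the genus is
  moved to a convenient place.\<close>

lemma dimension_RR_le:
  assumes "\<And>P. 0 \<le> lookup C P" "keys C \<subseteq> Pts"
    and "dimension n (range \<iota>) (RR D)"
  shows "\<exists>m. dimension m (range \<iota>) (RR (D + C)) \<and> int m \<le> int n + divisor_degree C"
  using assms(1,2)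
proof (induction rule: effective_divisor_induct)
  case zero
  then show ?case using assms(3) by auto
next
  case (add_point C P)
  then obtain m where m: "dimension m (range \<iota>) (RR (D + C))" "int m \<le> int n + divisor_degree C"
    by blast
  with dimension_RR_add_point[OF add_point(3) m(1)] show ?case
    by (fastforce simp: divisor_degree_add add.assoc)
qed

text \<open>If each point is a simple pole, and the only pole, of some \<open>f\<close>, then a
  power of \<open>f\<close> attains precisely the pole order that \<open>D + single P 1\<close>
  newly permits. The dimension thus grows at every point, as it does on a curve of genus 0.\<close>

lemma independent_RR:
  assumes poles: "\<And>P. P \<in> Pts \<Longrightarrow> \<exists>f \<in> carrier R - {\<zero>}. \<nu> P f = - 1 \<and> (\<forall>Q \<in> Pts - {P}. 0 \<le> \<nu> Q f)"
    and "\<And>P. 0 \<le> lookup D P" "keys D \<subseteq> Pts"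
  shows "\<exists>Us. independent (range \<iota>) Us \<and> set Us \<subseteq> RR D \<and> int (length Us) = divisor_degree D + 1"
  using assms(2,3)
proof (induction rule: effective_divisor_induct)
  case zero
  have "independent (range \<iota>) [\<one>]" by (intro li_Cons) auto
  moreover have "\<one> \<in> RR 0"
    using discrete_valuation.val_one[OF val] by (auto simp: RR_def)
  ultimately show ?case by (intro exI[of _ "[\<one>]"]) auto
next
  case (add_point D P)
  then obtain Us where Us: "independent (range \<iota>) Us" "set Us \<subseteq> RR D"
    "int (length Us) = divisor_degree D + 1" by blast
  obtain f where f: "f \<in> carrier R" "f \<noteq> \<zero>" "\<nu> P f = - 1" "\<And>Q. Q \<in> Pts - {P} \<Longrightarrow> 0 \<le> \<nu> Q f"
    using poles[OF add_point(3)] by auto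
  define g where "g = f [^] nat (lookup D P + 1)"
  have g: "g \<in> carrier R" "g \<noteq> \<zero>" using f by (auto simp: g_def)
  have gQ: "\<nu> Q g = (lookup D P + 1) * \<nu> Q f" if "Q \<in> Pts" for Q
    using discrete_valuation.val_pow[OF val[OF that] f(1,2), of "nat (lookup D P + 1)"]
      add_point(1)[of P]
    unfolding g_def by (simp del: pow_nat)
  have "g \<notin> RR D" using gQ[OF add_point(3)] g add_point(3) f(3) by (force simp: RR_def)
  moreover have "g \<in> RR (D + single P 1)"
  proof -
    have "- lookup (D + single P 1) Q \<le> \<nu> Q g" if Q: "Q \<in> Pts" for Q
    proof (cases "Q = P")
      case True
      then show ?thesis using gQ[OF Q] f(3) by (simp add: lookup_add)
    next
      case False
      then have "0 \<le> \<nu> Q g" using gQ[OF Q] f(4)[of Q] Q add_point(1)[of P] by simp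
      then show ?thesis using False add_point(1)[of Q] by (simp add: lookup_add lookup_single)
    qed
    then show ?thesis using g by (simp add: RR_def)
  qed
  moreover note RR_add_point_mono[of D P]
  ultimately have "independent (range \<iota>) (g # Us)" "set (g # Us) \<subseteq> RR (D + single P 1)"
    using Us Span_RR[OF Us(2)] g by (auto intro!: li_Cons)
  then show ?case using Us(3) by (intro exI[of _ "g # Us"]) (simp add: divisor_degree_add)
qed

text \<open>Every point of a rational function field \<open>K(t)\<close> is a simple zero of some \<open>t - c\<close> or a
  simple pole of \<open>t\<close>, and separation of points makes that zero or pole unique.\<close>

lemma rational_simple_pole:
  assumes t: "t \<in> carrier R"
    and rat: "\<And>a. a \<in> carrier R \<Longrightarrow> \<exists>p q. peval t q \<noteq> \<zero> \<and> a = peval t p \<otimes> inv (peval t q)"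
    and P: "P \<in> Pts"
  shows "\<exists>f \<in> carrier R - {\<zero>}. \<nu> P f = - 1 \<and> (\<forall>Q \<in> Pts - {P}. 0 \<le> \<nu> Q f)"
proof -
  interpret P: discrete_valuation R \<iota> "\<nu> P" by (rule val[OF P])
  \<comment> \<open>If all orders at \<open>P\<close> and \<open>Q\<close> are common multiples of
    those of \<open>f\<close>, then an element of order 1 forces \<open>f\<close> to have order 1 at
    \<open>P\<close>. A function of order 0 at \<open>P\<close> and positive order at
    \<open>Q\<close> would need the factor \<open>k = 0\<close>, so \<open>Q = P\<close>.\<close>
  have unique: "s = 1 \<and> Q = P"
    if Q: "Q \<in> Pts" and s: "\<nu> P f = s" "0 < s" "0 < \<nu> Q f"
      and pow: "\<And>a. a \<in> carrier R - {\<zero>} \<Longrightarrow> \<exists>k. \<nu> P a = k * \<nu> P f \<and> \<nu> Q a = k * \<nu> Q f" for Q f s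
  proof
    obtain a where "a \<in> carrier R - {\<zero>}" "\<nu> P a = 1" using P.val_uniformizer by blast
    then obtain k where "k * s = 1" using pow s by metis
    then show "s = 1" using s(2) by (metis mult.commute pos_zmult_eq_1_iff)
    show "Q = P"
    proof (rule ccontr)
      assume "Q \<noteq> P"
      then obtain u where "u \<in> carrier R - {\<zero>}" "\<nu> P u = 0" "1 \<le> \<nu> Q u"
        using separation[of "{P, Q}" P] P Q by auto
      then obtain k where "\<nu> P u = k * \<nu> P f" "\<nu> Q u = k * \<nu> Q f" using pow by blast
      then show False using s \<open>\<nu> P u = 0\<close> \<open>1 \<le> \<nu> Q u\<close> by auto
    qed
  qed
  show ?thesis
  proof (cases "t \<in> P.vset 0")
    case False
    have tnz: "t \<noteq> \<zero>" and neg: "\<nu> P t < 0" using False t by (auto simp: P.vset_def)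
    have pow: "\<exists>k. \<nu> P a = k * \<nu> P (inv t) \<and> \<nu> Q a = k * \<nu> Q (inv t)"
      if Q: "Q \<in> Pts" "\<nu> Q t < 0" and a: "a \<in> carrier R - {\<zero>}" for Q a
    proof -
      interpret Q: discrete_valuation R \<iota> "\<nu> Q" by (rule val[OF Q(1)])
      obtain p q where pq: "peval t q \<noteq> \<zero>" "a = peval t p \<otimes> inv (peval t q)" using rat[of a] a by blast
      then have "peval t p \<noteq> \<zero>" using a t by auto
      then have "p \<noteq> 0" "q \<noteq> 0" using pq by auto
      then have "\<nu> P a = (int (degree q) - int (degree p)) * \<nu> P (inv t)"
          "\<nu> Q a = (int (degree q) - int (degree p)) * \<nu> Q (inv t)"
        using pq \<open>peval t p \<noteq> \<zero>\<close> t tnz P.peval_pole[OF t tnz neg] Q.peval_pole[OF t tnz Q(2)]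
        by (auto simp: P.val_mult P.val_inv Q.val_mult Q.val_inv algebra_simps)
      then show ?thesis by blast
    qed
    have "\<nu> P t = - 1" 
      using unique[OF P refl _ _ pow[OF P neg]] neg t tnz by (simp add: P.val_inv)
    moreover have "0 \<le> \<nu> Q t" if Q: "Q \<in> Pts - {P}" for Q
    proof (rule ccontr)
      assume *: "\<not> ?thesis"
      interpret Q: discrete_valuation R \<iota> "\<nu> Q" using Q by (intro val) auto
      have QP: "Q \<in> Pts" and Qneg: "\<nu> Q t < 0" using Q * by auto
      have "Q = P"
        using unique[OF QP refl _ _ pow[OF QP Qneg]] neg t tnz Qneg by (simp add: P.val_inv Q.val_inv)
      then show False using Q by simp
    qed
    ultimately show ?thesis using t tnz by blast
  next
    case True
    then obtain c where c: "t \<ominus> \<iota> c \<in> P.vset 1" using P.vset_residue by blast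
    let ?s = "t \<ominus> \<iota> c"
    have s: "?s \<in> carrier R" using t by simp
    \<comment> \<open>Were \<open>t\<close> a constant, every element would be one, against the
      existence of an element of order 1 at \<open>P\<close>.\<close>
    have nz: "?s \<noteq> \<zero>"
    proof
      assume "?s = \<zero>"
      then have tc: "t = \<iota> c" using t by (metis const_closed r_right_minus_eq)
      have "peval t p = \<iota> (poly p c)" for p
        by (induction p) (auto simp: tc peval_pCons const_mult const_add)
      then have const: "peval t p \<in> range \<iota>" for p by simp
      have "a \<in> range \<iota>" if "a \<in> carrier R" for a
      proof -
        obtain p q where "peval t q \<noteq> \<zero>" "a = peval t p \<otimes> inv (peval t q)" using rat[of a] \<open>a \<in> carrier R\<close> by blast
        moreover obtain d e where "peval t p = \<iota> d" "peval t q = \<iota> e" using const by blast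
        ultimately show ?thesis by (auto simp flip: const_inverse const_mult)
      qed
      then show False using P.val_uniformizer P.val_const by fastforce
    qed
    have pow: "\<exists>k. \<nu> P a = k * \<nu> P ?s \<and> \<nu> Q a = k * \<nu> Q ?s"
      if Q: "Q \<in> Pts" "0 < \<nu> Q ?s" and a: "a \<in> carrier R - {\<zero>}" for Q a
    proof -
      interpret Q: discrete_valuation R \<iota> "\<nu> Q" by (rule val[OF Q(1)])
      have cQ: "?s \<in> Q.vset 1" using Q s by (auto intro: Q.vsetI)
      obtain p q where pq: "peval t q \<noteq> \<zero>" "a = peval t p \<otimes> inv (peval t q)" using rat[of a] a by blast
      then have "peval t p \<noteq> \<zero>" using a t by auto
      then have "p \<noteq> 0" "q \<noteq> 0" using pq by auto
      then have "\<nu> P a = (int (Polynomial.order c p) - int (Polynomial.order c q)) * \<nu> P ?s"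
          "\<nu> Q a = (int (Polynomial.order c p) - int (Polynomial.order c q)) * \<nu> Q ?s"
        using pq \<open>peval t p \<noteq> \<zero>\<close> t P.peval_zero[OF t c nz] Q.peval_zero[OF t cQ nz]
        by (auto simp: P.val_mult P.val_inv Q.val_mult Q.val_inv algebra_simps)
      then show ?thesis by blast
    qed
    have pos: "0 < \<nu> P ?s" using c nz by (auto simp: P.vset_def)
    have "\<nu> P (inv ?s) = - 1"
      using unique[OF P refl pos pos pow[OF P pos]] s nz by (simp add: P.val_inv)
    moreover have "0 \<le> \<nu> Q (inv ?s)" if Q: "Q \<in> Pts - {P}" for Q
    proof (rule ccontr)
      assume *: "\<not> ?thesis"
      interpret Q: discrete_valuation R \<iota> "\<nu> Q" using Q by (intro val) auto
      have QP: "Q \<in> Pts" and Qpos: "0 < \<nu> Q ?s" using Q * s nz by (auto simp: Q.val_inv)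
      have "Q = P" using unique[OF QP refl pos Qpos pow[OF QP Qpos]] by simp
      then show False using Q by simp
    qed
    ultimately show ?thesis using s nz by (intro bexI[of _ "inv ?s"]) auto
  qed
qed

end

lemma ex_poly_mapping:
  assumes "finite S" "\<And>x. x \<notin> S \<Longrightarrow> f x = (0::int)"
  obtains D where "lookup D = f" "keys D \<subseteq> S"
proof
  have "finite {x. f x \<noteq> 0}" using assms by (auto intro: finite_subset)
  then show *: "lookup (Abs_poly_mapping f) = f" by simp
  then show "keys (Abs_poly_mapping f) \<subseteq> S"
    using assms(2) by (metis in_keys_iff subsetI)
qed

section \<open>Dimension under scaling, and nested subfields of index 2\<close>

context field_over
begin

lemma dimension_mult:
  assumes "dimension n K E" "subfield K R" "x \<in> carrier R" "x \<noteq> \<zero>"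
  shows "dimension n K ((\<lambda>a. a \<otimes> x) ` E)"
  using assms
proof (induction rule: dimension.induct)
  case (zero_dim K)
  then show ?case by simp
next
  case (Suc_dim v E n K)
  have E: "E \<subseteq> carrier R" using space_subgroup_props(1)[OF Suc_dim.prems(1) Suc_dim.hyps(3)] .
  have K: "K \<subseteq> carrier R" using Suc_dim.prems(1) by (rule subfieldE(3))
  have "v \<otimes> x \<notin> (\<lambda>a. a \<otimes> x) ` E"
  proof
    assume "v \<otimes> x \<in> (\<lambda>a. a \<otimes> x) ` E"
    then obtain a where "a \<in> E" "v \<otimes> x = a \<otimes> x" by blast
    then have "v = a" using m_rcancel[of x v a] Suc_dim E by auto
    then show False using Suc_dim \<open>a \<in> E\<close> by simp
  qed
  moreover have "(\<lambda>a. a \<otimes> x) ` line_extension K v E = line_extension K (v \<otimes> x) ((\<lambda>a. a \<otimes> x) ` E)"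
  proof -
    have "(k \<otimes> v \<oplus> a) \<otimes> x = k \<otimes> (v \<otimes> x) \<oplus> a \<otimes> x" if "k \<in> K" "a \<in> E" for k a
      using that subsetD[OF K, of k] subsetD[OF E, of a] Suc_dim by (simp add: l_distr m_assoc)
    note eq = this
    show ?thesis
    proof (intro equalityI subsetI)
      fix b assume "b \<in> (\<lambda>a. a \<otimes> x) ` line_extension K v E"
      then obtain k a where "k \<in> K" "a \<in> E" "b = (k \<otimes> v \<oplus> a) \<otimes> x"
        by (auto simp: line_extension_mem_iff)
      then show "b \<in> line_extension K (v \<otimes> x) ((\<lambda>a. a \<otimes> x) ` E)"
        using eq[of k a] unfolding line_extension_mem_iff
        by (intro bexI[of _ k] bexI[of _ "a \<otimes> x"]) auto
    next
      fix b assume "b \<in> line_extension K (v \<otimes> x) ((\<lambda>a. a \<otimes> x) ` E)"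
      then obtain k a where "k \<in> K" "a \<in> E" "b = k \<otimes> (v \<otimes> x) \<oplus> a \<otimes> x"
        by (auto simp: line_extension_mem_iff)
      moreover from this have "k \<otimes> v \<oplus> a \<in> line_extension K v E"
        unfolding line_extension_mem_iff by blast
      ultimately show "b \<in> (\<lambda>a. a \<otimes> x) ` line_extension K v E"
        using eq[of k a] by (intro image_eqI[of _ _ "k \<otimes> v \<oplus> a"]) auto
    qed
  qed
  moreover have "dimension n K ((\<lambda>a. a \<otimes> x) ` E)" using Suc_dim by blast
  ultimately show ?case using Suc_dim by (metis dimension.Suc_dim m_closed)
qed

text \<open>An element \<open>a\<close> of \<open>L\<close> outside \<open>M\<close> makes
  \<open>[a, \<one>]\<close> a basis of \<open>R\<close> over \<open>M\<close>. Both vectors lie in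
  \<open>L\<close>, so \<open>L\<close> would be all of \<open>R\<close>, which has dimension 1 over
  itself.\<close>

lemma subfield_eq_of_dimension_2:
  assumes M: "subfield M R" and L: "subfield L R" and "M \<subseteq> L"
    and dM: "dimension 2 M (carrier R)" and dL: "dimension 2 L (carrier R)"
  shows "M = L"
proof (rule ccontr)
  assume "M \<noteq> L"
  then obtain a where a: "a \<in> L" "a \<notin> M" using assms(3) by blast
  have MR: "M \<subseteq> carrier R" "L \<subseteq> carrier R" using M L by (auto dest: subfieldE(3))
  have one: "\<one> \<in> M" "\<one> \<in> L" using M L by (auto dest!: subfieldE(1) subringE(3))
  have span1: "Span M [\<one>] = M"
    using MR by (force simp: line_extension_mem_iff set_eq_iff)
  have "independent M [a, \<one>]"
    using a span1 MR by (intro li_Cons) auto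
  then have "Span M [a, \<one>] = carrier R"
    using independent_length_eq_dimension[OF M dM, of "[a, \<one>]"] a MR by auto
  moreover have "Span M [a, \<one>] \<subseteq> L"
  proof
    fix b assume "b \<in> Span M [a, \<one>]"
    then obtain k c where "k \<in> M" "c \<in> M" "b = k \<otimes> a \<oplus> c"
      using span1 by (auto simp: line_extension_mem_iff)
    then show "b \<in> L" using subfieldE(1)[OF L] a assms(3) by (auto intro!: subringE(6,7))
  qed
  ultimately have "carrier R = L" using MR by blast
  then show False using dimension_is_inj[OF L dL, of 1] dimension_one[OF L] by simp
qed

end

context curve_model
begin

text \<open>The poles of \<open>x\<close> are the fibre over infinity of the map to the line given
  by \<open>x\<close>, with the pole orders as ramification indices: p(x)/q(x) has order deg q - deg
  p times the pole order.\<close>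

lemma poles_le:
  assumes x: "x \<in> carrier R" "x \<noteq> \<zero>"
    and M: "subfield M R" "dimension n M (carrier R)"
    and rat: "\<And>a. a \<in> M \<Longrightarrow> \<exists>p q. peval x q \<noteq> \<zero> \<and> a = peval x p \<otimes> inv (peval x q)"
  shows "finite {P \<in> Pts. \<nu> P x < 0}" "(\<Sum>P | P \<in> Pts \<and> \<nu> P x < 0. - \<nu> P x) \<le> int n"
proof -
  let ?S = "{P \<in> Pts. \<nu> P x < 0}"
  have ram: "\<exists>k. \<forall>P\<in>?S. \<nu> P a = k * int (nat (- \<nu> P x))" if a: "a \<in> M - {\<zero>}" for a
  proof -
    obtain p q where pq: "peval x q \<noteq> \<zero>" "a = peval x p \<otimes> inv (peval x q)" using rat[of a] a by blast
    then have p: "peval x p \<noteq> \<zero>" using a x by auto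
    then have pq0: "p \<noteq> 0" "q \<noteq> 0" using pq by auto
    have "\<nu> P a = (int (degree q) - int (degree p)) * int (nat (- \<nu> P x))" if P: "P \<in> ?S" for P
    proof -
      interpret P: discrete_valuation R \<iota> "\<nu> P" using P by (intro val) simp
      show ?thesis using pq p pq0 x P P.peval_pole[OF x]
        by (auto simp: P.val_mult P.val_inv algebra_simps)
    qed
    then show ?thesis by blast
  qed
  have sub: "?S \<subseteq> Pts" by auto
  have e1: "1 \<le> nat (- \<nu> P x)" if "P \<in> ?S" for P using that by auto
  note fin = fibre_finite[OF M(1) sub e1 ram M(2)]
  show "finite ?S" using fin(1) by simp
  have "(\<Sum>P\<in>?S. - \<nu> P x) = int (\<Sum>P\<in>?S. nat (- \<nu> P x))"
    unfolding of_nat_sum by (intro sum.cong) auto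
  also have "\<dots> \<le> int n" using fin(2) by (simp only: of_nat_le_iff)
  finally show "(\<Sum>P | P \<in> Pts \<and> \<nu> P x < 0. - \<nu> P x) \<le> int n" .
qed

end

section \<open>Double covers\<close>

locale field_over_hom = X: field_over R \<iota> + E: field_over G \<kappa>
  for R :: "('a, 'm) ring_scheme" (structure) and \<iota> :: "'k::field \<Rightarrow> 'a"
    and G :: "('b, 'm2) ring_scheme" and \<kappa> :: "'k \<Rightarrow> 'b" +
  fixes h :: "'b \<Rightarrow> 'a"
  assumes hom: "h \<in> ring_hom G R"
    and hom_const: "h (\<kappa> c) = \<iota> c"
begin

sublocale h: ring_hom_ring G R h
  by (rule ring_hom_ringI2) (auto simp: hom X.ring_axioms E.ring_axioms)

lemma h_eq_zero_iff: "a \<in> carrier G \<Longrightarrow> h a = \<zero> \<longleftrightarrow> a = \<zero>\<^bsub>G\<^esub>"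
proof
  assume a: "a \<in> carrier G" "h a = \<zero>"
  show "a = \<zero>\<^bsub>G\<^esub>"
  proof (rule ccontr)
    assume "a \<noteq> \<zero>\<^bsub>G\<^esub>"
    then have "h (a \<otimes>\<^bsub>G\<^esub> inv\<^bsub>G\<^esub> a) = \<zero>" using a by (simp del: E.r_inv')
    then show False using a \<open>a \<noteq> \<zero>\<^bsub>G\<^esub>\<close> by simp
  qed
qed simp

lemma h_inj: "inj_on h (carrier G)"
proof (rule inj_onI)
  fix a b assume ab: "a \<in> carrier G" "b \<in> carrier G" "h a = h b"
  then have "h (a \<ominus>\<^bsub>G\<^esub> b) = \<zero>" by (simp add: E.minus_eq X.r_neg)
  then show "a = b" using ab h_eq_zero_iff[of "a \<ominus>\<^bsub>G\<^esub> b"] by simp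
qed

lemma h_inv: "a \<in> carrier G \<Longrightarrow> a \<noteq> \<zero>\<^bsub>G\<^esub> \<Longrightarrow> h (inv\<^bsub>G\<^esub> a) = inv (h a)"
  using X.comm_inv_char[of "h a" "h (inv\<^bsub>G\<^esub> a)"] h.hom_mult[of a "inv\<^bsub>G\<^esub> a"]
  by (simp del: h.hom_mult)

lemma h_peval: "t \<in> carrier G \<Longrightarrow> h (E.peval t p) = X.peval (h t) p"
  by (induction p) (auto simp: E.peval_pCons X.peval_pCons hom_const)

lemma subfield_image: "subfield (h ` carrier G) R"
proof (rule X.subfieldI')
  show "subring (h ` carrier G) R"
    by (rule h.img_is_subring[OF E.carrier_is_subring])
  show "inv k \<in> h ` carrier G" if "k \<in> h ` carrier G - {\<zero>}" for k
    using that by (auto simp flip: h_inv simp: h_eq_zero_iff)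
qed

lemma h_pow: "a \<in> carrier G \<Longrightarrow> h (a [^]\<^bsub>G\<^esub> (n::nat)) = h a [^] n"
  by (induction n) auto

end

text \<open>\<open>h\<close> plays the part of the pullback along \<open>\<phi>\<close>.
  Ramification is stated as one factor \<open>e\<close> valid for all functions on the base, because
  \<open>fibre_finite\<close> needs a factor \<open>k\<close> common to a whole fibre.\<close>

locale double_cover_model =
  X: curve_model R \<iota> Pts \<nu> + E: curve_model G \<kappa> Pts' \<nu>' + field_over_hom R \<iota> G \<kappa> h
  for R :: "('a, 'm) ring_scheme" (structure) and \<iota> :: "'k::field \<Rightarrow> 'a"
    and Pts :: "'p set" and \<nu> :: "'p \<Rightarrow> 'a \<Rightarrow> int"
    and G :: "('b, 'm2) ring_scheme" and \<kappa> :: "'k \<Rightarrow> 'b"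
    and Pts' :: "'q set" and \<nu>' :: "'q \<Rightarrow> 'b \<Rightarrow> int" and h :: "'b \<Rightarrow> 'a" +
  fixes \<phi> :: "'p \<Rightarrow> 'q"
  assumes map_points: "P \<in> Pts \<Longrightarrow> \<phi> P \<in> Pts'"
    and ramification: "P \<in> Pts \<Longrightarrow>
      \<exists>e::nat. 1 \<le> e \<and> (\<forall>a \<in> carrier G - {\<zero>\<^bsub>G\<^esub>}. \<nu> P (h a) = int e * \<nu>' (\<phi> P) a)"
    and degree_2: "X.dimension 2 (h ` carrier G) (carrier R)"
begin

text \<open>The divisor \<open>A\<close> has two tasks: \<open>D0 \<le> A\<close> makes
  \<open>E.RR A\<close> finite dimensional, and a pullback dominating \<open>D\<close> makes
  \<open>X.RR D'\<close> finite dimensional with controlled dimension. The count takes place at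
  \<open>D'\<close>; its result returns to \<open>D\<close> through
  \<open>dimension_RR_le\<close>.\<close>

lemma castelnuovo_bound:
  assumes x: "x \<in> carrier R" "x \<notin> h ` carrier G"
    and poles: "finite {P \<in> Pts. \<nu> P x < 0}" "(\<Sum>P | P \<in> Pts \<and> \<nu> P x < 0. - \<nu> P x) \<le> 2"
    and D: "keys D \<subseteq> Pts" "X.dimension l (range \<iota>) (X.RR D)"
    and D0: "keys D0 \<subseteq> Pts'" "E.dimension l0 (range \<kappa>) (E.RR D0)"
    and E: "\<And>A n. keys A \<subseteq> Pts' \<Longrightarrow> E.dimension n (range \<kappa>) (E.RR A) \<Longrightarrow>
      divisor_degree A \<le> int n"
  shows "divisor_degree D \<le> int l + 2"
proof -
  have x0: "x \<noteq> \<zero>" using x(2) h.hom_zero E.zero_closed by (metis imageI)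
  obtain e where e: "\<And>P. P \<in> Pts \<Longrightarrow> 1 \<le> e P"
      "\<And>P a. P \<in> Pts \<Longrightarrow> a \<in> carrier G - {\<zero>\<^bsub>G\<^esub>} \<Longrightarrow> \<nu> P (h a) = int (e P) * \<nu>' (\<phi> P) a"
    using ramification by metis
  define fib where "fib Q = {P \<in> Pts. \<phi> P = Q}" for Q
  have fib: "finite (fib Q)" "(\<Sum>P\<in>fib Q. e P) \<le> 2" for Q
  proof -
    have "\<exists>k. \<forall>P\<in>fib Q. \<nu> P a = k * int (e P)" if a: "a \<in> h ` carrier G - {\<zero>}" for a
    proof -
      obtain b where b: "b \<in> carrier G" "a = h b" using a by blast
      then have "b \<in> carrier G - {\<zero>\<^bsub>G\<^esub>}" using a by auto
      then show ?thesis using e(2)[of _ b] b(2) by (intro exI[of _ "\<nu>' Q b"]) (auto simp: fib_def)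
    qed
    then show "finite (fib Q)" "(\<Sum>P\<in>fib Q. e P) \<le> 2"
      using X.fibre_finite[OF subfield_image, of "fib Q" e, OF _ _ _ degree_2] e(1)
      by (auto simp: fib_def)
  qed
  \<comment> \<open>The positive part of \<open>D0\<close> ensures effectivity and
    \<open>D0 \<le> A\<close>. The sum of the coefficients of \<open>D\<close> above
    \<open>Q\<close>, in absolute value, makes the pullback of \<open>A\<close> dominate
    \<open>D\<close>.\<close>
  define f where "f Q = max 0 (lookup D0 Q) +
      (\<Sum>P\<in>keys D. if \<phi> P = Q then \<bar>lookup D P\<bar> else 0)" for Q
  have "f Q = 0" if "Q \<notin> keys D0 \<union> \<phi> ` keys D" for Q
    using that by (auto simp: f_def in_keys_iff intro!: sum.neutral)
  then obtain A where A: "lookup A = f"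
      "keys A \<subseteq> keys D0 \<union> \<phi> ` keys D"
    using ex_poly_mapping[of "keys D0 \<union> \<phi> ` keys D" f] by auto
  have AX: "keys A \<subseteq> Pts'" using A(2) D0(1) D(1) map_points by blast
  have sum_nn: "0 \<le> (\<Sum>P\<in>keys D. if \<phi> P = Q then \<bar>lookup D P\<bar> else 0)" for Q
    by (intro sum_nonneg) auto
  have A0: "0 \<le> lookup A Q" and AD0: "lookup D0 Q \<le> lookup A Q" for Q
    unfolding A(1) f_def using sum_nn[of Q] by auto
  have AD: "lookup D P \<le> lookup A (\<phi> P)" for P
  proof (cases "P \<in> keys D")
    case True
    then have "(if \<phi> P = \<phi> P then \<bar>lookup D P\<bar> else 0) \<le>
        (\<Sum>R\<in>keys D. if \<phi> R = \<phi> P then \<bar>lookup D R\<bar> else 0)"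
      by (intro member_le_sum) auto
    then show ?thesis unfolding A(1) f_def by auto
  next
    case False
    then show ?thesis using A0[of "\<phi> P"] by (simp add: in_keys_iff)
  qed
  obtain n where n: "E.dimension n (range \<kappa>) (E.RR A)"
  proof -
    have "0 \<le> lookup (A - D0) Q" for Q using AD0[of Q] by (simp add: lookup_minus)
    moreover have "keys (A - D0) \<subseteq> Pts'"
      using AX D0(1) keys_diff[of A D0] by blast
    ultimately show ?thesis using E.dimension_RR_le[OF _ _ D0(2), of "A - D0"] that by auto
  qed
  have degA: "divisor_degree A \<le> int n" by (rule E[OF AX n])
  define polx where "polx = {P \<in> Pts. \<nu> P x < 0}"
  \<comment> \<open>The pullback of \<open>A\<close> with multiplicities \<open>e P\<close>, plus
    the polar divisor of \<open>x\<close>: for \<open>b\<close> pulled back from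
    \<open>E.RR A\<close>, both \<open>b\<close> and \<open>b \<otimes> x\<close> satisfy these pole
    bounds.\<close>
  define g where "g P = (if P \<in> Pts then int (e P) * f (\<phi> P) + max 0 (- \<nu> P x) else 0)" for P
  let ?S = "(\<Union>Q\<in>keys A. fib Q)"
  have "g P = 0" if "P \<notin> ?S \<union> polx" for P
    using that A(1) by (auto simp: g_def fib_def polx_def in_keys_iff)
  moreover have finS: "finite ?S" "finite polx" using fib poles by (auto simp: polx_def)
  ultimately obtain D' where D': "lookup D' = g" "keys D' \<subseteq> ?S \<union> polx"
    using ex_poly_mapping[of "?S \<union> polx" g] by auto
  have D'X: "keys D' \<subseteq> Pts" using D'(2) by (auto simp: fib_def polx_def)
  have f0: "0 \<le> f Q" for Q using A0[of Q] A(1) by simp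
  have eA: "lookup A (\<phi> P) \<le> int (e P) * f (\<phi> P)" if "P \<in> Pts" for P
    using mult_right_mono[of 1 "int (e P)" "f (\<phi> P)"] e(1)[OF that] f0 A(1) by simp
  have DD': "lookup D P \<le> lookup D' P" for P
  proof (cases "P \<in> Pts")
    case True
    then show ?thesis using AD[of P] eA[OF True] by (simp add: D'(1) g_def)
  next
    case False
    then have "P \<notin> keys D" using D(1) by blast
    then show ?thesis using False by (simp add: D'(1) g_def in_keys_iff)
  qed
  obtain m where m: "X.dimension m (range \<iota>) (X.RR D')"
      "int m \<le> int l + (divisor_degree D' - divisor_degree D)"
  proof -
    have "0 \<le> lookup (D' - D) Q" for Q using DD'[of Q] by (simp add: lookup_minus)
    moreover have "keys (D' - D) \<subseteq> Pts"
      using D'X D(1) keys_diff[of D' D] by blast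
    moreover have "divisor_degree (D' - D) = divisor_degree D' - divisor_degree D"
      using divisor_degree_add[of "D' - D" D] by simp
    ultimately show ?thesis using X.dimension_RR_le[OF _ _ D(2), of "D' - D"] that by auto
  qed
  \<comment> \<open>Each fibre has total weight at most 2, whence the factor; the pole orders of
    \<open>x\<close> add up to at most 2, whence the summand.\<close>
  have degD': "divisor_degree D' \<le> 2 * divisor_degree A + 2"
  proof -
    have "divisor_degree D' = (\<Sum>P\<in>?S \<union> polx. g P)"
      using divisor_degree_superset[of "?S \<union> polx" D'] D' finS by simp
    also have "\<dots> = (\<Sum>P\<in>?S \<union> polx. int (e P) * f (\<phi> P)) + (\<Sum>P\<in>?S \<union> polx. max 0 (- \<nu> P x))"
      unfolding sum.distrib[symmetric]
      by (intro sum.cong) (auto simp: g_def fib_def polx_def)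
    also have "(\<Sum>P\<in>?S \<union> polx. int (e P) * f (\<phi> P)) = (\<Sum>P\<in>?S. int (e P) * f (\<phi> P))"
      using finS A(1) by (intro sum.mono_neutral_right) (auto simp: fib_def polx_def in_keys_iff)
    also have "\<dots> = (\<Sum>Q\<in>keys A. \<Sum>P\<in>fib Q. int (e P) * f (\<phi> P))"
      using fib by (intro sum.UNION_disjoint) (auto simp: fib_def)
    also have "\<dots> \<le> (\<Sum>Q\<in>keys A. 2 * f Q)"
    proof (rule sum_mono)
      fix Q
      have "(\<Sum>P\<in>fib Q. int (e P) * f (\<phi> P)) = int (\<Sum>P\<in>fib Q. e P) * f Q"
        unfolding of_nat_sum sum_distrib_right by (intro sum.cong) (auto simp: fib_def)
      also have "\<dots> \<le> 2 * f Q" using fib(2)[of Q] f0[of Q] by (intro mult_right_mono) (simp_all del: of_nat_sum)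
      finally show "(\<Sum>P\<in>fib Q. int (e P) * f (\<phi> P)) \<le> 2 * f Q" .
    qed
    also have "\<dots> = 2 * divisor_degree A" by (simp add: divisor_degree_def A(1) sum_distrib_left)
    also have "(\<Sum>P\<in>?S \<union> polx. max 0 (- \<nu> P x)) = (\<Sum>P\<in>polx. max 0 (- \<nu> P x))"
      using finS by (intro sum.mono_neutral_right) (auto simp: fib_def polx_def)
    also have "\<dots> = (\<Sum>P\<in>polx. - \<nu> P x)" by (intro sum.cong) (auto simp: polx_def)
    also have "\<dots> \<le> 2" using poles(2) by (simp add: polx_def)
    finally show ?thesis by simp
  qed
  define V where "V = h ` E.RR A"
  have RRG: "E.RR A \<subseteq> carrier G" by (auto simp: E.RR_def)
  have VL: "V \<subseteq> h ` carrier G" and VR: "V \<subseteq> carrier R" using RRG by (auto simp: V_def)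
  have "h ` range \<kappa> = range \<iota>" using hom_const by (auto simp: image_iff)
  then have dimV: "X.dimension n (range \<iota>) V"
    using h.inj_hom_dimension[OF E.subfield_const X.one_not_zero inj_on_subset[OF h_inj RRG] n]
    by (simp add: V_def)
  note dimVx = X.dimension_mult[OF dimV X.subfield_const x(1) x0]
  \<comment> \<open>A nonzero common element would exhibit \<open>x\<close> as a quotient of two
    pulled back functions, against the choice of \<open>x\<close> outside the image of
    \<open>h\<close>.\<close>
  have "V \<inter> (\<lambda>a. a \<otimes> x) ` V = {\<zero>}"
  proof -
    have "a \<otimes> x = \<zero>" if a: "a \<in> V" "a \<otimes> x \<in> V" for a
    proof (rule ccontr)
      assume nz: "a \<otimes> x \<noteq> \<zero>"
      then have a0: "a \<noteq> \<zero>" "a \<in> carrier R" using a x VR by auto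
      have "inv a \<in> h ` carrier G" using X.subfield_m_inv(1)[OF subfield_image, of a] a VL a0 by auto
      then have "inv a \<otimes> (a \<otimes> x) \<in> h ` carrier G"
        using a VL subringE(6)[OF subfieldE(1)[OF subfield_image]] by blast
      moreover have "inv a \<otimes> (a \<otimes> x) = x" using a0 x by (simp add: X.m_assoc[symmetric])
      ultimately show False using x(2) by simp
    qed
    moreover have "\<zero> \<in> V" using X.space_subgroup_props(2)[OF X.subfield_const dimV] .
    moreover from this have "\<zero> \<in> (\<lambda>a. a \<otimes> x) ` V"
      using x(1) by (intro image_eqI[of _ _ \<zero>]) simp_all
    ultimately show ?thesis by blast
  qed
  from X.dimension_direct_sum_space[OF X.subfield_const dimV dimVx this]
  obtain Vs where Vs: "X.independent (range \<iota>) Vs" "length Vs = n + n"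
      "X.Span (range \<iota>) Vs = V <+>\<^bsub>R\<^esub> (\<lambda>a. a \<otimes> x) ` V" "set Vs \<subseteq> carrier R"
    using X.exists_base[OF X.subfield_const] by blast
  have VD': "b \<in> X.RR D' \<and> b \<otimes> x \<in> X.RR D'" if b: "b \<in> V" for b
  proof -
    obtain a where a: "a \<in> E.RR A" "b = h a" using b by (auto simp: V_def)
    have bR: "b \<in> carrier R" using b VR by auto
    have "b \<in> discrete_valuation.vset R (\<nu> P) (- lookup D' P) \<and>
        b \<otimes> x \<in> discrete_valuation.vset R (\<nu> P) (- lookup D' P)" if P: "P \<in> Pts" for P
    proof -
      interpret P: discrete_valuation R \<iota> "\<nu> P" by (rule X.val[OF P])
      show ?thesis
      proof (cases "a = \<zero>\<^bsub>G\<^esub>")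
        case True
        then show ?thesis using a x by simp
      next
        case False
        have aG: "a \<in> carrier G - {\<zero>\<^bsub>G\<^esub>}" using a False RRG by auto
        then have b0: "b \<noteq> \<zero>" using a h_eq_zero_iff by auto
        have "- f (\<phi> P) \<le> \<nu>' (\<phi> P) a"
          using a(1) aG map_points[OF P] A(1) by (auto simp: E.RR_def)
        then have "int (e P) * (- f (\<phi> P)) \<le> int (e P) * \<nu>' (\<phi> P) a"
          by (intro mult_left_mono) auto
        then have "- (int (e P) * f (\<phi> P)) \<le> \<nu> P b" using e(2)[OF P aG] a by simp
        then show ?thesis using bR b0 x x0 P
          by (auto intro!: P.vsetI simp: D'(1) g_def P.val_mult)
      qed
    qed
    then show ?thesis using bR x by (auto simp: X.RR_iff)
  qed
  have "set Vs \<subseteq> X.RR D'"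
  proof -
    have "set Vs \<subseteq> V <+>\<^bsub>R\<^esub> (\<lambda>a. a \<otimes> x) ` V"
      using X.Span_base_incl[OF X.subfield_const Vs(4)] Vs(3) by simp
    also have "\<dots> \<subseteq> X.RR D'" using VD' by (auto simp: set_add_def' intro: X.RR_add)
    finally show ?thesis .
  qed
  then have "n + n \<le> m"
    using X.independent_length_le_dimension[OF X.subfield_const m(1) Vs(1)] Vs(2) by simp
  then show ?thesis using m(2) degD' degA by linarith
qed

theorem hyperelliptic_contradiction:
  assumes M: "subfield M R" "X.dimension 2 M (carrier R)"
    and x: "x \<in> M"
      "\<And>a. a \<in> M \<Longrightarrow> \<exists>p q. X.peval x q \<noteq> \<zero> \<and> a = X.peval x p \<otimes> inv (X.peval x q)"
    and D: "keys D \<subseteq> Pts" "X.dimension l (range \<iota>) (X.RR D)"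
      "divisor_degree D + 1 - int l = 4"
    and D0: "keys D0 \<subseteq> Pts'" "E.dimension l0 (range \<kappa>) (E.RR D0)"
      "divisor_degree D0 + 1 - int l0 = 1"
    and E: "\<And>A n. keys A \<subseteq> Pts' \<Longrightarrow> E.dimension n (range \<kappa>) (E.RR A) \<Longrightarrow>
      divisor_degree A + 1 - int n \<le> 1"
  shows False
proof (cases "x \<in> h ` carrier G")
  case False
  have xR: "x \<in> carrier R" using x(1) subfieldE(3)[OF M(1)] by auto
  have x0: "x \<noteq> \<zero>" using False h.hom_zero E.zero_closed by (metis imageI)
  have "divisor_degree D \<le> int l + 2"
    using E X.poles_le[OF xR x0 M x(2)]
    by (intro castelnuovo_bound[OF xR False _ _ D(1,2) D0(1,2)]) fastforce+
  then show False using D(3) by simp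
next
  case True
  then obtain t where t: "t \<in> carrier G" "x = h t" by blast
  have "M \<subseteq> h ` carrier G"
  proof
    fix a assume "a \<in> M"
    then obtain p q where pq: "X.peval x q \<noteq> \<zero>" "a = X.peval x p \<otimes> inv (X.peval x q)"
      using x(2) by blast
    then have q: "E.peval t q \<noteq> \<zero>\<^bsub>G\<^esub>" using t by (auto simp: h_peval[symmetric])
    then have "a = h (E.peval t p \<otimes>\<^bsub>G\<^esub> inv\<^bsub>G\<^esub> (E.peval t q))"
      using t pq by (simp add: h_peval[symmetric] h_inv)
    then show "a \<in> h ` carrier G" using q t by blast
  qed
  \<comment> \<open>Inclusion is enough, since \<open>R\<close> has dimension 2 over both subfields.
    The base therefore has a rational function field generated by \<open>t\<close>.\<close>
  then have M_eq: "M = h ` carrier G"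
    by (rule X.subfield_eq_of_dimension_2[OF M(1) subfield_image _ M(2) degree_2])
  have rat: "\<exists>p q. E.peval t q \<noteq> \<zero>\<^bsub>G\<^esub> \<and> a = E.peval t p \<otimes>\<^bsub>G\<^esub> inv\<^bsub>G\<^esub> (E.peval t q)"
    if a: "a \<in> carrier G" for a
  proof -
    obtain p q where pq: "X.peval x q \<noteq> \<zero>" "h a = X.peval x p \<otimes> inv (X.peval x q)"
      using x(2)[of "h a"] a M_eq by blast
    then have q: "E.peval t q \<noteq> \<zero>\<^bsub>G\<^esub>" using t by (auto simp: h_peval[symmetric])
    then have "h a = h (E.peval t p \<otimes>\<^bsub>G\<^esub> inv\<^bsub>G\<^esub> (E.peval t q))"
      using t pq by (simp add: h_peval[symmetric] h_inv)
    then have "a = E.peval t p \<otimes>\<^bsub>G\<^esub> inv\<^bsub>G\<^esub> (E.peval t q)"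
      using inj_onD[OF h_inj, of a "E.peval t p \<otimes>\<^bsub>G\<^esub> inv\<^bsub>G\<^esub> (E.peval t q)"] a t q by simp
    then show ?thesis using q by blast
  qed
  \<comment> \<open>\<open>D1\<close> is the positive part of \<open>D0\<close>. As
    \<open>l0\<close> equals the degree of \<open>D0\<close>, enlarging \<open>D0\<close> to
    \<open>D1\<close> leaves a dimension of at most the degree of \<open>D1\<close>. The divisor
    \<open>D1\<close> is effective, so \<open>independent_RR\<close> yields one more independent
    function than that.\<close>
  obtain D1 where D1: "lookup D1 = (\<lambda>P. max 0 (lookup D0 P))"
      "keys D1 \<subseteq> keys D0"
    using ex_poly_mapping[of "keys D0" "\<lambda>P. max 0 (lookup D0 P)"]
    by (auto simp: in_keys_iff)
  have "0 \<le> lookup (D1 - D0) Q" for Q by (simp add: lookup_minus D1)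
  moreover have "keys (D1 - D0) \<subseteq> Pts'"
    using D1(2) D0(1) keys_diff[of D1 D0] by blast
  moreover have "divisor_degree (D1 - D0) = divisor_degree D1 - divisor_degree D0"
    using divisor_degree_add[of "D1 - D0" D0] by simp
  ultimately obtain m where m: "E.dimension m (range \<kappa>) (E.RR D1)" "int m \<le> divisor_degree D1"
    using E.dimension_RR_le[OF _ _ D0(2), of "D1 - D0"] D0(3) by auto
  obtain Us where "E.independent (range \<kappa>) Us" "set Us \<subseteq> E.RR D1"
      "int (length Us) = divisor_degree D1 + 1"
    using E.independent_RR[OF E.rational_simple_pole[OF t(1) rat], of D1] D1 D0(1) by auto
  then show False
    using E.independent_length_le_dimension[OF E.subfield_const m(1)] m(2) by fastforce
qed

end

section \<open>Transcendence degree\<close>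

lemma (in ring) Span_dimension_le:
  assumes K: "subfield K R" and "set Us \<subseteq> carrier R"
  shows "\<exists>n\<le>length Us. dimension n K (Span K Us)"
  using assms(2)
proof (induction Us)
  case Nil
  then show ?case by auto
next
  case (Cons u Us)
  then obtain n where n: "n \<le> length Us" "dimension n K (Span K Us)" by auto
  show ?case
  proof (cases "u \<in> Span K Us")
    case True
    have "Span K (u # Us) \<subseteq> Span K Us"
      using True Cons.prems Span_subgroup_props(3)[OF K, of Us] Span_smult_closed[OF K, of Us]
      by (auto simp: line_extension_mem_iff)
    moreover have "Span K Us \<subseteq> Span K (u # Us)"
      using Cons.prems by (intro mono_Span[OF K]) auto
    ultimately have "Span K (u # Us) = Span K Us" by blast
    then show ?thesis using n by (intro exI[of _ n]) simp
  next
    case False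
    then show ?thesis using n Cons.prems by (intro exI[of _ "Suc n"]) (auto intro: Suc_dim)
  qed
qed

text \<open>The order in which \<open>List.product\<close> runs through increasing lists
  (\<open>sorted_product\<close>); \<open>krull_intersection\<close> peels off monomials in this
  order.\<close>

definition lex_less :: "nat \<times> nat \<Rightarrow> nat \<times> nat \<Rightarrow> bool" where
  "lex_less p q \<longleftrightarrow> fst p < fst q \<or> fst p = fst q \<and> snd p < snd q"

lemma sorted_product:
  assumes "sorted_wrt (<) xs" "sorted_wrt (<) ys"
  shows "sorted_wrt lex_less (List.product xs ys)"
  using assms(1)
proof (induction xs)
  case (Cons x xs)
  then show ?case using assms(2)
    by (auto simp: sorted_wrt_append sorted_wrt_map lex_less_def)
qed simp

context field_over
begin

definition monomial :: "'a \<Rightarrow> 'a \<Rightarrow> nat \<times> nat \<Rightarrow> 'a" where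
  "monomial a t p = a [^] fst p \<otimes> t [^] snd p"

text \<open>Algebraic dependence of any two elements, put as linear dependence of the monomials with
  both exponents below some \<open>N\<close>, so that it can be proved by counting
  dimensions.\<close>

definition transcendence_degree_le_1 :: bool where
  "transcendence_degree_le_1 \<longleftrightarrow> (\<forall>a\<in>carrier R. \<forall>t\<in>carrier R. \<exists>N::nat.
     dependent (range \<iota>) (map (monomial a t) (List.product [0..<N] [0..<N])))"

lemma peval_mult_in_Span:
  assumes "x \<in> carrier R" "u \<in> carrier R" "set Us \<subseteq> carrier R"
    and "\<And>i. i \<le> m \<Longrightarrow> x [^] (i::nat) \<otimes> u \<in> Span (range \<iota>) Us" "degree p \<le> m"
  shows "peval x p \<otimes> u \<in> Span (range \<iota>) Us"
  using assms(2,4,5)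
proof (induction p arbitrary: u m)
  case 0
  then show ?case using assms(3) Span_subgroup_props(2)[OF subfield_const] by simp
next
  case (pCons c p)
  have cu: "\<iota> c \<otimes> u \<in> Span (range \<iota>) Us"
    using Span_smult_closed[OF subfield_const assms(3), of "\<iota> c" u] pCons.prems(2)[of 0] pCons.prems(1)
    by simp
  show ?case
  proof (cases "p = 0")
    case True
    then show ?thesis using cu pCons assms by (simp add: peval_pCons)
  next
    case False
    then obtain m' where m: "m = Suc m'" "degree p \<le> m'" using pCons.prems by (cases m) auto
    have "x [^] i \<otimes> (x \<otimes> u) \<in> Span (range \<iota>) Us" if "i \<le> m'" for i
      using pCons.prems(2)[of "Suc i"] that m assms(1) pCons.prems(1) by (simp add: m_assoc)
    then have "peval x p \<otimes> (x \<otimes> u) \<in> Span (range \<iota>) Us"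
      using m assms(1) pCons.prems(1) by (intro pCons.IH) auto
    moreover have "peval x (pCons c p) \<otimes> u = \<iota> c \<otimes> u \<oplus> peval x p \<otimes> (x \<otimes> u)"
      using assms(1) pCons.prems(1) by (simp add: peval_pCons l_distr r_distr m_ac)
    ultimately show ?thesis using cu Span_subgroup_props(3)[OF subfield_const assms(3)] by simp
  qed
qed

text \<open>Counting: multiplication by \<open>a\<close> and \<open>t\<close> raises degrees in \<open>x\<close> by a bounded amount \<open>d\<close> after
  clearing denominators, so the \<open>N\<^sup>2\<close> monomials in \<open>a, t\<close> lie in a space of dimension \<open>O(N d)\<close>.\<close>

lemma transcendence_degree_le_1I:
  assumes M: "subfield M R" "dimension 2 M (carrier R)" and x: "x \<in> carrier R"
    and rat: "\<And>a. a \<in> M \<Longrightarrow> \<exists>p q. peval x q \<noteq> \<zero> \<and> a = peval x p \<otimes> inv (peval x q)"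
  shows transcendence_degree_le_1
  unfolding transcendence_degree_le_1_def
proof (intro ballI)
  fix a t assume a: "a \<in> carrier R" and t: "t \<in> carrier R"
  let ?K = "range \<iota>"
  obtain Vs where Vs: "set Vs \<subseteq> carrier R" "independent M Vs" "length Vs = 2" "Span M Vs = carrier R"
    using exists_base[OF M] by blast
  then obtain u1 u2 where Vs2: "Vs = [u1, u2]"
    by (auto simp: numeral_2_eq_2 length_Suc_conv)
  have u: "u1 \<in> carrier R" "u2 \<in> carrier R" using Vs Vs2 by auto
  have "u1 \<noteq> \<zero>"
  proof
    assume "u1 = \<zero>"
    then have "u1 \<in> Span M [u2]" using Span_subgroup_props(2)[OF M(1), of "[u2]"] u by simp
    then show False using Vs(2) Vs2 independent_backwards(1) by blast
  qed
  let ?p = "peval x"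
  \<comment> \<open>A filtration by degree in \<open>x\<close> with respect to the basis
    \<open>u1\<close>, \<open>u2\<close> over \<open>M\<close>; \<open>mulW c d\<close> says that
    multiplication by \<open>c\<close> raises the degree by at most \<open>d\<close>.\<close>
  define W where "W m = {?p p \<otimes> u1 \<oplus> ?p r \<otimes> u2 | p r. degree p \<le> m \<and> degree r \<le> m}" for m
  define mulW where "mulW c d \<longleftrightarrow> c \<in> carrier R \<and> (\<forall>m. \<forall>w\<in>W m. c \<otimes> w \<in> W (m + d))" for c d
  have WR: "w \<in> carrier R" if "w \<in> W m" for w m using that u x by (auto simp: W_def)
  have Wmono: "w \<in> W m'" if "w \<in> W m" "m \<le> m'" for w m m' using that by (force simp: W_def)
  have mulW_mult: "mulW (c \<otimes> c') (d + d')" if "mulW c d" "mulW c' d'" for c c' d d'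
    unfolding mulW_def
  proof (intro conjI allI ballI)
    show "c \<otimes> c' \<in> carrier R" using that by (simp add: mulW_def)
    fix m w assume w: "w \<in> W m"
    then have "c \<otimes> (c' \<otimes> w) \<in> W (m + d' + d)" using that by (simp add: mulW_def)
    then show "c \<otimes> c' \<otimes> w \<in> W (m + (d + d'))"
      using that w WR by (simp add: mulW_def m_assoc add_ac)
  qed
  have mulW_one: "mulW \<one> 0" using WR by (auto simp: mulW_def)
  have mulW_mono: "mulW c d'" if "mulW c d" "d \<le> d'" for c d d'
    using that Wmono by (fastforce simp: mulW_def)
  have mulW_pow: "mulW (c [^] n) (n * d)" if "mulW c d" for c d and n :: nat
    using mulW_mult[OF _ that] mulW_one by (induction n) (auto simp: add.commute[of d])
  have poly_mulW: "mulW (?p q) (degree q)" for q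
    unfolding mulW_def
  proof (intro conjI allI ballI)
    show "?p q \<in> carrier R" using x by simp
    fix m w assume "w \<in> W m"
    then obtain p r where pr: "w = ?p p \<otimes> u1 \<oplus> ?p r \<otimes> u2" "degree p \<le> m" "degree r \<le> m"
      by (auto simp: W_def)
    have "?p q \<otimes> w = ?p (q * p) \<otimes> u1 \<oplus> ?p (q * r) \<otimes> u2"
      using x u by (simp add: pr peval_mult r_distr m_assoc)
    moreover have "degree (q * p) \<le> m + degree q" "degree (q * r) \<le> m + degree q"
      using pr degree_mult_le[of q p] degree_mult_le[of q r] by auto
    ultimately show "?p q \<otimes> w \<in> W (m + degree q)" unfolding W_def by blast
  qed
  have coords: "\<exists>q p r. ?p q \<noteq> \<zero> \<and> ?p q \<otimes> c = ?p p \<otimes> u1 \<oplus> ?p r \<otimes> u2" if c: "c \<in> carrier R" for c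
  proof -
    have "c \<in> Span M [u1, u2]" using c Vs Vs2 by simp
    then obtain k1 k2 where k: "k1 \<in> M" "k2 \<in> M" "c = k1 \<otimes> u1 \<oplus> (k2 \<otimes> u2 \<oplus> \<zero>)"
      by (auto simp: line_extension_mem_iff)
    obtain p1 q1 where 1: "?p q1 \<noteq> \<zero>" "k1 = ?p p1 \<otimes> inv (?p q1)" using rat[OF k(1)] by blast
    obtain p2 q2 where 2: "?p q2 \<noteq> \<zero>" "k2 = ?p p2 \<otimes> inv (?p q2)" using rat[OF k(2)] by blast
    have kR: "k1 \<in> carrier R" "k2 \<in> carrier R" using 1 2 x by auto
    have "?p q1 \<otimes> k1 = ?p p1" "?p q2 \<otimes> k2 = ?p p2" using 1 2 x by (simp_all add: m_lcomm)
    moreover have "?p (q1 * q2) \<otimes> c = ?p q2 \<otimes> (?p q1 \<otimes> k1) \<otimes> u1 \<oplus> ?p q1 \<otimes> (?p q2 \<otimes> k2) \<otimes> u2"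
      using x kR u by (simp add: k(3) peval_mult r_distr l_distr m_ac)
    ultimately have "?p (q1 * q2) \<otimes> c = ?p (q2 * p1) \<otimes> u1 \<oplus> ?p (q1 * p2) \<otimes> u2"
      using x by (simp add: peval_mult)
    moreover have "?p (q1 * q2) \<noteq> \<zero>" using 1 2 x by (simp add: peval_mult integral_iff)
    ultimately show ?thesis by blast
  qed
  \<comment> \<open>Clearing the denominators of \<open>b \<otimes> u1\<close> and
    \<open>b \<otimes> u2\<close> together turns multiplication by \<open>b\<close> into an action
    on the filtration with polynomial coefficients of bounded degree.\<close>
  have denom: "\<exists>q d. ?p q \<noteq> \<zero> \<and> mulW (?p q) d \<and> mulW (?p q \<otimes> b) d" if b: "b \<in> carrier R" for b
  proof -
    obtain q1 p1 r1 where 1: "?p q1 \<noteq> \<zero>" "?p q1 \<otimes> (b \<otimes> u1) = ?p p1 \<otimes> u1 \<oplus> ?p r1 \<otimes> u2"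
      using coords[of "b \<otimes> u1"] b u by blast
    obtain q2 p2 r2 where 2: "?p q2 \<noteq> \<zero>" "?p q2 \<otimes> (b \<otimes> u2) = ?p p2 \<otimes> u1 \<oplus> ?p r2 \<otimes> u2"
      using coords[of "b \<otimes> u2"] b u by blast
    define d where "d = degree (q1 * q2) + degree (q2 * p1) + degree (q2 * r1) +
        degree (q1 * p2) + degree (q1 * r2)"
    have "mulW (?p (q1 * q2) \<otimes> b) d"
      unfolding mulW_def
    proof (intro conjI allI ballI)
      show "?p (q1 * q2) \<otimes> b \<in> carrier R" using x b by simp
      fix m w assume "w \<in> W m"
      then obtain p r where pr: "w = ?p p \<otimes> u1 \<oplus> ?p r \<otimes> u2" "degree p \<le> m" "degree r \<le> m"
        by (auto simp: W_def)
      have "?p (q1 * q2) \<otimes> b \<otimes> w = ?p p \<otimes> (?p q2 \<otimes> (?p q1 \<otimes> (b \<otimes> u1))) \<oplus>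
          ?p r \<otimes> (?p q1 \<otimes> (?p q2 \<otimes> (b \<otimes> u2)))"
        using x u b by (simp add: pr peval_mult r_distr l_distr m_ac)
      also have "\<dots> = ?p (p * (q2 * p1) + r * (q1 * p2)) \<otimes> u1 \<oplus>
          ?p (p * (q2 * r1) + r * (q1 * r2)) \<otimes> u2"
        unfolding 1(2) 2(2) using x u by (simp add: peval_mult peval_add r_distr l_distr m_ac a_ac)
      finally have "?p (q1 * q2) \<otimes> b \<otimes> w = \<dots>" .
      moreover have "degree (s * s') \<le> m + d" if "degree s \<le> m" "degree s' \<le> d" for s s' :: "'k poly"
        using degree_mult_le[of s s'] that by linarith
      then have "degree (p * (q2 * p1) + r * (q1 * p2)) \<le> m + d"
          "degree (p * (q2 * r1) + r * (q1 * r2)) \<le> m + d"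
        using pr by (auto intro!: degree_add_le simp: d_def)
      ultimately show "?p (q1 * q2) \<otimes> b \<otimes> w \<in> W (m + d)" unfolding W_def by blast
    qed
    moreover have "mulW (?p (q1 * q2)) d" by (rule mulW_mono[OF poly_mulW]) (simp add: d_def)
    moreover have "?p (q1 * q2) \<noteq> \<zero>" using 1 2 x by (simp add: peval_mult integral_iff)
    ultimately show ?thesis by blast
  qed
  obtain qa da where qa: "?p qa \<noteq> \<zero>" "mulW (?p qa) da" "mulW (?p qa \<otimes> a) da" using denom[OF a] by blast
  obtain qt dt where qt: "?p qt \<noteq> \<zero>" "mulW (?p qt) dt" "mulW (?p qt \<otimes> t) dt" using denom[OF t] by blast
  define d where "d = max da dt"
  have d: "mulW (?p qa) d" "mulW (?p qa \<otimes> a) d" "mulW (?p qt) d" "mulW (?p qt \<otimes> t) d"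
    using qa qt mulW_mono by (auto simp: d_def)
  \<comment> \<open>Chosen so that the number \<open>N * N\<close> of monomials exceeds
    \<open>4 * (N * d) + 2\<close>, the length of the spanning list \<open>Ls\<close>.\<close>
  define N where "N = 4 * d + 3"
  \<comment> \<open>One power of the denominator serves all exponents \<open>i < N\<close>:
    \<open>i\<close> of its factors are absorbed by \<open>b [^] i\<close>, and the remaining
    \<open>N - i\<close> act alone, so the cost in degree is always \<open>N * d\<close>.\<close>
  have pow: "mulW (?p q [^] N \<otimes> b [^] i) (N * d)"
    if "mulW (?p q) d" "mulW (?p q \<otimes> b) d" "i < N" "b \<in> carrier R" for q b i
  proof -
    have "?p q [^] N = ?p q [^] i \<otimes> ?p q [^] (N - i)" using that x by (simp add: nat_pow_mult)
    then have "?p q [^] N \<otimes> b [^] i = (?p q \<otimes> b) [^] i \<otimes> ?p q [^] (N - i)"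
      using that x by (simp add: pow_mult_distrib m_comm m_ac)
    moreover have "i * d + (N - i) * d = N * d" using that by (simp flip: add_mult_distrib)
    ultimately show ?thesis
      using mulW_mult[OF mulW_pow[OF that(2), of i] mulW_pow[OF that(1), of "N - i"]] by simp
  qed
  \<comment> \<open>The common denominator of all monomials, times \<open>u1\<close> so that the
    products land in the filtration. Being nonzero, it leaves dimensions unchanged.\<close>
  define e where "e = ?p qa [^] N \<otimes> ?p qt [^] N \<otimes> u1"
  have e: "e \<in> carrier R" "e \<noteq> \<zero>"
    using x u \<open>u1 \<noteq> \<zero>\<close> qa(1) qt(1) by (auto simp: e_def integral_iff)
  define Ls where "Ls = map (\<lambda>i. x [^] i \<otimes> u1) [0..<Suc (2 * N * d)] @
      map (\<lambda>i. x [^] i \<otimes> u2) [0..<Suc (2 * N * d)]"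
  have LsR: "set Ls \<subseteq> carrier R" using x u by (auto simp: Ls_def)
  have LsS: "set Ls \<subseteq> Span ?K Ls" by (rule Span_base_incl[OF subfield_const LsR])
  have WL: "w \<in> Span ?K Ls" if w: "w \<in> W (2 * N * d)" for w
  proof -
    obtain p r where pr: "w = ?p p \<otimes> u1 \<oplus> ?p r \<otimes> u2" "degree p \<le> 2 * N * d" "degree r \<le> 2 * N * d"
      using w by (auto simp: W_def)
    have "x [^] i \<otimes> u1 \<in> set Ls" "x [^] i \<otimes> u2 \<in> set Ls" if "i \<le> 2 * N * d" for i
      using that by (auto simp: Ls_def simp del: upt_Suc)
    then have "x [^] i \<otimes> u1 \<in> Span ?K Ls" "x [^] i \<otimes> u2 \<in> Span ?K Ls" if "i \<le> 2 * N * d" for i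
      using that LsS by blast+
    then have "?p p \<otimes> u1 \<in> Span ?K Ls" "?p r \<otimes> u2 \<in> Span ?K Ls"
      using pr by (auto intro!: peval_mult_in_Span[OF x _ LsR, where m = "2 * N * d"] u simp del: Span.simps)
    then show ?thesis unfolding pr(1) by (rule Span_subgroup_props(3)[OF subfield_const LsR])
  qed
  have mon: "monomial a t ij \<otimes> e \<in> Span ?K Ls" if ij: "ij \<in> {0..<N} \<times> {0..<N}" for ij
  proof -
    obtain i j where ij': "ij = (i, j)" "i < N" "j < N" using ij by auto
    have "u1 \<in> W 0" unfolding W_def using u x
      by (intro CollectI exI[of _ 1] exI[of _ 0]) simp
    moreover have "mulW ((?p qa [^] N \<otimes> a [^] i) \<otimes> (?p qt [^] N \<otimes> t [^] j)) (N * d + N * d)"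
      (is "mulW ?c _")
      using ij' d a t by (intro mulW_mult pow)
    ultimately have "(?p qa [^] N \<otimes> a [^] i) \<otimes> (?p qt [^] N \<otimes> t [^] j) \<otimes> u1 \<in> W (2 * N * d)"
      unfolding mulW_def by (metis add_0 mult_2 add_mult_distrib)
    moreover have "monomial a t ij \<otimes> e = (?p qa [^] N \<otimes> a [^] i) \<otimes> (?p qt [^] N \<otimes> t [^] j) \<otimes> u1"
      using a t x u by (simp add: monomial_def ij' e_def m_ac)
    ultimately show ?thesis using WL by metis
  qed
  have "dependent ?K (map (monomial a t) (List.product [0..<N] [0..<N]))"
  proof
    define zs where "zs = map (monomial a t) (List.product [0..<N] [0..<N])"
    assume "independent ?K (map (monomial a t) (List.product [0..<N] [0..<N]))"
    then have "dimension (N * N) ?K (Span ?K zs)"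
      using dimension_independent[of ?K zs] by (simp add: zs_def)
    from dimension_mult[OF this subfield_const e]
    have "dimension (N * N) ?K ((\<lambda>b. b \<otimes> e) ` Span ?K zs)" .
    then obtain Us where Us: "independent ?K Us" "length Us = N * N"
        "Span ?K Us = (\<lambda>b. b \<otimes> e) ` Span ?K zs" "set Us \<subseteq> carrier R"
      using exists_base[OF subfield_const] by blast
    have sub: "b \<in> carrier R \<and> b \<otimes> e \<in> Span ?K Ls" if "set zs' \<subseteq> set zs" "b \<in> Span ?K zs'" for zs' b
      using that
    proof (induction zs' arbitrary: b)
      case Nil
      then have "b = \<zero>" by simp
      then show ?case using e Span_subgroup_props(2)[OF subfield_const LsR] by (simp del: Span.simps)
    next
      case (Cons z zs')
      then obtain c b' where b': "b = \<iota> c \<otimes> z \<oplus> b'" "b' \<in> Span ?K zs'"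
        by (auto simp: line_extension_mem_iff)
      have IH: "b' \<in> carrier R" "b' \<otimes> e \<in> Span ?K Ls"
        using Cons.IH[OF _ b'(2)] Cons.prems by (auto simp del: Span.simps)
      obtain ij where ij: "ij \<in> {0..<N} \<times> {0..<N}" "z = monomial a t ij"
        using Cons.prems(1) by (auto simp: zs_def)
      have z: "z \<in> carrier R" "z \<otimes> e \<in> Span ?K Ls"
        using mon[OF ij(1)] ij a t by (auto simp: monomial_def simp del: Span.simps)
      have "b \<otimes> e = \<iota> c \<otimes> (z \<otimes> e) \<oplus> b' \<otimes> e"
        using z IH e by (simp add: b'(1) l_distr m_assoc)
      also have "\<dots> \<in> Span ?K Ls"
        using z IH Span_subgroup_props(3)[OF subfield_const LsR] Span_smult_closed[OF subfield_const LsR]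
        by blast
      finally show ?case using z IH b'(1) by (simp del: Span.simps)
    qed
    have "set Us \<subseteq> Span ?K Ls"
      using Span_base_incl[OF subfield_const Us(4)] Us(3) sub[of zs] by (auto simp del: Span.simps)
    moreover obtain n where "n \<le> length Ls" "dimension n ?K (Span ?K Ls)"
      using Span_dimension_le[OF subfield_const LsR] by blast
    ultimately have "N * N \<le> length Ls"
      using independent_length_le_dimension[OF subfield_const _ Us(1)] Us(2) by fastforce
    also have "length Ls = 4 * (N * d) + 2" by (simp add: Ls_def)
    also have "\<dots> < N * N"
    proof -
      have "4 * (N * d) + 2 < N * (4 * d) + N * 3" by (simp add: N_def)
      also have "\<dots> = N * N" by (simp add: N_def algebra_simps)
      finally show ?thesis .
    qed
    finally show False by simp
  qed
  then show "\<exists>N::nat. dependent ?K (map (monomial a t) (List.product [0..<N] [0..<N]))" by blast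
qed

end

context field_over_hom
begin

text \<open>As \<open>h\<close> is injective, independent monomials over \<open>G\<close> would map
  to independent monomials over \<open>R\<close>.\<close>

lemma transcendence_degree_le_1_subfield:
  assumes "X.transcendence_degree_le_1"
  shows "E.transcendence_degree_le_1"
  unfolding E.transcendence_degree_le_1_def
proof (intro ballI)
  fix a t assume at: "a \<in> carrier G" "t \<in> carrier G"
  then obtain N where N: "\<not> X.independent (range \<iota>)
      (map (X.monomial (h a) (h t)) (List.product [0..<N] [0..<N]))"
    using assms unfolding X.transcendence_degree_le_1_def by fastforce
  let ?us = "map (E.monomial a t) (List.product [0..<N] [0..<N])"
  have "set ?us \<subseteq> carrier G" using at by (auto simp: E.monomial_def)
  then have "E.Span (range \<kappa>) ?us \<subseteq> carrier G"
    by (rule E.Span_subgroup_props(1)[OF E.subfield_const])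
  then have inj: "inj_on h (E.Span (range \<kappa>) ?us)" using inj_on_subset[OF h_inj] by blast
  have map_us: "map h ?us = map (X.monomial (h a) (h t)) (List.product [0..<N] [0..<N])"
    using at by (simp add: E.monomial_def X.monomial_def h_pow)
  have const_img: "h ` range \<kappa> = range \<iota>" using hom_const by (auto simp: image_iff)
  have "\<not> E.independent (range \<kappa>) ?us"
    using h.inj_hom_preserves_independent[OF E.subfield_const X.one_not_zero inj] N
    unfolding map_us const_img by blast
  then show "\<exists>N. \<not> E.independent (range \<kappa>)
      (map (E.monomial a t) (List.product [0..<N] [0..<N]))" by blast
qed

end

section \<open>Regular local rings of dimension one\<close>

context field_over
begin

declare Span.simps [simp del]

lemma Span_Nil [simp]: "Span K [] = {\<zero>}"
  by (simp add: Span.simps)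

lemma Span_Cons_iff: "a \<in> Span K (u # us) \<longleftrightarrow> (\<exists>k\<in>K. \<exists>b\<in>Span K us. a = k \<otimes> u \<oplus> b)"
  by (simp add: Span.simps line_extension_mem_iff)

section \<open>Integer powers of nonzero elements\<close>

lemma units_of_inv: "x \<in> Units R \<Longrightarrow> inv\<^bsub>units_of R\<^esub> x = inv x"
  using group.inv_equality[OF units_group, of "inv x" x]
  by (simp add: units_of_carrier units_of_mult units_of_one)

text \<open>\<open>ord_at\<close> takes integer powers in the ring, while the power laws are those
  of groups; the group of units transfers them.\<close>

lemma units_of_int_pow: "x \<in> Units R \<Longrightarrow> x [^]\<^bsub>units_of R\<^esub> (k::int) = x [^] k"
proof -
  assume x: "x \<in> Units R"
  have nat: "x [^]\<^bsub>units_of R\<^esub> (n::nat) = x [^] n" for n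
    by (simp add: nat_pow_def units_of_mult units_of_one)
  have "x [^] (n::nat) \<in> Units R" for n using x by (rule Units_pow_closed)
  then show ?thesis by (simp add: int_pow_def2 nat units_of_inv del: pow_nat)
qed

lemma int_pow_nonzero: 
  assumes "x \<in> carrier R" "x \<noteq> \<zero>"
  shows "x [^] (k::int) \<in> carrier R" "x [^] k \<noteq> \<zero>"
  using assms by (auto simp: int_pow_def2 simp del: pow_nat)

lemma int_pow_add:
  assumes "x \<in> carrier R" "x \<noteq> \<zero>"
  shows "x [^] (k + l :: int) = x [^] k \<otimes> x [^] l"
  using group.int_pow_mult[OF units_group, of x k l] nonzero_Units[OF assms]
  by (simp add: units_of_int_pow units_of_carrier units_of_mult)

lemma int_pow_distrib:
  assumes "x \<in> carrier R" "x \<noteq> \<zero>" "y \<in> carrier R" "y \<noteq> \<zero>"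
  shows "(x \<otimes> y) [^] (k :: int) = x [^] k \<otimes> y [^] k"
  using comm_group.int_pow_distrib[OF units_comm_group, of x y k] nonzero_Units assms
  by (simp add: units_of_int_pow units_of_carrier units_of_mult)

end

text \<open>Models the local ring \<open>A\<close> of a point with its maximal ideal
  \<open>m\<close>, placed inside the function field as its fraction field (see
  \<open>local_subring_local_ring\<close>).\<close>

locale local_subring = field_over R \<iota> for R (structure) and \<iota> :: "'k::field \<Rightarrow> 'a" +
  fixes A m :: "'a set"
  assumes A_carrier: "A \<subseteq> carrier R"
    and A_add: "a \<in> A \<Longrightarrow> b \<in> A \<Longrightarrow> a \<oplus> b \<in> A"
    and A_mult: "a \<in> A \<Longrightarrow> b \<in> A \<Longrightarrow> a \<otimes> b \<in> A"
    and A_const: "\<iota> c \<in> A"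
    and m_A: "m \<subseteq> A"
    and zero_m: "\<zero> \<in> m"
    and m_add: "a \<in> m \<Longrightarrow> b \<in> m \<Longrightarrow> a \<oplus> b \<in> m"
    and m_mult: "a \<in> A \<Longrightarrow> b \<in> m \<Longrightarrow> a \<otimes> b \<in> m"
    and one_m: "\<one> \<notin> m"
    and A_units: "a \<in> A \<Longrightarrow> a \<notin> m \<Longrightarrow> inv a \<in> A"
    and A_residue: "a \<in> A \<Longrightarrow> \<exists>c. a \<ominus> \<iota> c \<in> m"
    and A_fractions: "a \<in> carrier R \<Longrightarrow> \<exists>b\<in>A. \<exists>c\<in>A. c \<noteq> \<zero> \<and> a = b \<otimes> inv c"
begin

lemma A_closed: "a \<in> A \<Longrightarrow> a \<in> carrier R"
  using A_carrier by blast

lemma m_closed': "a \<in> m \<Longrightarrow> a \<in> A" "a \<in> m \<Longrightarrow> a \<in> carrier R"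
  using m_A A_carrier by blast+

lemma A_one: "\<one> \<in> A"
  using A_const[of 1] by simp

lemma A_uminus: "a \<in> A \<Longrightarrow> \<ominus> a \<in> A"
  using A_mult[OF A_const[of "- 1"], of a] A_closed by (simp add: const_uminus l_minus)

lemma A_minus: "a \<in> A \<Longrightarrow> b \<in> A \<Longrightarrow> a \<ominus> b \<in> A"
  by (simp add: minus_eq A_add A_uminus)

lemma m_uminus: "a \<in> m \<Longrightarrow> \<ominus> a \<in> m"
  using m_mult[OF A_const[of "- 1"], of a] m_closed' by (simp add: const_uminus l_minus)

text \<open>With coefficients from \<open>A\<close> instead of a subfield, \<open>Span A us\<close>
  is the ideal generated by \<open>us\<close>. The facts about spans over subfields do not apply to
  it, so its closure properties are shown by separate inductions.\<close>

lemma Span_A: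
  assumes "set us \<subseteq> A"
  shows "Span A us \<subseteq> A"
  using assms
proof (induction us)
  case Nil
  then show ?case using A_const[of 0] by simp
next
  case (Cons u us)
  then have "u \<in> A" "Span A us \<subseteq> A" by auto
  then show ?case using A_add A_mult by (fastforce simp: Span_Cons_iff)
qed

lemma zero_Span_A: "set us \<subseteq> A \<Longrightarrow> \<zero> \<in> Span A us"
proof (induction us)
  case (Cons u us)
  have "\<zero> = \<iota> 0 \<otimes> u \<oplus> \<zero>" using Cons.prems A_closed by simp
  moreover have "\<zero> \<in> Span A us" using Cons by simp
  ultimately show ?case using A_const[of 0] unfolding Span_Cons_iff by blast
qed simp

lemma Span_A_add:
  assumes "set us \<subseteq> A" "a \<in> Span A us" "b \<in> Span A us"
  shows "a \<oplus> b \<in> Span A us"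
  using assms
proof (induction us arbitrary: a b)
  case (Cons u us)
  then obtain k a' l b' where *: "k \<in> A" "a' \<in> Span A us" "a = k \<otimes> u \<oplus> a'"
      "l \<in> A" "b' \<in> Span A us" "b = l \<otimes> u \<oplus> b'"
    by (auto simp: Span_Cons_iff)
  have us: "set us \<subseteq> A" using Cons.prems by simp
  have "a' \<in> carrier R" "b' \<in> carrier R" "u \<in> carrier R" "k \<in> carrier R" "l \<in> carrier R"
    using * Span_A[OF us] A_closed Cons.prems(1) by auto
  then have "a \<oplus> b = (k \<oplus> l) \<otimes> u \<oplus> (a' \<oplus> b')" by (simp add: * l_distr a_ac)
  moreover have "a' \<oplus> b' \<in> Span A us" using Cons.IH * us by blast
  ultimately show ?case using *(1,4) A_add unfolding Span_Cons_iff by blast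
qed simp

lemma Span_A_mult:
  assumes "set us \<subseteq> A" "c \<in> A" "a \<in> Span A us"
  shows "c \<otimes> a \<in> Span A us"
  using assms
proof (induction us arbitrary: a)
  case (Cons u us)
  then obtain k a' where *: "k \<in> A" "a' \<in> Span A us" "a = k \<otimes> u \<oplus> a'"
    by (auto simp: Span_Cons_iff)
  have us: "set us \<subseteq> A" using Cons.prems by simp
  have "a' \<in> carrier R" "u \<in> carrier R" "k \<in> carrier R" "c \<in> carrier R"
    using * Span_A[OF us] A_closed Cons.prems by auto
  then have "c \<otimes> a = (c \<otimes> k) \<otimes> u \<oplus> c \<otimes> a'" by (simp add: * r_distr m_assoc)
  moreover have "c \<otimes> a' \<in> Span A us" using Cons.IH * us Cons.prems by blast
  ultimately show ?case using *(1) A_mult Cons.prems unfolding Span_Cons_iff by blast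
qed (use A_closed in auto)

lemma mem_Span_A: "set us \<subseteq> A \<Longrightarrow> u \<in> set us \<Longrightarrow> u \<in> Span A us"
proof (induction us)
  case (Cons w us)
  have us: "set us \<subseteq> A" using Cons.prems by simp
  consider "u = w" | "u \<in> set us" using Cons.prems by auto
  then show ?case
  proof cases
    case 1
    then have "u = \<one> \<otimes> w \<oplus> \<zero>" using Cons.prems A_closed by simp
    then show ?thesis using A_one zero_Span_A[OF us] unfolding Span_Cons_iff by blast
  next
    case 2
    then have "u = \<zero> \<otimes> w \<oplus> u" using Cons.prems A_closed by auto
    then show ?thesis using A_const[of 0] Cons.IH[OF us 2] unfolding Span_Cons_iff const_zero by blast
  qed
qed simp

lemma Span_m: "set us \<subseteq> m \<Longrightarrow> Span A us \<subseteq> m"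
proof (induction us)
  case (Cons u us)
  then show ?case using m_add m_mult by (fastforce simp: Span_Cons_iff)
qed (simp add: zero_m)

lemma const_m: "\<iota> c \<in> m \<Longrightarrow> c = 0"
proof (rule ccontr)
  assume "\<iota> c \<in> m" "c \<noteq> 0"
  then have "\<iota> (inverse c) \<otimes> \<iota> c \<in> m" using A_const m_mult by blast
  then show False using \<open>c \<noteq> 0\<close> one_m by (simp flip: const_mult)
qed

text \<open>The subring K + I, where I is the ideal generated by \<open>us\<close>. In
  \<open>max_ideal_generators\<close> it absorbs all quotients of forms by powers of a linear
  form.\<close>

definition const_plus_Span :: "'a list \<Rightarrow> 'a set" where
  "const_plus_Span us = {a. \<exists>c. \<exists>s\<in>Span A us. a = \<iota> c \<oplus> s}"

text \<open>For the last part, subtracting the ideal component from an element of \<open>m\<close>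
  leaves a constant in \<open>m\<close>, which can only be zero.\<close>

lemma const_plus_Span_closed:
  assumes us: "set us \<subseteq> m"
  shows "\<iota> c \<in> const_plus_Span us"
    and "a \<in> const_plus_Span us \<Longrightarrow> b \<in> const_plus_Span us \<Longrightarrow> a \<oplus> b \<in> const_plus_Span us"
    and "a \<in> const_plus_Span us \<Longrightarrow> b \<in> const_plus_Span us \<Longrightarrow> a \<otimes> b \<in> const_plus_Span us"
    and "a \<in> const_plus_Span us \<Longrightarrow> a \<in> m \<Longrightarrow> a \<in> Span A us"
proof -
  have usA: "set us \<subseteq> A" using us m_A by blast
  note SA = Span_A[OF usA] and Sm = Span_m[OF us]
  have "\<iota> c = \<iota> c \<oplus> \<zero>" by simp
  then show "\<iota> c \<in> const_plus_Span us"
    unfolding const_plus_Span_def using zero_Span_A[OF usA] by blast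
  assume "a \<in> const_plus_Span us"
  then obtain c s where a: "s \<in> Span A us" "a = \<iota> c \<oplus> s" by (auto simp: const_plus_Span_def)
  have s: "s \<in> A" "s \<in> carrier R" using a SA A_closed by auto
  {
    assume "b \<in> const_plus_Span us"
    then obtain d r where b: "r \<in> Span A us" "b = \<iota> d \<oplus> r" by (auto simp: const_plus_Span_def)
    have r: "r \<in> A" "r \<in> carrier R" using b SA A_closed by auto
    have "a \<oplus> b = \<iota> (c + d) \<oplus> (s \<oplus> r)" using a b s r by (simp add: const_add a_ac)
    then show "a \<oplus> b \<in> const_plus_Span us"
      unfolding const_plus_Span_def using Span_A_add[OF usA a(1) b(1)] by blast
    have "a \<otimes> b = \<iota> (c * d) \<oplus> (\<iota> c \<otimes> r \<oplus> b \<otimes> s)"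
      using a b s r by (simp add: const_mult l_distr r_distr a_ac m_ac)
    moreover have "b \<in> A" using b r A_add A_const by blast
    ultimately show "a \<otimes> b \<in> const_plus_Span us"
      unfolding const_plus_Span_def
      using Span_A_add[OF usA Span_A_mult[OF usA A_const b(1)] Span_A_mult[OF usA _ a(1)]] by blast
  }
  assume "a \<in> m"
  have "\<iota> c = a \<oplus> (\<ominus> s)" using a(2) s by (simp add: a_assoc r_neg)
  moreover have "\<ominus> s \<in> m" using a(1) Sm m_uminus by blast
  ultimately have "\<iota> c \<in> m" using \<open>a \<in> m\<close> m_add by metis
  then have "c = 0" by (rule const_m)
  then show "a \<in> Span A us" using a s by simp
qed

end

text \<open>\<open>gens\<close> is the finite generation that Nakayama's lemma asks for;
  \<open>tr_deg\<close> takes the place of the Noetherian property in Krull's intersection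
  theorem.\<close>

locale nonsingular_local_ring = local_subring R \<iota> A m
  for R (structure) and \<iota> :: "'k::field \<Rightarrow> 'a" and A m :: "'a set" +
  fixes ms :: "'a list"
  assumes gens: "set ms \<subseteq> m" "m \<subseteq> Span A ms"
    and cotangent: "\<exists>t\<in>m. t \<notin> ideal_prod R m m \<and> m = line_extension (range \<iota>) t (ideal_prod R m m)"
    and tr_deg: transcendence_degree_le_1
begin

text \<open>Nakayama's lemma, by dropping generators one at a time: \<open>g = k t + z\<close> with \<open>z \<in> \<mm>\<^sup>2\<close> expresses
  \<open>(1 - b) g\<close>, with \<open>b \<in> \<mm>\<close>, through the remaining generators.\<close>

lemma drop_generator:
  assumes t: "m = line_extension (range \<iota>) t (ideal_prod R m m)"
    and g: "g \<in> m" "set gs \<subseteq> m" "t \<in> set gs" and span: "m \<subseteq> Span A (g # gs)"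
  shows "m \<subseteq> Span A gs"
proof -
  have gsA: "set gs \<subseteq> A" using g m_A by blast
  have tS: "t \<in> Span A gs" using mem_Span_A[OF gsA] g by blast
  \<comment> \<open>Only the second factor of a product is expanded along \<open>g\<close>; the
    first factor, being in \<open>m\<close>, pushes the coefficient of \<open>g\<close> into
    \<open>m\<close>.\<close>
  have "\<exists>b\<in>m. \<exists>s\<in>Span A gs. z = b \<otimes> g \<oplus> s" if "z \<in> ideal_prod R m m" for z
    using that
  proof induction
    case (prod i j)
    then obtain a s where as: "a \<in> A" "s \<in> Span A gs" "j = a \<otimes> g \<oplus> s"
      using span unfolding Span_Cons_iff subset_eq by blast
    have "i \<otimes> j = (a \<otimes> i) \<otimes> g \<oplus> i \<otimes> s"
      using prod as Span_A[OF gsA] m_closed' A_closed g(1) by (auto simp: r_distr m_ac subsetD)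
    moreover have "i \<otimes> s \<in> Span A gs" using Span_A_mult[OF gsA] as prod m_closed' by blast
    ultimately show ?case using m_mult as prod by blast
  next
    case (sum s1 s2)
    then obtain b1 r1 b2 r2 where *: "b1 \<in> m" "r1 \<in> Span A gs" "s1 = b1 \<otimes> g \<oplus> r1"
        "b2 \<in> m" "r2 \<in> Span A gs" "s2 = b2 \<otimes> g \<oplus> r2" by blast
    have "s1 \<oplus> s2 = (b1 \<oplus> b2) \<otimes> g \<oplus> (r1 \<oplus> r2)"
      using * Span_A[OF gsA] m_closed' A_closed g(1) by (auto simp: l_distr a_ac subsetD)
    then show ?case using * m_add Span_A_add[OF gsA] by blast
  qed
  moreover have "g \<in> line_extension (range \<iota>) t (ideal_prod R m m)"
    using g(1) by (subst (asm) t)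
  then obtain c z where cz: "z \<in> ideal_prod R m m" "g = \<iota> c \<otimes> t \<oplus> z"
    by (auto simp: line_extension_mem_iff)
  ultimately obtain b s where bs: "b \<in> m" "s \<in> Span A gs" "z = b \<otimes> g \<oplus> s" by blast
  let ?s = "\<iota> c \<otimes> t \<oplus> s"
  have s: "?s \<in> Span A gs" using bs tS Span_A_add[OF gsA] Span_A_mult[OF gsA A_const] by blast
  have car: "g \<in> carrier R" "b \<in> carrier R" "s \<in> carrier R" "t \<in> carrier R"
    using g bs Span_A[OF gsA] m_closed' A_closed by auto
  have eq: "(\<one> \<ominus> b) \<otimes> g = ?s"
  proof -
    have g_eq: "g = \<iota> c \<otimes> t \<oplus> (b \<otimes> g \<oplus> s)" using cz(2) unfolding bs(3) .
    have "(\<one> \<ominus> b) \<otimes> g = g \<ominus> b \<otimes> g" using car by algebra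
    also have "\<dots> = (\<iota> c \<otimes> t \<oplus> (b \<otimes> g \<oplus> s)) \<ominus> b \<otimes> g"
      by (rule arg_cong[OF g_eq, of "\<lambda>z. z \<ominus> b \<otimes> g"])
    also have "\<dots> = ?s" using car const_closed[of c] by algebra
    finally show ?thesis .
  qed
  have "\<one> \<ominus> b \<notin> m"
  proof
    assume "\<one> \<ominus> b \<in> m"
    then have "(\<one> \<ominus> b) \<oplus> b \<in> m" using bs m_add by blast
    moreover have "(\<one> \<ominus> b) \<oplus> b = \<one>" using car by algebra
    ultimately show False using one_m by simp
  qed
  moreover have A1: "\<one> \<ominus> b \<in> A" using A_one bs m_closed' A_minus by blast
  ultimately have "inv (\<one> \<ominus> b) \<in> A" "\<one> \<ominus> b \<noteq> \<zero>" using A_units zero_m by auto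
  moreover have "g = inv (\<one> \<ominus> b) \<otimes> ?s"
    using car \<open>\<one> \<ominus> b \<noteq> \<zero>\<close> by (simp add: eq[symmetric] m_assoc[symmetric])
  ultimately have gS: "g \<in> Span A gs" using Span_A_mult[OF gsA _ s] by metis
  show ?thesis
  proof
    fix a assume "a \<in> m"
    then obtain k r where "k \<in> A" "r \<in> Span A gs" "a = k \<otimes> g \<oplus> r"
      using span unfolding Span_Cons_iff subset_eq by blast
    then show "a \<in> Span A gs" using gS Span_A_add[OF gsA] Span_A_mult[OF gsA] by blast
  qed
qed

definition unif :: "'a \<Rightarrow> bool" where
  "unif t \<longleftrightarrow> t \<in> m \<and> m = {t \<otimes> a | a. a \<in> A}"

lemma unifD:
  assumes "unif t"
  shows "t \<in> m" "t \<in> A" "t \<in> carrier R" "b \<in> m \<Longrightarrow> \<exists>a\<in>A. b = t \<otimes> a"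
proof -
  show "t \<in> m" using assms unfolding unif_def by (rule conjunct1)
  then show "t \<in> A" "t \<in> carrier R" by (rule m_closed')+
  show "\<exists>a\<in>A. b = t \<otimes> a" if "b \<in> m" using assms that unfolding unif_def by blast
qed

text \<open>Append the cotangent generator \<open>t\<close> to the generators of \<open>m\<close>
  and let \<open>drop_generator\<close> remove all others. That \<open>t\<close> is nonzero follows
  from its lying outside the square of \<open>m\<close>.\<close>

lemma ex_unif: "\<exists>t. unif t \<and> t \<noteq> \<zero>"
proof -
  obtain t where t: "t \<in> m" "t \<notin> ideal_prod R m m" "m = line_extension (range \<iota>) t (ideal_prod R m m)"
    using cotangent by blast
  have step: "m \<subseteq> Span A (gs @ [t]) \<Longrightarrow> set gs \<subseteq> m \<Longrightarrow> m \<subseteq> Span A [t]" for gs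
  proof (induction gs)
    case (Cons g gs)
    then have "m \<subseteq> Span A (gs @ [t])"
      using drop_generator[OF t(3), of g "gs @ [t]"] t(1) by auto
    then show ?case using Cons by auto
  qed simp
  have "Span A ms \<subseteq> Span A (ms @ [t])"
  proof -
    have "set us \<subseteq> A \<Longrightarrow> Span A us \<subseteq> Span A (us @ [t])" for us
    proof (induction us)
      case Nil
      then show ?case using zero_Span_A[of "[t]"] t(1) m_closed' by auto
    next
      case (Cons u us)
      then have IH: "Span A us \<subseteq> Span A (us @ [t])" by simp
      show ?case
      proof
        fix a assume "a \<in> Span A (u # us)"
        then obtain k b where "k \<in> A" "b \<in> Span A us" "a = k \<otimes> u \<oplus> b"
          unfolding Span_Cons_iff by blast
        then show "a \<in> Span A ((u # us) @ [t])"
          using IH unfolding append_Cons Span_Cons_iff by blast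
      qed
    qed
    then show ?thesis using gens m_A by blast
  qed
  then have mt: "m \<subseteq> Span A [t]" using step gens by blast
  have "m = {t \<otimes> a | a. a \<in> A}"
  proof
    show "m \<subseteq> {t \<otimes> a | a. a \<in> A}"
    proof
      fix b assume "b \<in> m"
      then have "b \<in> Span A [t]" using mt by blast
      then obtain a where "a \<in> A" "b = a \<otimes> t \<oplus> \<zero>" unfolding Span_Cons_iff Span_Nil by blast
      moreover from this have "b = t \<otimes> a"
        using m_closed'(2)[OF t(1)] A_closed by (simp add: m_comm)
      ultimately show "b \<in> {t \<otimes> a | a. a \<in> A}" by blast
    qed
    show "{t \<otimes> a | a. a \<in> A} \<subseteq> m"
    proof
      fix b assume "b \<in> {t \<otimes> a | a. a \<in> A}"
      then obtain a where a: "a \<in> A" "b = t \<otimes> a" by blast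
      then have "b = a \<otimes> t" using m_closed'(2)[OF t(1)] A_closed by (simp add: m_comm)
      then show "b \<in> m" using m_mult a t(1) by blast
    qed
  qed
  moreover have "t \<noteq> \<zero>"
  proof
    assume "t = \<zero>"
    then have "t = \<zero> \<otimes> \<zero>" by simp
    then show False using ideal_prod.prod[OF zero_m zero_m, of R] t(2) by simp
  qed
  ultimately show ?thesis using t(1) unfolding unif_def by blast
qed

text \<open>Krull's intersection theorem: if \<open>a\<close> were divisible by all powers of \<open>t\<close>, then each monomial
  \<open>a\<^sup>i t\<^sup>j\<close> would lie outside the span of the lexicographically larger ones.\<close>

lemma krull_intersection:
  assumes t: "unif t" "t \<noteq> \<zero>" and a: "a \<in> A" "a \<noteq> \<zero>"
  shows "\<exists>n::nat. a \<notin> {t [^] n \<otimes> b | b. b \<in> A}"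
proof (rule ccontr)
  assume "\<not> ?thesis"
  then have all: "\<exists>b\<in>A. a = t [^] n \<otimes> b" for n :: nat by blast
  have car: "a \<in> carrier R" "t \<in> carrier R" and tA: "t \<in> A"
    using a unifD(2,3)[OF t(1)] A_closed by auto
  have powA: "b [^] n \<in> A" if "b \<in> A" for b and n :: nat
    using that by (induction n) (auto simp: A_one A_mult)
  have indep: "independent (range \<iota>) (map (monomial a t) ps)" if "sorted_wrt lex_less ps" for ps
    using that
  proof (induction ps)
    case (Cons p ps)
    obtain i j where p: "p = (i, j)" by force
    \<comment> \<open>This ideal contains every lexicographically later monomial: with the same
      exponent of \<open>a\<close> the exponent of \<open>t\<close> has grown, and with a larger one
      a spare factor \<open>a\<close> is divisible by \<open>t [^] Suc j\<close>. The monomial of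
      \<open>p\<close> itself stays outside, since otherwise \<open>\<one> = t \<otimes> b\<close>
      would lie in \<open>m\<close>.\<close>
    define I where "I = {a [^] i \<otimes> t [^] Suc j \<otimes> b | b. b \<in> A}"
    have I_add: "b \<oplus> c \<in> I" if bc: "b \<in> I" "c \<in> I" for b c
    proof -
      obtain b' c' where *: "b' \<in> A" "c' \<in> A" "b = a [^] i \<otimes> t [^] Suc j \<otimes> b'"
          "c = a [^] i \<otimes> t [^] Suc j \<otimes> c'" using bc by (auto simp: I_def)
      then have "b \<oplus> c = a [^] i \<otimes> t [^] Suc j \<otimes> (b' \<oplus> c')"
        using car A_closed by (simp add: r_distr)
      then show ?thesis using * A_add by (auto simp: I_def)
    qed
    have I_mult: "k \<otimes> b \<in> I" if kb: "b \<in> I" "k \<in> A" for b k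
    proof -
      obtain b' where *: "b' \<in> A" "b = a [^] i \<otimes> t [^] Suc j \<otimes> b'" using kb by (auto simp: I_def)
      then have "k \<otimes> b = a [^] i \<otimes> t [^] Suc j \<otimes> (k \<otimes> b')"
        using car A_closed kb by (simp add: m_ac)
      then show ?thesis using * A_mult kb by (auto simp: I_def)
    qed
    have I_0: "\<zero> \<in> I"
      unfolding I_def using car A_const[of 0] by (intro CollectI exI[of _ \<zero>]) simp
    have "monomial a t q \<in> I" if q: "q \<in> set ps" for q
    proof -
      obtain i' j' where q': "q = (i', j')" by force
      have "lex_less (i, j) (i', j')" using Cons.prems q p q' by auto
      then consider "i' = i" "j < j'" | "i < i'" by (auto simp: lex_less_def)
      then show ?thesis
      proof cases
        case 1
        then obtain l where l: "j' = Suc j + l" by (metis less_iff_Suc_add add_Suc)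
        have "t [^] j' = t [^] Suc j \<otimes> t [^] l"
          unfolding l using car by (simp only: nat_pow_mult)
        then have "monomial a t q = a [^] i \<otimes> t [^] Suc j \<otimes> t [^] l"
          using 1 car by (simp add: monomial_def q' m_assoc del: nat_pow_Suc)
        then show ?thesis unfolding I_def using powA[OF tA] by blast
      next
        case 2
        then obtain l where l: "i' = Suc i + l" by (metis less_iff_Suc_add add_Suc)
        obtain b where b: "b \<in> A" "a = t [^] Suc j \<otimes> b" using all[of "Suc j"] by blast
        have "monomial a t q = a [^] i \<otimes> a \<otimes> a [^] l \<otimes> t [^] j'"
          using car by (simp add: monomial_def q' l nat_pow_mult[symmetric] m_ac)
        also have "\<dots> = a [^] i \<otimes> (t [^] Suc j \<otimes> b) \<otimes> a [^] l \<otimes> t [^] j'"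
          by (rule arg_cong[OF b(2), of "\<lambda>z. a [^] i \<otimes> z \<otimes> a [^] l \<otimes> t [^] j'"])
        also have "\<dots> = a [^] i \<otimes> t [^] Suc j \<otimes> (b \<otimes> a [^] l \<otimes> t [^] j')"
          using car A_closed[OF b(1)] by (simp add: m_assoc del: nat_pow_Suc)
        finally show ?thesis unfolding I_def using powA[OF tA] powA[OF a(1)] b(1) A_mult by blast
      qed
    qed
    then have "Span (range \<iota>) (map (monomial a t) qs) \<subseteq> I" if "set qs \<subseteq> set ps" for qs
      using that I_0
      by (induction qs) (auto simp: Span_Cons_iff intro!: I_add I_mult A_const)
    then have "Span (range \<iota>) (map (monomial a t) ps) \<subseteq> I" by blast
    moreover have "monomial a t p \<notin> I"
    proof
      assume "monomial a t p \<in> I"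
      then obtain b where b: "b \<in> A" "a [^] i \<otimes> t [^] j = a [^] i \<otimes> t [^] Suc j \<otimes> b"
        by (auto simp: I_def monomial_def p)
      moreover have "a [^] i \<otimes> t [^] Suc j \<otimes> b = (a [^] i \<otimes> t [^] j) \<otimes> (t \<otimes> b)"
        using car A_closed[OF b(1)] by (simp add: m_assoc)
      ultimately have "(a [^] i \<otimes> t [^] j) \<otimes> \<one> = (a [^] i \<otimes> t [^] j) \<otimes> (t \<otimes> b)"
        using car by (metis m_closed nat_pow_closed r_one)
      moreover have "a [^] i \<otimes> t [^] j \<noteq> \<zero>" using car a t by (simp add: integral_iff)
      ultimately have "\<one> = t \<otimes> b"
        using car A_closed[OF b(1)] by (subst (asm) m_lcancel) auto
      moreover have "t \<otimes> b \<in> m"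
        using m_mult[OF b(1) unifD(1)[OF t(1)]] m_comm[of t b] car A_closed[OF b(1)] by simp
      ultimately show False using one_m by simp
    qed
    moreover have "monomial a t p \<in> carrier R" using car by (simp add: monomial_def)
    ultimately show ?case using Cons by (auto intro!: li_Cons simp del: Span.simps)
  qed auto
  have "independent (range \<iota>) (map (monomial a t) (List.product [0..<N] [0..<N]))" for N
    by (intro indep sorted_product) auto
  then show False using tr_deg car unfolding transcendence_degree_le_1_def by blast
qed

text \<open>Has the shape of \<open>ord_at\<close>, with \<open>unif\<close> for
  \<open>uniformizer\<close>, so that \<open>ord_at_valuation\<close> identifies the two by
  unfolding.\<close>

definition valu :: "'a \<Rightarrow> int" where
  "valu a = (THE k::int. \<exists>t u. unif t \<and> u \<in> A - m \<and> a = u \<otimes> t [^] k)"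

lemma A_unit: "u \<in> A - m \<Longrightarrow> u \<in> carrier R \<and> u \<noteq> \<zero> \<and> inv u \<in> A - m"
proof -
  assume u: "u \<in> A - m"
  then have 1: "u \<in> carrier R" "u \<noteq> \<zero>" "inv u \<in> A" using zero_m A_closed A_units by auto
  have "inv u \<notin> m"
  proof
    assume "inv u \<in> m"
    then have "u \<otimes> inv u \<in> m" using u m_mult by blast
    then show False using 1 one_m by simp
  qed
  then show ?thesis using 1 by simp
qed

lemma unit_mult: "u \<in> A - m \<Longrightarrow> w \<in> A - m \<Longrightarrow> u \<otimes> w \<in> A - m"
proof -
  assume u: "u \<in> A - m" and w: "w \<in> A - m"
  have "u \<otimes> w \<notin> m"
  proof
    assume "u \<otimes> w \<in> m"
    then have "inv u \<otimes> (u \<otimes> w) \<in> m" using A_unit[OF u] m_mult by blast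
    then show False using A_unit[OF u] A_unit[OF w] w by (simp add: m_assoc[symmetric])
  qed
  then show ?thesis using u w A_mult by blast
qed

lemma unit_pow: "u \<in> A - m \<Longrightarrow> u [^] (k::int) \<in> A - m"
proof -
  assume u: "u \<in> A - m"
  have nat: "u [^] (n::nat) \<in> A - m" for n
    using unit_mult[OF _ u] A_one one_m by (induction n) auto
  show ?thesis using nat A_unit by (simp add: int_pow_def2 del: pow_nat)
qed

lemma unif_unit_multiple:
  assumes "unif s" "unif t" "t \<noteq> \<zero>"
  shows "s \<noteq> \<zero>" "\<exists>u\<in>A - m. s = t \<otimes> u"
proof -
  obtain b where b: "b \<in> A" "s = t \<otimes> b" using unifD(4)[OF assms(2) unifD(1)[OF assms(1)]] by blast
  obtain c where c: "c \<in> A" "t = s \<otimes> c" using unifD(4)[OF assms(1) unifD(1)[OF assms(2)]] by blast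
  have car: "t \<in> carrier R" "b \<in> carrier R" "c \<in> carrier R" "s \<in> carrier R"
    using unifD(3)[OF assms(1)] unifD(3)[OF assms(2)] b(1) c(1) A_closed by auto
  show "s \<noteq> \<zero>" using c assms car by auto
  have "t \<otimes> \<one> = t \<otimes> (b \<otimes> c)" using b c car by (metis m_assoc r_one)
  then have "\<one> = b \<otimes> c" using car assms(3) by (subst (asm) m_lcancel) auto
  then have "b \<notin> m" using c m_mult[of c b] one_m car by (metis m_comm)
  then show "\<exists>u\<in>A - m. s = t \<otimes> u" using b by blast
qed

text \<open>Different exponents would present a unit as a multiple of a positive power of
  \<open>t\<close>, which lies in \<open>m\<close>.\<close>

lemma unit_pow_unique:
  assumes t: "unif t" "t \<noteq> \<zero>" and "u \<in> A - m" "w \<in> A - m" "u \<otimes> t [^] (k::int) = w \<otimes> t [^] (l::int)"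
  shows "k = l"
proof -
  have tc: "t \<in> carrier R" using t(1) by (rule unifD(3))
  have False if "k < l" "u \<in> A - m" "w \<in> A - m" "u \<otimes> t [^] k = w \<otimes> t [^] l"
    for k l :: int and u w
  proof -
    have c: "u \<in> carrier R" "w \<in> carrier R" using that A_closed by auto
    have "t [^] l = t [^] (l - k) \<otimes> t [^] k" using int_pow_add[OF tc t(2), of "l - k" k] by simp
    then have "u \<otimes> t [^] k = (w \<otimes> t [^] (l - k)) \<otimes> t [^] k"
      using that c int_pow_nonzero[OF tc t(2)] by (simp add: m_assoc)
    then have u: "u = w \<otimes> t [^] (l - k)"
      using c int_pow_nonzero[OF tc t(2)] by (subst (asm) m_rcancel) auto
    obtain n where n: "l - k = int (Suc n)" using \<open>k < l\<close> by (metis zero_less_imp_eq_int diff_gt_0_iff_gt gr0_implies_Suc)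
    have "w \<otimes> t [^] Suc n \<in> m"
    proof -
      have "t [^] n \<in> A" using unifD(2)[OF t(1)] A_one A_mult by (induction n) auto
      then have "t [^] Suc n \<in> m" using unifD(1)[OF t(1)] m_mult by simp
      then show ?thesis using m_mult that by blast
    qed
    moreover have "u = w \<otimes> t [^] Suc n" using u unfolding n int_pow_int .
    ultimately show False using that by simp
  qed
  then show ?thesis using assms by (metis linorder_neqE)
qed

text \<open>By \<open>krull_intersection\<close> some power of \<open>t\<close> fails to divide
  \<open>a\<close>; let \<open>n\<close> be the least such exponent. It is not 0, and the cofactor
  of exponent \<open>n - 1\<close> is a unit, since otherwise one more \<open>t\<close> would split
  off.\<close>

lemma A_repr:
  assumes t: "unif t" "t \<noteq> \<zero>" and a: "a \<in> A" "a \<noteq> \<zero>"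
  shows "\<exists>n::nat. \<exists>u\<in>A - m. a = u \<otimes> t [^] n"
proof -
  have tc: "t \<in> carrier R" using t(1) by (rule unifD(3))
  let ?P = "\<lambda>n::nat. a \<notin> {t [^] n \<otimes> b | b. b \<in> A}"
  define n where "n = (LEAST n. ?P n)"
  have Pn: "?P n" unfolding n_def by (rule LeastI_ex[OF krull_intersection[OF t a]])
  have "n \<noteq> 0"
  proof
    assume "n = 0"
    then show False using Pn a A_closed by force
  qed
  then obtain k where k: "n = Suc k" by (metis not0_implies_Suc)
  then have "\<not> ?P k" using not_less_Least[of k ?P] by (simp add: n_def)
  then obtain u where u: "u \<in> A" "a = t [^] k \<otimes> u" by blast
  have "u \<notin> m"
  proof
    assume "u \<in> m"
    then obtain b where "b \<in> A" "u = t \<otimes> b" using unifD(4)[OF t(1)] by blast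
    then have "a = t [^] n \<otimes> b" using u k tc A_closed by (simp add: m_assoc)
    then show False using Pn \<open>b \<in> A\<close> by blast
  qed
  moreover have "a = u \<otimes> t [^] k" using u tc A_closed m_comm by auto
  ultimately show ?thesis using u by blast
qed

text \<open>The description in \<open>valu\<close> lets the uniformizer vary. Another one is
  \<open>t\<close> times a unit \<open>x\<close>, and the power of \<open>x\<close> joins the unit
  factor, so the exponent is the same.\<close>

lemma valu_eqI:
  assumes t: "unif t" "t \<noteq> \<zero>" and u: "u \<in> A - m" "a = u \<otimes> t [^] (k::int)"
  shows "valu a = k"
  unfolding valu_def
proof (rule the_equality)
  show "\<exists>t u. unif t \<and> u \<in> A - m \<and> a = u \<otimes> t [^] k" using assms by blast
  have tc: "t \<in> carrier R" using t(1) by (rule unifD(3))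
  fix l :: int assume "\<exists>s w. unif s \<and> w \<in> A - m \<and> a = w \<otimes> s [^] l"
  then obtain s w where sw: "unif s" "w \<in> A - m" "a = w \<otimes> s [^] l" by blast
  obtain x where x: "x \<in> A - m" "s = t \<otimes> x" using unif_unit_multiple[OF sw(1) t] by blast
  have xc: "x \<in> carrier R" "x \<noteq> \<zero>" using A_unit[OF x(1)] by auto
  have "a = (w \<otimes> x [^] l) \<otimes> t [^] l"
    using sw(2) A_closed int_pow_nonzero[OF tc t(2), of l] int_pow_nonzero[OF xc, of l]
    unfolding sw(3) x(2) int_pow_distrib[OF tc t(2) xc] by (simp add: m_ac)
  moreover have "w \<otimes> x [^] l \<in> A - m" using unit_mult[OF sw(2) unit_pow[OF x(1)]] .
  ultimately show "l = k" using unit_pow_unique[OF t] u by metis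
qed

lemma repr:
  assumes t: "unif t" "t \<noteq> \<zero>" and a: "a \<in> carrier R" "a \<noteq> \<zero>"
  shows "\<exists>u\<in>A - m. a = u \<otimes> t [^] valu a"
proof -
  have tc: "t \<in> carrier R" using t(1) by (rule unifD(3))
  obtain b c where bc: "b \<in> A" "c \<in> A" "c \<noteq> \<zero>" "a = b \<otimes> inv c" using A_fractions[OF a(1)] by blast
  have "b \<noteq> \<zero>" using bc a A_closed by auto
  obtain n u where b: "u \<in> A - m" "b = u \<otimes> t [^] (n::nat)" using A_repr[OF t bc(1) \<open>b \<noteq> \<zero>\<close>] by blast
  obtain l w where c: "w \<in> A - m" "c = w \<otimes> t [^] (l::nat)" using A_repr[OF t bc(2,3)] by blast
  note uw = A_unit[OF b(1)] A_unit[OF c(1)]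
  have "a \<otimes> c = b" using bc A_closed by (simp add: m_assoc)
  moreover have "(u \<otimes> inv w) \<otimes> t [^] (int n - int l) \<otimes> c = b"
  proof -
    have "t [^] (int n - int l) \<otimes> t [^] int l = t [^] int n"
      using int_pow_add[OF tc t(2), of "int n - int l" "int l"] by simp
    then have "u \<otimes> (inv w \<otimes> w) \<otimes> (t [^] (int n - int l) \<otimes> t [^] int l) = b"
      using uw by (simp add: b(2) int_pow_int)
    moreover have "(u \<otimes> iw \<otimes> T) \<otimes> (w \<otimes> T') = u \<otimes> (iw \<otimes> w) \<otimes> (T \<otimes> T')"
      if "iw \<in> carrier R" "T \<in> carrier R" "T' \<in> carrier R" for iw T T'
      using that uw by (simp add: m_ac)
    from this[of "inv w" "t [^] (int n - int l)" "t [^] int l"]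
    have "(u \<otimes> inv w \<otimes> t [^] (int n - int l)) \<otimes> (w \<otimes> t [^] int l) =
        u \<otimes> (inv w \<otimes> w) \<otimes> (t [^] (int n - int l) \<otimes> t [^] int l)"
      using uw int_pow_nonzero[OF tc t(2)] by simp
    ultimately show ?thesis unfolding c(2) int_pow_int by simp
  qed
  moreover have "(u \<otimes> inv w) \<otimes> t [^] (int n - int l) \<in> carrier R"
    using uw int_pow_nonzero[OF tc t(2)] by simp
  ultimately have "a = (u \<otimes> inv w) \<otimes> t [^] (int n - int l)"
    using m_rcancel[of c a] bc A_closed a by metis
  moreover have "u \<otimes> inv w \<in> A - m" using unit_mult b(1) uw by blast
  ultimately show ?thesis using valu_eqI[OF t] by metis
qed

text \<open>Translates orders into membership in the local ring and its maximal ideal, the form in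
  which functions are pulled back.\<close>

lemma valu_nonneg_iff:
  assumes "a \<in> carrier R" "a \<noteq> \<zero>"
  shows "0 \<le> valu a \<longleftrightarrow> a \<in> A" "0 < valu a \<longleftrightarrow> a \<in> m"
proof -
  obtain t where t: "unif t" "t \<noteq> \<zero>" using ex_unif by blast
  have tA: "t \<in> A" and tm: "t \<in> m" using unifD[OF t(1)] by auto
  have powA: "t [^] (n::nat) \<in> A" for n using tA A_one A_mult by (induction n) auto
  have powm: "t [^] Suc n \<in> m" for n using powA[of n] tm m_mult by simp
  obtain u where u: "u \<in> A - m" "a = u \<otimes> t [^] valu a" using repr[OF t assms] by blast
  have nonneg: "0 \<le> valu a" if aA: "a \<in> A"
  proof -
    obtain n w where "w \<in> A - m" "a = w \<otimes> t [^] (n::nat)" using A_repr[OF t aA assms(2)] by blast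
    then show ?thesis using valu_eqI[OF t, of w a "int n"] by (simp add: int_pow_int)
  qed
  moreover have "a \<in> A" if v: "0 \<le> valu a"
  proof -
    obtain n where "valu a = int n" using v nonneg_int_cases by blast
    then show ?thesis using u powA A_mult by (auto simp: int_pow_int)
  qed
  ultimately show "0 \<le> valu a \<longleftrightarrow> a \<in> A" by blast
  have "a \<in> m" if v: "0 < valu a"
  proof -
    obtain n where n: "valu a = int (Suc n)" using v by (metis gr0_implies_Suc zero_less_imp_eq_int)
    have "a = u \<otimes> t [^] Suc n" using u(2) unfolding n int_pow_int .
    then show ?thesis using m_mult[OF _ powm[of n], of u] u by blast
  qed
  moreover have "0 < valu a" if am: "a \<in> m"
  proof -
    have "0 \<le> valu a" using am m_closed' nonneg by blast
    moreover have "valu a \<noteq> 0"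
    proof
      assume "valu a = 0"
      then have "a = u" using u A_closed by auto
      then show False using am u by simp
    qed
    ultimately show ?thesis by simp
  qed
  ultimately show "0 < valu a \<longleftrightarrow> a \<in> m" by blast
qed

lemma discrete_valuation_valu: "discrete_valuation R \<iota> valu"
proof
  obtain t where t: "unif t" "t \<noteq> \<zero>" using ex_unif by blast
  have tc: "t \<in> carrier R" using t(1) by (rule unifD(3))
  show mult: "valu (a \<otimes> b) = valu a + valu b"
    if ab: "a \<in> carrier R" "a \<noteq> \<zero>" "b \<in> carrier R" "b \<noteq> \<zero>" for a b
  proof -
    obtain u where u: "u \<in> A - m" "a = u \<otimes> t [^] valu a" using repr[OF t] ab by blast
    obtain w where w: "w \<in> A - m" "b = w \<otimes> t [^] valu b" using repr[OF t] ab by blast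
    have "a \<otimes> b = (u \<otimes> t [^] valu a) \<otimes> (w \<otimes> t [^] valu b)" using u w by simp
    also have "\<dots> = (u \<otimes> w) \<otimes> t [^] (valu a + valu b)"
      using u(1) w(1) A_closed int_pow_nonzero[OF tc t(2)] by (simp add: int_pow_add[OF tc t(2)] m_ac)
    finally show ?thesis using valu_eqI[OF t unit_mult[OF u(1) w(1)]] by blast
  qed
  \<comment> \<open>Factor out the summand of smaller order: \<open>a \<oplus> b = a \<otimes>
    (\<one> \<oplus> inv a \<otimes> b)\<close>, where the second factor lies in
    \<open>A\<close>.\<close>
  have add: "valu a \<le> valu (a \<oplus> b)"
    if ab: "a \<in> carrier R" "a \<noteq> \<zero>" "b \<in> carrier R" "b \<noteq> \<zero>" "a \<oplus> b \<noteq> \<zero>" "valu a \<le> valu b" for a b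
  proof -
    have ia: "inv a \<in> carrier R" "inv a \<noteq> \<zero>" using ab by auto
    have one: "valu \<one> = 0" using mult[of \<one> \<one>] by simp
    have "valu (inv a) = - valu a" using mult[OF ab(1,2) ia] ab one by simp
    then have "0 \<le> valu (inv a \<otimes> b)" using mult[OF ia ab(3,4)] ab by simp
    then have "inv a \<otimes> b \<in> A" using valu_nonneg_iff(1)[of "inv a \<otimes> b"] ab ia by (simp add: integral_iff)
    then have 1: "\<one> \<oplus> inv a \<otimes> b \<in> A" using A_add A_one by blast
    have eq: "a \<oplus> b = a \<otimes> (\<one> \<oplus> inv a \<otimes> b)"
      using ab ia by (simp add: r_distr m_assoc[symmetric])
    then have nz: "\<one> \<oplus> inv a \<otimes> b \<noteq> \<zero>" using ab by auto
    then have "0 \<le> valu (\<one> \<oplus> inv a \<otimes> b)" using valu_nonneg_iff(1)[OF A_closed[OF 1]] 1 by simp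
    then show ?thesis using mult[OF ab(1,2) A_closed[OF 1] nz] eq by simp
  qed
  show "min (valu a) (valu b) \<le> valu (a \<oplus> b)"
    if ab: "a \<in> carrier R" "a \<noteq> \<zero>" "b \<in> carrier R" "b \<noteq> \<zero>" "a \<oplus> b \<noteq> \<zero>" for a b
    using add[of a b] add[of b a] ab by (cases "valu a \<le> valu b") (auto simp: a_comm)
  show "valu (\<iota> c) = 0" if c: "c \<noteq> 0" for c
  proof -
    have "\<iota> c \<notin> m" using const_m c by blast
    then show ?thesis using A_const valu_nonneg_iff[of "\<iota> c"] c by force
  qed
  have "valu t = 1"
    using valu_eqI[OF t, of \<one> t 1] A_one one_m tc by (simp add: int_pow_def2 del: pow_nat)
  then show "\<exists>t\<in>carrier R - {\<zero>}. valu t = 1" using t tc by blast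
  show "\<exists>c. a \<ominus> \<iota> c = \<zero> \<or> 0 < valu (a \<ominus> \<iota> c)"
    if a: "a \<in> carrier R" "a \<noteq> \<zero>" "0 \<le> valu a" for a
  proof -
    obtain c where c: "a \<ominus> \<iota> c \<in> m" using A_residue valu_nonneg_iff(1)[OF a(1,2)] a(3) by blast
    then show ?thesis using valu_nonneg_iff(2)[of "a \<ominus> \<iota> c"] a by (intro exI[of _ c]) auto
  qed
qed

end

section \<open>Regular functions on irreducible varieties\<close>

lemma proj_space_nonempty:
  assumes "P \<in> proj_space" shows "\<exists>x. x \<in> P"
proof -
  obtain z where z: "z \<noteq> 0" "P = proportional `` {z}"
    using assms by (auto simp: proj_space_def quotient_def)
  have "z = 1 *s z" by (simp add: vec_eq_iff)
  then have "z \<in> P" using z unfolding proportional_def by blast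
  then show ?thesis by blast
qed

lemma proj_space_scale:
  fixes P :: "('k::field, 'n::finite) point"
  assumes "P \<in> proj_space" "x \<in> P" "y \<in> P"
  shows "\<exists>c. c \<noteq> 0 \<and> y = c *s x" "x \<noteq> 0"
proof -
  obtain z where z: "z \<noteq> 0" "P = proportional `` {z}"
    using assms by (auto simp: proj_space_def quotient_def)
  obtain a b where a: "x = a *s z" "x \<noteq> 0" and b: "y = b *s z" "y \<noteq> 0"
    using z assms by (auto simp: proportional_def)
  have "a \<noteq> 0" "b \<noteq> 0" using a b by auto
  moreover have "y = (b / a) *s x" using a b \<open>a \<noteq> 0\<close> by (simp add: vec_eq_iff)
  ultimately show "\<exists>c. c \<noteq> 0 \<and> y = c *s x" by (intro exI[of _ "b / a"]) simp
  show "x \<noteq> 0" using a by simp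
qed

lemma homogeneous_add: "homogeneous d p \<Longrightarrow> homogeneous d q \<Longrightarrow> homogeneous d (p + q)"
  using keys_add[of p q] by (auto simp: homogeneous_def)

lemma homogeneous_single [simp]: "homogeneous 0 (single 0 c)"
  by (auto simp: homogeneous_def)

lemma mpoly_eval_single_0 [simp]: "mpoly_eval (single 0 c) x = c"
  by (simp add: mpoly_eval_single monom_eval_def)

text \<open>Taken at an arbitrary representative of the point: only quotients of values of forms of equal
  degree are meaningful.\<close>

definition form_value :: "('k::field, 'n::finite) mpoly \<Rightarrow> ('k, 'n) point \<Rightarrow> 'k" where
  "form_value p P = mpoly_eval p (SOME x. x \<in> P)"

lemma form_value_eq_0_iff:
  assumes "homogeneous d p" "P \<in> proj_space" "x \<in> P"
  shows "form_value p P = 0 \<longleftrightarrow> mpoly_eval p x = 0"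
  unfolding form_value_def
  using mpoly_eval_eq_0_cong[OF assms(1,2)] someI_ex[OF proj_space_nonempty[OF assms(2)]] assms(3)
  by blast

lemma form_value_quotient:
  assumes "homogeneous d p" "homogeneous d q" "P \<in> proj_space" "x \<in> P"
  shows "form_value p P / form_value q P = mpoly_eval p x / mpoly_eval q x"
proof -
  obtain c where c: "c \<noteq> 0" "(SOME x. x \<in> P) = c *s x"
    using proj_space_scale[OF assms(3,4) someI_ex[OF proj_space_nonempty[OF assms(3)]]] by blast
  then show ?thesis
    using assms(1,2) by (simp add: form_value_def c(2) mpoly_eval_scale)
qed

lemma form_value_simps [simp]:
  "form_value (p + q) P = form_value p P + form_value q P"
  "form_value (p * q) P = form_value p P * form_value q P"
  "form_value (single 0 c) P = c"
  by (simp_all add: form_value_def mpoly_eval_add mpoly_eval_mult)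

lemma form_value_1 [simp]: "form_value 1 P = 1"
  using form_value_simps(3)[of 1 P] by simp

lemma form_value_power [simp]: "form_value (p ^ m) P = form_value p P ^ m"
  by (induction m) simp_all

lemma homogeneous_power: "homogeneous d p \<Longrightarrow> homogeneous (m * d) (p ^ m)"
proof (induction m)
  case 0
  then show ?case using homogeneous_single[of 1] by simp
qed (simp add: homogeneous_mult)

text \<open>\<open>dense\<close> is irreducibility in the form that rational functions use.
  Dimension is left out, so that the projective line becomes an instance through
  \<open>variety_dominant_image\<close>.\<close>

locale variety =
  fixes X :: "('k::field, 'n::finite) point set"
  assumes X_proj: "X \<subseteq> proj_space" and X_nonempty: "X \<noteq> {}"
    and dense: "\<lbrakk>open_in X U; open_in X V; U \<noteq> {}; V \<noteq> {}\<rbrakk> \<Longrightarrow> U \<inter> V \<noteq> {}"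
begin

lemma open_subset: "open_in X U \<Longrightarrow> U \<subseteq> X"
  using openin_subset[of "subtopology zariski X" U] by simp

lemma open_X [simp]: "open_in X X"
  using openin_topspace[of "subtopology zariski X"] X_proj
  by (simp add: topspace_subtopology topspace_zariski inf_absorb2)

definition nz :: "('k, 'n) mpoly \<Rightarrow> ('k, 'n) point set" where
  "nz h = {P \<in> X. form_value h P \<noteq> 0}"

lemma nz_iff: "homogeneous d h \<Longrightarrow> P \<in> nz h \<longleftrightarrow> P \<in> X \<and> (\<forall>x\<in>P. mpoly_eval h x \<noteq> 0)"
  using form_value_eq_0_iff[of d h P] X_proj proj_space_nonempty[of P] by (auto simp: nz_def)

lemma open_nz: assumes "homogeneous d h" shows "open_in X (nz h)"
proof -
  have "openin zariski (proj_space - zero_locus {h})"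
    unfolding openin_zariski using assms by (intro exI[of _ "{h}"]) auto
  moreover have "nz h = X \<inter> (proj_space - zero_locus {h})"
  proof -
    have "P \<in> nz h \<longleftrightarrow> P \<notin> zero_locus {h}" if P: "P \<in> X" for P
    proof -
      have PP: "P \<in> proj_space" using P X_proj by auto
      obtain x where x: "x \<in> P" using proj_space_nonempty[OF PP] by blast
      have "(\<forall>y\<in>P. mpoly_eval h y = 0) \<longleftrightarrow> mpoly_eval h x = 0"
        using mpoly_eval_eq_0_cong[OF assms PP] x by blast
      then show ?thesis using form_value_eq_0_iff[OF assms PP x] P PP
        by (simp add: nz_def zero_locus_def)
    qed
    then show ?thesis using X_proj by (auto simp: nz_def)
  qed
  ultimately show ?thesis by (auto simp: openin_subtopology_alt image_iff)
qed

lemma nz_mult [simp]: "nz (g * h) = nz g \<inter> nz h"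
  by (auto simp: nz_def)

text \<open>Replaces the quantifier over all representatives of a point by the single representative
  behind \<open>form_value\<close>; quotients of forms of equal degree do not see the
  difference.\<close>

lemma regular_on_iff:
  assumes "U \<subseteq> X"
  shows "regular_on X U f \<longleftrightarrow> (\<forall>P\<in>U. \<exists>V d g h. open_in X V \<and> P \<in> V \<and> V \<subseteq> U \<and>
    homogeneous d g \<and> homogeneous d h \<and> V \<subseteq> nz h \<and>
    (\<forall>Q\<in>V. f Q = form_value g Q / form_value h Q))"
proof -
  have "(\<forall>Q\<in>V. \<forall>x\<in>Q. mpoly_eval h x \<noteq> 0 \<and> f Q = mpoly_eval g x / mpoly_eval h x) \<longleftrightarrow>
      V \<subseteq> nz h \<and> (\<forall>Q\<in>V. f Q = form_value g Q / form_value h Q)"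
    if gh: "homogeneous d g" "homogeneous d h" and V: "V \<subseteq> U" for V d g h
  proof -
    have "(\<forall>x\<in>Q. mpoly_eval h x \<noteq> 0 \<and> f Q = mpoly_eval g x / mpoly_eval h x) \<longleftrightarrow>
        Q \<in> nz h \<and> f Q = form_value g Q / form_value h Q" if Q: "Q \<in> V" for Q
    proof -
      have QX: "Q \<in> X" "Q \<in> proj_space" using Q V assms X_proj by auto
      then show ?thesis
        using nz_iff[OF gh(2), of Q] form_value_quotient[OF gh QX(2)] proj_space_nonempty[OF QX(2)]
        by metis
    qed
    then show ?thesis by blast
  qed
  note eq = this
  show ?thesis
    unfolding regular_on_def
  proof (intro ball_cong refl iffI)
    fix P assume "P \<in> U"
    assume "\<exists>V. open_in X V \<and> P \<in> V \<and> V \<subseteq> U \<and> (\<exists>d g h. homogeneous d g \<and> homogeneous d h \<and>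
        (\<forall>Q\<in>V. \<forall>x\<in>Q. mpoly_eval h x \<noteq> 0 \<and> f Q = mpoly_eval g x / mpoly_eval h x))"
    then obtain V d g h where V: "open_in X V" "P \<in> V" "V \<subseteq> U" "homogeneous d g" "homogeneous d h"
        "\<forall>Q\<in>V. \<forall>x\<in>Q. mpoly_eval h x \<noteq> 0 \<and> f Q = mpoly_eval g x / mpoly_eval h x" by blast
    then show "\<exists>V d g h. open_in X V \<and> P \<in> V \<and> V \<subseteq> U \<and> homogeneous d g \<and> homogeneous d h \<and>
        V \<subseteq> nz h \<and> (\<forall>Q\<in>V. f Q = form_value g Q / form_value h Q)"
      using eq[OF V(4,5,3)] by blast
  next
    fix P assume "P \<in> U"
    assume "\<exists>V d g h. open_in X V \<and> P \<in> V \<and> V \<subseteq> U \<and> homogeneous d g \<and> homogeneous d h \<and>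
        V \<subseteq> nz h \<and> (\<forall>Q\<in>V. f Q = form_value g Q / form_value h Q)"
    then obtain V d g h where V: "open_in X V" "P \<in> V" "V \<subseteq> U" "homogeneous d g" "homogeneous d h"
        "V \<subseteq> nz h" "\<forall>Q\<in>V. f Q = form_value g Q / form_value h Q" by blast
    then show "\<exists>V. open_in X V \<and> P \<in> V \<and> V \<subseteq> U \<and> (\<exists>d g h. homogeneous d g \<and> homogeneous d h \<and>
        (\<forall>Q\<in>V. \<forall>x\<in>Q. mpoly_eval h x \<noteq> 0 \<and> f Q = mpoly_eval g x / mpoly_eval h x))"
      using eq[OF V(4,5,3)] by blast
  qed
qed

lemma regular_onD:
  assumes "regular_on X U f" "U \<subseteq> X" "P \<in> U"
  shows "\<exists>V d g h. open_in X V \<and> P \<in> V \<and> V \<subseteq> U \<and> homogeneous d g \<and> homogeneous d h \<and>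
    V \<subseteq> nz h \<and> (\<forall>Q\<in>V. f Q = form_value g Q / form_value h Q)"
  using assms(1,3) unfolding regular_on_iff[OF assms(2)] by blast

lemma regular_on_quotient:
  assumes "homogeneous d g" "homogeneous d h" "open_in X U" "U \<subseteq> nz h"
    and "\<And>P. P \<in> U \<Longrightarrow> f P = form_value g P / form_value h P"
  shows "regular_on X U f"
  unfolding regular_on_iff[OF open_subset[OF assms(3)]] using assms by blast

lemma regular_on_const: "open_in X U \<Longrightarrow> regular_on X U (\<lambda>_. c)"
proof (rule regular_on_quotient)
  show "homogeneous 0 (single 0 c)" "homogeneous 0 (single 0 1)"
    by (rule homogeneous_single)+
qed (use open_subset in \<open>auto simp: nz_def\<close>)

lemma regular_on_subset:
  assumes "regular_on X U f" "open_in X V" "V \<subseteq> U" "U \<subseteq> X"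
  shows "regular_on X V f"
proof -
  have VX: "V \<subseteq> X" using assms by auto
  show ?thesis unfolding regular_on_iff[OF VX]
  proof
    fix P assume P: "P \<in> V"
    then have PU: "P \<in> U" using assms by auto
    obtain W d g h where W: "open_in X W" "P \<in> W" "W \<subseteq> U" "homogeneous d g"
        "homogeneous d h" "W \<subseteq> nz h" "\<And>Q. Q \<in> W \<Longrightarrow> f Q = form_value g Q / form_value h Q"
      using regular_onD[OF assms(1,4) PU] by blast
    then show "\<exists>V' d g h. open_in X V' \<and> P \<in> V' \<and> V' \<subseteq> V \<and> homogeneous d g \<and> homogeneous d h \<and>
        V' \<subseteq> nz h \<and> (\<forall>Q\<in>V'. f Q = form_value g Q / form_value h Q)"
      using P assms(2) by (intro exI[of _ "W \<inter> V"] exI[of _ d] exI[of _ g] exI[of _ h]) auto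
  qed
qed

lemma regular_on_Int:
  assumes "regular_on X U f" "open_in X U" "open_in X V"
  shows "regular_on X (U \<inter> V) f" "regular_on X (V \<inter> U) f"
  using assms open_subset[of U] by (auto intro!: regular_on_subset[of U f])

text \<open>The common core of sums and products: only the numerator \<open>k\<close> over the
  denominator \<open>h * h'\<close> depends on the operation.\<close>

lemma regular_on_combine:
  assumes "regular_on X U f" "regular_on X U f'" "open_in X U"
    and "\<And>d g h d' g' h'. \<lbrakk>homogeneous d g; homogeneous d h; homogeneous d' g'; homogeneous d' h'\<rbrakk> \<Longrightarrow>
      \<exists>k. homogeneous (d + d') k \<and> (\<forall>Q\<in>nz h \<inter> nz h'. f Q = form_value g Q / form_value h Q \<longrightarrow>
        f' Q = form_value g' Q / form_value h' Q \<longrightarrow> F Q = form_value k Q / form_value (h * h') Q)"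
  shows "regular_on X U F"
proof -
  have UX: "U \<subseteq> X" using assms(3) by (rule open_subset)
  show ?thesis unfolding regular_on_iff[OF UX]
  proof
    fix P assume P: "P \<in> U"
    obtain W d g h where W: "open_in X W" "P \<in> W" "W \<subseteq> U" "homogeneous d g"
        "homogeneous d h" "W \<subseteq> nz h" "\<And>Q. Q \<in> W \<Longrightarrow> f Q = form_value g Q / form_value h Q"
      using regular_onD[OF assms(1) UX P] by blast
    obtain W' d' g' h' where W': "open_in X W'" "P \<in> W'" "W' \<subseteq> U" "homogeneous d' g'"
        "homogeneous d' h'" "W' \<subseteq> nz h'" "\<And>Q. Q \<in> W' \<Longrightarrow> f' Q = form_value g' Q / form_value h' Q"
      using regular_onD[OF assms(2) UX P] by blast
    obtain k where k: "homogeneous (d + d') k"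
        "\<And>Q. Q \<in> nz h \<inter> nz h' \<Longrightarrow> f Q = form_value g Q / form_value h Q \<Longrightarrow>
          f' Q = form_value g' Q / form_value h' Q \<Longrightarrow> F Q = form_value k Q / form_value (h * h') Q"
      using assms(4)[OF W(4,5) W'(4,5)] by blast
    have "\<forall>Q\<in>W \<inter> W'. F Q = form_value k Q / form_value (h * h') Q"
      using W(6,7) W'(6,7) by (intro ballI k(2)) auto
    then show "\<exists>V' d g h. open_in X V' \<and> P \<in> V' \<and> V' \<subseteq> U \<and> homogeneous d g \<and> homogeneous d h \<and>
        V' \<subseteq> nz h \<and> (\<forall>Q\<in>V'. F Q = form_value g Q / form_value h Q)"
      using W W' k(1) homogeneous_mult[OF W(5) W'(5)]
      by (intro exI[of _ "W \<inter> W'"] exI[of _ "d + d'"] exI[of _ k] exI[of _ "h * h'"]) auto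
  qed
qed

lemma regular_on_mult:
  assumes "regular_on X U f" "regular_on X U f'" "open_in X U"
  shows "regular_on X U (\<lambda>P. f P * f' P)"
proof (rule regular_on_combine[OF assms])
  fix d d' :: nat and g h g' h' :: "('k, 'n) mpoly"
  assume "homogeneous d g" "homogeneous d h" "homogeneous d' g'" "homogeneous d' h'"
  then show "\<exists>k. homogeneous (d + d') k \<and> (\<forall>Q\<in>nz h \<inter> nz h'. f Q = form_value g Q / form_value h Q \<longrightarrow>
      f' Q = form_value g' Q / form_value h' Q \<longrightarrow> f Q * f' Q = form_value k Q / form_value (h * h') Q)"
    by (intro exI[of _ "g * g'"]) (auto simp: homogeneous_mult)
qed

lemma regular_on_add:
  assumes "regular_on X U f" "regular_on X U f'" "open_in X U"
  shows "regular_on X U (\<lambda>P. f P + f' P)"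
proof (rule regular_on_combine[OF assms])
  fix d d' :: nat and g h g' h' :: "('k, 'n) mpoly"
  assume *: "homogeneous d g" "homogeneous d h" "homogeneous d' g'" "homogeneous d' h'"
  have "homogeneous (d + d') (g * h' + g' * h)"
    using homogeneous_mult[OF *(1,4)] homogeneous_mult[OF *(3,2)]
    by (simp add: homogeneous_add add.commute)
  then show "\<exists>k. homogeneous (d + d') k \<and> (\<forall>Q\<in>nz h \<inter> nz h'. f Q = form_value g Q / form_value h Q \<longrightarrow>
      f' Q = form_value g' Q / form_value h' Q \<longrightarrow> f Q + f' Q = form_value k Q / form_value (h * h') Q)"
    by (intro exI[of _ "g * h' + g' * h"]) (auto simp: nz_def field_simps)
qed

lemma open_nonvanishing:
  assumes "regular_on X U f" "open_in X U"
  shows "open_in X {P \<in> U. f P \<noteq> 0}" "regular_on X {P \<in> U. f P \<noteq> 0} (\<lambda>P. inverse (f P))"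
proof -
  have UX: "U \<subseteq> X" using assms(2) by (rule open_subset)
  have local: "\<exists>V d g h. open_in X V \<and> P \<in> V \<and> V \<subseteq> {P \<in> U. f P \<noteq> 0} \<and> homogeneous d g \<and>
      homogeneous d h \<and> V \<subseteq> nz h \<and> (\<forall>Q\<in>V. inverse (f Q) = form_value g Q / form_value h Q)"
    if "P \<in> {P \<in> U. f P \<noteq> 0}" for P
  proof -
    have P: "P \<in> U" "f P \<noteq> 0" using that by auto
    obtain W d g h where W: "open_in X W" "P \<in> W" "W \<subseteq> U" "homogeneous d g"
        "homogeneous d h" "W \<subseteq> nz h" "\<And>Q. Q \<in> W \<Longrightarrow> f Q = form_value g Q / form_value h Q"
      using regular_onD[OF assms(1) UX P(1)] by blast
    have "P \<in> nz g" using W P UX by (auto simp: nz_def)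
    moreover have "W \<inter> nz g \<subseteq> {P \<in> U. f P \<noteq> 0}" using W by (auto simp: nz_def)
    ultimately show ?thesis
      using W open_nz[OF W(4)]
      by (intro exI[of _ "W \<inter> nz g"] exI[of _ d] exI[of _ h] exI[of _ g]) auto
  qed
  then show 1: "open_in X {P \<in> U. f P \<noteq> 0}"
    by (subst openin_subopen) meson
  show "regular_on X {P \<in> U. f P \<noteq> 0} (\<lambda>P. inverse (f P))"
    unfolding regular_on_iff[OF open_subset[OF 1]] using local by blast
qed

text \<open>The set where the difference is nonzero is open, so if nonempty it would meet
  \<open>W\<close> by irreducibility.\<close>

lemma regular_identity:
  assumes "regular_on X U f" "regular_on X U' f'" "open_in X U" "open_in X U'"
    and "open_in X W" "W \<noteq> {}" "\<And>P. P \<in> W \<Longrightarrow> P \<in> U \<and> P \<in> U' \<and> f P = f' P"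
    and "P \<in> U" "P \<in> U'"
  shows "f P = f' P"
proof (rule ccontr)
  assume neq: "f P \<noteq> f' P"
  have o: "open_in X (U \<inter> U')" using assms by blast
  let ?g = "\<lambda>P. f P + (- 1) * f' P"
  have "regular_on X (U \<inter> U') ?g"
    using assms(1-4) o
    by (intro regular_on_add regular_on_mult regular_on_const) (simp_all add: regular_on_Int)
  from open_nonvanishing(1)[OF this o]
  have "open_in X {P \<in> U \<inter> U'. ?g P \<noteq> 0}" .
  moreover have "P \<in> {P \<in> U \<inter> U'. ?g P \<noteq> 0}" using neq assms by simp
  ultimately have "{P \<in> U \<inter> U'. ?g P \<noteq> 0} \<inter> W \<noteq> {}" using assms(5,6) by (intro dense) auto
  then show False using assms(7) by auto
qed

section \<open>The function field of an irreducible variety\<close>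

abbreviation FF where "FF \<equiv> function_field X"

abbreviation reps where "reps \<equiv> rational_reps X"

abbreviation cls where "cls \<equiv> rational_class X"

lemma reps_iff: "(U, f) \<in> reps \<longleftrightarrow> open_in X U \<and> U \<noteq> {} \<and> regular_on X U f"
  by (simp add: rational_reps_def)

lemma equiv_rational_rel: "equiv reps (rational_rel X)"
proof (rule equivI)
  show "rational_rel X \<subseteq> reps \<times> reps" by (auto simp: rational_rel_def)
  show "refl_on reps (rational_rel X)" by (auto simp: refl_on_def rational_rel_def)
  show "sym (rational_rel X)" by (auto simp: sym_def rational_rel_def)
  show "trans (rational_rel X)"
  proof (rule transI)
    fix a b c assume ab: "(a, b) \<in> rational_rel X" and bc: "(b, c) \<in> rational_rel X"
    obtain U f V g W h where abc: "a = (U, f)" "b = (V, g)" "c = (W, h)" by (metis surj_pair)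
    have UVW: "(U, f) \<in> reps" "(V, g) \<in> reps" "(W, h) \<in> reps"
      and eq: "\<forall>P\<in>U \<inter> V. f P = g P" "\<forall>P\<in>V \<inter> W. g P = h P"
      using ab bc by (auto simp: abc rational_rel_def)
    \<comment> \<open>Irreducibility makes the relation transitive: \<open>f\<close> and
      \<open>h\<close> agree on the triple intersection, and \<open>regular_identity\<close> extends
      this to \<open>U \<inter> W\<close>.\<close>
    have "open_in X (U \<inter> V \<inter> W)" "U \<inter> V \<inter> W \<noteq> {}"
      using UVW dense[of U V] dense[of "U \<inter> V" W] by (auto simp: reps_iff)
    then have "f P = h P" if "P \<in> U \<inter> W" for P
      using UVW eq that
      by (intro regular_identity[of U f W h "U \<inter> V \<inter> W"]) (auto simp: reps_iff)
    then show "(a, c) \<in> rational_rel X" using UVW by (auto simp: abc rational_rel_def)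
  qed
qed

lemma cls_eq_iff:
  assumes "(U, f) \<in> reps" "(V, g) \<in> reps"
  shows "cls U f = cls V g \<longleftrightarrow> (\<forall>P\<in>U \<inter> V. f P = g P)"
  unfolding rational_class_def eq_equiv_class_iff[OF equiv_rational_rel assms]
  using assms by (simp add: rational_rel_def)

lemma cls_mem_iff:
  assumes "(U, f) \<in> reps"
  shows "(V, g) \<in> cls U f \<longleftrightarrow> (V, g) \<in> reps \<and> cls V g = cls U f"
proof -
  have "(V, g) \<in> cls U f \<longleftrightarrow> (V, g) \<in> reps \<and> (\<forall>P\<in>U \<inter> V. f P = g P)"
    using assms by (auto simp: rational_class_def rational_rel_def)
  moreover have "cls V g = cls U f \<longleftrightarrow> (\<forall>P\<in>U \<inter> V. f P = g P)" if "(V, g) \<in> reps"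
    using cls_eq_iff[OF that assms] by auto
  ultimately show ?thesis by blast
qed

lemma carrier_eq: "carrier FF = {cls U f | U f. (U, f) \<in> reps}"
  by (auto simp: function_field_def quotient_def rational_class_def)

lemma carrierE:
  assumes "a \<in> carrier FF" obtains U f where "(U, f) \<in> reps" "a = cls U f"
  using assms by (auto simp: carrier_eq)

lemma cls_carrier [simp, intro]: "(U, f) \<in> reps \<Longrightarrow> cls U f \<in> carrier FF"
  by (auto simp: carrier_eq)

lemma cls_cong_agree:
  assumes "(U, f) \<in> reps" "(V, g) \<in> reps" "open_in X W" "W \<noteq> {}"
    and "\<And>P. P \<in> W \<Longrightarrow> P \<in> U \<and> P \<in> V \<and> f P = g P"
  shows "cls U f = cls V g"
  unfolding cls_eq_iff[OF assms(1,2)]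
  using assms by (intro ballI regular_identity[of U f V g W]) (auto simp: reps_iff)

lemma reps_mult:
  assumes "(U, f) \<in> reps" "(V, g) \<in> reps"
  shows "(U \<inter> V, \<lambda>P. f P * g P) \<in> reps"
  using assms dense[of U V] by (simp add: reps_iff regular_on_mult regular_on_Int openin_Int)

lemma reps_add:
  assumes "(U, f) \<in> reps" "(V, g) \<in> reps"
  shows "(U \<inter> V, \<lambda>P. f P + g P) \<in> reps"
  using assms dense[of U V] by (simp add: reps_iff regular_on_add regular_on_Int openin_Int)

lemma reps_const [simp, intro]: "(X, \<lambda>_. c) \<in> reps"
  using X_nonempty by (simp add: reps_iff regular_on_const)

text \<open>The field operations are unions over all representatives; when every choice gives the
  same class, the union is that class.\<close>

lemma UN_const2:
  assumes "a \<noteq> {}" "b \<noteq> {}" "\<And>U f V g. (U, f) \<in> a \<Longrightarrow> (V, g) \<in> b \<Longrightarrow> F U f V g = C"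
  shows "(\<Union>(U, f)\<in>a. \<Union>(V, g)\<in>b. F U f V g) = C"
proof -
  have "(\<Union>(U, f)\<in>a. \<Union>(V, g)\<in>b. F U f V g) = (\<Union>p\<in>a. \<Union>q\<in>b. C)"
    using assms(3) by (intro SUP_cong refl) auto
  then show ?thesis using assms(1,2) by auto
qed

lemma cls_mult:
  assumes f: "(U, f) \<in> reps" and g: "(V, g) \<in> reps"
  shows "cls U f \<otimes>\<^bsub>FF\<^esub> cls V g = cls (U \<inter> V) (\<lambda>P. f P * g P)"
proof -
  have "(\<Union>(U, f)\<in>cls U f. \<Union>(V, g)\<in>cls V g. cls (U \<inter> V) (\<lambda>P. f P * g P)) =
      cls (U \<inter> V) (\<lambda>P. f P * g P)"
  proof (rule UN_const2)
    show "cls U f \<noteq> {}" "cls V g \<noteq> {}" using f g cls_mem_iff by blast+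
    fix U' f' V' g' assume "(U', f') \<in> cls U f" "(V', g') \<in> cls V g"
    then have *: "(U', f') \<in> reps" "(V', g') \<in> reps" "cls U' f' = cls U f" "cls V' g' = cls V g"
      using f g cls_mem_iff by blast+
    then show "cls (U' \<inter> V') (\<lambda>P. f' P * g' P) = cls (U \<inter> V) (\<lambda>P. f P * g P)"
      using f g by (subst cls_eq_iff) (auto simp: cls_eq_iff intro: reps_mult)
  qed
  then show ?thesis by (simp add: function_field_def)
qed

lemma cls_add:
  assumes f: "(U, f) \<in> reps" and g: "(V, g) \<in> reps"
  shows "cls U f \<oplus>\<^bsub>FF\<^esub> cls V g = cls (U \<inter> V) (\<lambda>P. f P + g P)"
proof -
  have "(\<Union>(U, f)\<in>cls U f. \<Union>(V, g)\<in>cls V g. cls (U \<inter> V) (\<lambda>P. f P + g P)) =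
      cls (U \<inter> V) (\<lambda>P. f P + g P)"
  proof (rule UN_const2)
    show "cls U f \<noteq> {}" "cls V g \<noteq> {}" using f g cls_mem_iff by blast+
    fix U' f' V' g' assume "(U', f') \<in> cls U f" "(V', g') \<in> cls V g"
    then have *: "(U', f') \<in> reps" "(V', g') \<in> reps" "cls U' f' = cls U f" "cls V' g' = cls V g"
      using f g cls_mem_iff by blast+
    then show "cls (U' \<inter> V') (\<lambda>P. f' P + g' P) = cls (U \<inter> V) (\<lambda>P. f P + g P)"
      using f g by (subst cls_eq_iff) (auto simp: cls_eq_iff intro: reps_add)
  qed
  then show ?thesis by (simp add: function_field_def)
qed

definition \<iota> :: "'k \<Rightarrow> ('k, 'n) rational" where
  "\<iota> c = cls X (\<lambda>_. c)"

lemma one_zero: "\<one>\<^bsub>FF\<^esub> = cls X (\<lambda>_. 1)" "\<zero>\<^bsub>FF\<^esub> = cls X (\<lambda>_. 0)"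
  by (simp_all add: function_field_def)

lemma constants_eq: "constants X = range \<iota>"
  by (auto simp: constants_def \<iota>_def)

lemma cls_eq_zero_iff: "(U, f) \<in> reps \<Longrightarrow> cls U f = \<zero>\<^bsub>FF\<^esub> \<longleftrightarrow> (\<forall>P\<in>U. f P = 0)"
  unfolding one_zero using open_subset
  by (subst cls_eq_iff) (auto simp: reps_iff regular_on_const X_nonempty)

lemma cls_inverse:
  assumes f: "(U, f) \<in> reps" and nz: "cls U f \<noteq> \<zero>\<^bsub>FF\<^esub>"
  shows "({P \<in> U. f P \<noteq> 0}, \<lambda>P. inverse (f P)) \<in> reps"
    "cls U f \<otimes>\<^bsub>FF\<^esub> cls {P \<in> U. f P \<noteq> 0} (\<lambda>P. inverse (f P)) = \<one>\<^bsub>FF\<^esub>"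
proof -
  show *: "({P \<in> U. f P \<noteq> 0}, \<lambda>P. inverse (f P)) \<in> reps"
    using f nz open_nonvanishing[of U f] by (auto simp: cls_eq_zero_iff reps_iff)
  show "cls U f \<otimes>\<^bsub>FF\<^esub> cls {P \<in> U. f P \<noteq> 0} (\<lambda>P. inverse (f P)) = \<one>\<^bsub>FF\<^esub>"
    unfolding cls_mult[OF f *] one_zero
    by (subst cls_eq_iff[OF reps_mult[OF f *] reps_const]) auto
qed

lemma field_function_field: "field FF"
proof -
  have "cring FF"
  proof (rule cringI)
    show "abelian_group FF"
    proof (rule abelian_groupI)
      fix a b assume "a \<in> carrier FF" "b \<in> carrier FF"
      then obtain U f V g where 1: "(U, f) \<in> reps" "a = cls U f" "(V, g) \<in> reps" "b = cls V g"
        by (metis carrierE)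
      then show "a \<oplus>\<^bsub>FF\<^esub> b \<in> carrier FF" by (simp add: cls_add reps_add cls_carrier)
      show "a \<oplus>\<^bsub>FF\<^esub> b = b \<oplus>\<^bsub>FF\<^esub> a"
        using 1 by (simp add: cls_add cls_eq_iff reps_add)
      fix c assume "c \<in> carrier FF"
      then obtain W h where 2: "(W, h) \<in> reps" "c = cls W h" by (metis carrierE)
      show "a \<oplus>\<^bsub>FF\<^esub> b \<oplus>\<^bsub>FF\<^esub> c = a \<oplus>\<^bsub>FF\<^esub> (b \<oplus>\<^bsub>FF\<^esub> c)"
        using 1 2 reps_add[OF reps_add[OF 1(1,3)] 2(1)] reps_add[OF 1(1) reps_add[OF 1(3) 2(1)]]
        by (simp add: cls_add cls_eq_iff reps_add)
    next
      show "\<zero>\<^bsub>FF\<^esub> \<in> carrier FF" by (simp add: one_zero cls_carrier)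
    next
      fix a assume "a \<in> carrier FF"
      then obtain U f where 1: "(U, f) \<in> reps" "a = cls U f" by (metis carrierE)
      have 2: "(U \<inter> X, \<lambda>P. - f P) \<in> reps" using reps_mult[OF 1(1) reps_const[of "- 1"]] by simp
      have 3: "(X \<inter> U, \<lambda>P. 0 + f P) \<in> reps" by (rule reps_add[OF reps_const 1(1)])
      show "\<zero>\<^bsub>FF\<^esub> \<oplus>\<^bsub>FF\<^esub> a = a"
        unfolding one_zero 1(2) cls_add[OF reps_const 1(1)] by (subst cls_eq_iff[OF 3 1(1)]) simp
      show "\<exists>b\<in>carrier FF. b \<oplus>\<^bsub>FF\<^esub> a = \<zero>\<^bsub>FF\<^esub>"
        using 1 2 reps_add[OF 2 1(1)]
        by (intro bexI[of _ "cls (U \<inter> X) (\<lambda>P. - f P)"])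
          (simp_all add: cls_add[OF 2 1(1)] cls_eq_zero_iff cls_carrier)
    qed
    show "comm_monoid FF"
    proof (rule comm_monoidI)
      fix a b assume "a \<in> carrier FF" "b \<in> carrier FF"
      then obtain U f V g where 1: "(U, f) \<in> reps" "a = cls U f" "(V, g) \<in> reps" "b = cls V g"
        by (metis carrierE)
      then show "a \<otimes>\<^bsub>FF\<^esub> b \<in> carrier FF" by (simp add: cls_mult reps_mult cls_carrier)
      show "a \<otimes>\<^bsub>FF\<^esub> b = b \<otimes>\<^bsub>FF\<^esub> a"
        using 1 by (simp add: cls_mult cls_eq_iff reps_mult)
      fix c assume "c \<in> carrier FF"
      then obtain W h where 2: "(W, h) \<in> reps" "c = cls W h" by (metis carrierE)
      show "a \<otimes>\<^bsub>FF\<^esub> b \<otimes>\<^bsub>FF\<^esub> c = a \<otimes>\<^bsub>FF\<^esub> (b \<otimes>\<^bsub>FF\<^esub> c)"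
        using 1 2 reps_mult[OF reps_mult[OF 1(1,3)] 2(1)] reps_mult[OF 1(1) reps_mult[OF 1(3) 2(1)]]
        by (simp add: cls_mult cls_eq_iff reps_mult)
    next
      show "\<one>\<^bsub>FF\<^esub> \<in> carrier FF" by (simp add: one_zero cls_carrier)
    next
      fix a assume "a \<in> carrier FF"
      then obtain U f where 1: "(U, f) \<in> reps" "a = cls U f" by (metis carrierE)
      have 3: "(X \<inter> U, \<lambda>P. 1 * f P) \<in> reps" by (rule reps_mult[OF reps_const 1(1)])
      show "\<one>\<^bsub>FF\<^esub> \<otimes>\<^bsub>FF\<^esub> a = a"
        unfolding one_zero 1(2) cls_mult[OF reps_const 1(1)] by (subst cls_eq_iff[OF 3 1(1)]) simp
    qed
    fix a b c assume "a \<in> carrier FF" "b \<in> carrier FF" "c \<in> carrier FF"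
    then obtain U f V g W h where 1: "(U, f) \<in> reps" "a = cls U f" "(V, g) \<in> reps" "b = cls V g"
        "(W, h) \<in> reps" "c = cls W h"
      by (metis carrierE)
    note m = reps_mult[OF reps_add[OF 1(1,3)] 1(5)] reps_add[OF reps_mult[OF 1(1,5)] reps_mult[OF 1(3,5)]]
    show "(a \<oplus>\<^bsub>FF\<^esub> b) \<otimes>\<^bsub>FF\<^esub> c = a \<otimes>\<^bsub>FF\<^esub> c \<oplus>\<^bsub>FF\<^esub> b \<otimes>\<^bsub>FF\<^esub> c"
      unfolding 1(2,4,6) cls_add[OF 1(1,3)] cls_mult[OF reps_add[OF 1(1,3)] 1(5)]
        cls_mult[OF 1(1,5)] cls_mult[OF 1(3,5)] cls_add[OF reps_mult[OF 1(1,5)] reps_mult[OF 1(3,5)]]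
      by (subst cls_eq_iff[OF m]) (simp add: distrib_right)
  qed
  then show ?thesis
  proof (rule cring.cring_fieldI2)
    show "\<zero>\<^bsub>FF\<^esub> \<noteq> \<one>\<^bsub>FF\<^esub>"
      unfolding one_zero using X_nonempty by (subst cls_eq_iff) auto
    fix a assume a: "a \<in> carrier FF" "a \<noteq> \<zero>\<^bsub>FF\<^esub>"
    then obtain U f where 1: "(U, f) \<in> reps" "a = cls U f" by (metis carrierE)
    then show "\<exists>b\<in>carrier FF. a \<otimes>\<^bsub>FF\<^esub> b = \<one>\<^bsub>FF\<^esub>"
      using cls_inverse[OF 1(1)] a by (auto intro: cls_carrier)
  qed
qed

sublocale FF: field_over FF \<iota>
proof -
  interpret field FF by (rule field_function_field)
  show "field_over FF \<iota>"
  proof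
    show "\<iota> c \<in> carrier FF" for c by (simp add: \<iota>_def cls_carrier)
    show "\<iota> 1 = \<one>\<^bsub>FF\<^esub>" by (simp add: \<iota>_def one_zero)
    show "\<iota> (c + d) = \<iota> c \<oplus>\<^bsub>FF\<^esub> \<iota> d" for c d by (simp add: \<iota>_def cls_add)
    show "\<iota> (c * d) = \<iota> c \<otimes>\<^bsub>FF\<^esub> \<iota> d" for c d by (simp add: \<iota>_def cls_mult)
  qed
qed

end

section \<open>Forms and local rings\<close>

definition coord :: "'n::finite \<Rightarrow> ('k::field, 'n) mpoly" where
  "coord i = single (single i 1) 1"

lemma monom_eval_single_1: "monom_eval (single i 1) x = (x :: 'k::field ^ 'n::finite) $ i"
proof -
  have "monom_eval (single i 1) x = (\<Prod>j\<in>UNIV. if j = i then x $ i else 1)"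
    unfolding monom_eval_def by (intro prod.cong) (auto simp: lookup_single when_def)
  then show ?thesis by simp
qed

lemma mpoly_eval_coord [simp]: "mpoly_eval (coord i) x = x $ i"
  using monom_eval_single_1[of i x] by (simp add: coord_def mpoly_eval_single)

lemma homogeneous_single_1: "homogeneous 1 (single (single i 1) c)"
  by (auto simp: homogeneous_def lookup_single when_def)

lemma homogeneous_coord: "homogeneous 1 (coord i)"
  unfolding coord_def by (rule homogeneous_single_1)

lemma single_mult_coord:
  "single m c * coord i = single (m + single i 1) c"
  by (simp add: coord_def mult_single)

text \<open>For \<open>x\<close> over \<open>P\<close> and \<open>y\<close> over \<open>Q\<close> some minor
  \<open>x\<^sub>i y\<^sub>j - x\<^sub>j y\<^sub>i\<close> does not vanish.\<close>

lemma separating_linear_form: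
  fixes P Q :: "('k::field, 'n::finite) point"
  assumes P: "P \<in> proj_space" and Q: "Q \<in> proj_space" and "P \<noteq> Q"
  shows "\<exists>g. homogeneous 1 g \<and> form_value g P \<noteq> 0 \<and> form_value g Q = 0"
proof -
  obtain x y where x: "x \<in> P" and y: "y \<in> Q" using P Q proj_space_nonempty by metis
  have nz: "x \<noteq> 0" "y \<noteq> 0" using proj_space_scale(2)[OF P x x] proj_space_scale(2)[OF Q y y] by auto
  obtain j where j: "y $ j \<noteq> 0" using nz by (auto simp: vec_eq_iff)
  have "\<exists>i. x $ i * y $ j \<noteq> x $ j * y $ i"
  proof (rule ccontr)
    assume "\<not> ?thesis"
    then have "x = (x $ j / y $ j) *s y" using j by (simp add: vec_eq_iff field_simps)
    then have yx: "(y, x) \<in> proportional" using nz by (auto simp: proportional_def)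
    obtain z where z: "z \<noteq> 0" "P = proportional `` {z}"
      using P by (auto simp: proj_space_def quotient_def)
    obtain w where w: "w \<noteq> 0" "Q = proportional `` {w}"
      using Q by (auto simp: proj_space_def quotient_def)
    have sym: "(b, a) \<in> proportional" if ab: "(a, b) \<in> proportional" for a b :: "'k ^ 'n"
    proof -
      obtain c where c: "b = c *s a" "a \<noteq> 0" "b \<noteq> 0" using ab by (auto simp: proportional_def)
      then have "c \<noteq> 0" by auto
      then have "a = inverse c *s b" using c by (simp add: vec_eq_iff)
      then show ?thesis using c unfolding proportional_def by blast
    qed
    have trans: "(a, c) \<in> proportional" if abc: "(a, b) \<in> proportional" "(b, c) \<in> proportional"
      for a b c :: "'k ^ 'n"
    proof -
      obtain k l where "b = k *s a" "c = l *s b" "a \<noteq> 0" "c \<noteq> 0"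
        using abc by (auto simp: proportional_def)
      then have "c = (l * k) *s a" by (simp add: vec_eq_iff)
      then show ?thesis using \<open>a \<noteq> 0\<close> \<open>c \<noteq> 0\<close> unfolding proportional_def by blast
    qed
    have "(z, x) \<in> proportional" "(w, y) \<in> proportional" using x y z w by auto
    then have "(z, w) \<in> proportional" using yx sym trans by blast
    then have "P = Q" unfolding z(2) w(2) using sym trans by blast
    then show False using \<open>P \<noteq> Q\<close> by simp
  qed
  then obtain i where i: "x $ i * y $ j \<noteq> x $ j * y $ i" by blast
  define g :: "('k, 'n) mpoly" where "g = single (single i 1) (y $ j) +
      single (single j 1) (- y $ i)"
  have g: "homogeneous 1 g" unfolding g_def by (intro homogeneous_add homogeneous_single_1)
  have eval: "mpoly_eval g z = y $ j * z $ i - y $ i * z $ j" for z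
    using monom_eval_single_1[of i z] monom_eval_single_1[of j z]
    by (simp add: g_def mpoly_eval_add mpoly_eval_single)
  show ?thesis
    using g i form_value_eq_0_iff[OF g P x] form_value_eq_0_iff[OF g Q y]
    by (intro exI[of _ g]) (auto simp: eval mult.commute)
qed

text \<open>Euclid's argument: over a finite field, one plus the product of all X - a takes only the
  value 1, a nonconstant polynomial without a root.\<close>

lemma infinite_alg_closed: "infinite (UNIV :: 'k::alg_closed_field set)"
proof
  assume fin: "finite (UNIV :: 'k set)"
  define p :: "'k poly" where "p = (\<Prod>a\<in>UNIV. [:- a, 1:]) + 1"
  have "degree (\<Prod>a\<in>(UNIV :: 'k set). [:- a, 1:]) = card (UNIV :: 'k set)"
    by (subst degree_prod_eq_sum_degree) auto
  then have "degree p = card (UNIV :: 'k set)"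
    unfolding p_def using fin by (subst degree_add_eq_left) (simp_all add: card_gt_0_iff)
  then have "degree p > 0" using fin by (simp add: card_gt_0_iff)
  then obtain x where "poly p x = 0" using alg_closed_imp_poly_has_root by blast
  moreover have "(\<Prod>a\<in>UNIV. x - a) = 0" using fin by (subst prod_zero_iff) auto
  ultimately show False by (simp add: p_def poly_prod)
qed

context variety
begin

lemma exists_coord:
  assumes "P \<in> X" shows "\<exists>i. form_value (coord i) P \<noteq> 0"
proof -
  have P: "P \<in> proj_space" using assms X_proj by blast
  obtain x where x: "x \<in> P" using proj_space_nonempty[OF P] by blast
  then have "x \<noteq> 0" using proj_space_scale(2)[OF P] by blast
  then obtain i where "x $ i \<noteq> 0" by (auto simp: vec_eq_iff)
  then show ?thesis using form_value_eq_0_iff[OF homogeneous_coord P x] by auto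
qed

lemma nonvanishing_linear_form:
  assumes "infinite (UNIV :: 'k set)" "finite S" "S \<subseteq> X"
  shows "\<exists>l. homogeneous 1 l \<and> (\<forall>P\<in>S. form_value l P \<noteq> 0)"
  using assms(2,3)
proof (induction S)
  case empty
  then show ?case using homogeneous_coord by blast
next
  case (insert P S)
  then obtain l where l: "homogeneous 1 l" "\<forall>P\<in>S. form_value l P \<noteq> 0" by auto
  obtain i where i: "form_value (coord i) P \<noteq> 0" using exists_coord insert by blast
  \<comment> \<open>Each point rules out one value of \<open>s\<close>. Where \<open>coord i\<close>
    vanishes, the quotient is 0 by convention and \<open>l\<close> alone is already nonzero, because
    such a point differs from \<open>P\<close>.\<close>
  define bad where "bad = (\<lambda>Q. - form_value l Q / form_value (coord i) Q) ` insert P S"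
  obtain s where s: "s \<notin> bad"
    using ex_new_if_finite[OF assms(1), of bad] insert by (auto simp: bad_def)
  define l' where "l' = l + single 0 s * coord i"
  have "homogeneous 1 l'" unfolding l'_def
    using homogeneous_mult[OF homogeneous_single homogeneous_coord, of s i] l
    by (simp add: homogeneous_add)
  moreover have "form_value l' Q \<noteq> 0" if Q: "Q \<in> insert P S" for Q
  proof (cases "form_value (coord i) Q = 0")
    case True
    then show ?thesis using Q i l by (auto simp: l'_def)
  next
    case False
    have "s \<noteq> - form_value l Q / form_value (coord i) Q" using s Q by (auto simp: bad_def)
    then show ?thesis using False by (simp add: l'_def field_simps eq_neg_iff_add_eq_0)
  qed
  ultimately show ?case by blast
qed

lemma separating_form:
  assumes "finite T" "P \<notin> T" "insert P T \<subseteq> X"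
  shows "\<exists>d g. homogeneous d g \<and> form_value g P \<noteq> 0 \<and> (\<forall>Q\<in>T. form_value g Q = 0)"
  using assms
proof (induction T)
  case empty
  then show ?case using homogeneous_single[of 1] by (intro exI[of _ 0] exI[of _ 1]) simp
next
  case (insert Q T)
  then obtain d g where g: "homogeneous d g" "form_value g P \<noteq> 0" "\<forall>Q\<in>T. form_value g Q = 0" by auto
  obtain g' where g': "homogeneous 1 g'" "form_value g' P \<noteq> 0" "form_value g' Q = 0"
    using separating_linear_form[of P Q] insert X_proj by auto
  show ?case using g g' homogeneous_mult[OF g(1) g'(1)]
    by (intro exI[of _ "d + 1"] exI[of _ "g * g'"]) auto
qed

definition quot :: "('k, 'n) mpoly \<Rightarrow> ('k, 'n) mpoly \<Rightarrow> ('k, 'n) rational" where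
  "quot g h = cls (nz h) (\<lambda>P. form_value g P / form_value h P)"

lemma quot_reps:
  assumes "homogeneous d g" "homogeneous d h" "nz h \<noteq> {}"
  shows "(nz h, \<lambda>P. form_value g P / form_value h P) \<in> reps"
  unfolding reps_iff
  using assms(3) open_nz[OF assms(2)] regular_on_quotient[OF assms(1,2) open_nz[OF assms(2)]] by simp

lemma quot_carrier:
  "homogeneous d g \<Longrightarrow> homogeneous d h \<Longrightarrow> nz h \<noteq> {} \<Longrightarrow> quot g h \<in> carrier FF"
  unfolding quot_def using quot_reps by blast

lemma nz_Int_nonempty:
  assumes "homogeneous d g" "homogeneous e h" "nz g \<noteq> {}" "nz h \<noteq> {}"
  shows "nz g \<inter> nz h \<noteq> {}"
  by (rule dense[OF open_nz[OF assms(1)] open_nz[OF assms(2)] assms(3,4)])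

lemma nz_power [simp]: "nz (h ^ d) = (if d = 0 then X else nz h)"
  by (auto simp: nz_def)

lemma quot_mult:
  assumes "homogeneous d g" "homogeneous d h" "homogeneous d' g'" "homogeneous d' h'"
    and "nz h \<noteq> {}" "nz h' \<noteq> {}"
  shows "quot g h \<otimes>\<^bsub>FF\<^esub> quot g' h' = quot (g * g') (h * h')"
  unfolding quot_def
  by (simp add: cls_mult[OF quot_reps[OF assms(1,2,5)] quot_reps[OF assms(3,4,6)]])

lemma quot_add:
  assumes "homogeneous d g" "homogeneous d g'" "homogeneous d h" "nz h \<noteq> {}"
  shows "quot g h \<oplus>\<^bsub>FF\<^esub> quot g' h = quot (g + g') h"
  unfolding quot_def
  by (simp add: cls_add[OF quot_reps[OF assms(1,3,4)] quot_reps[OF assms(2,3,4)]] add_divide_distrib)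

lemma quot_eqI:
  assumes "(U, f) \<in> reps" "P \<in> U"
  shows "\<exists>d g h. homogeneous d g \<and> homogeneous d h \<and> P \<in> nz h \<and> cls U f = quot g h \<and>
    f P = form_value g P / form_value h P"
proof -
  have U: "open_in X U" "regular_on X U f" using assms by (auto simp: reps_iff)
  obtain V d g h where V: "open_in X V" "P \<in> V" "V \<subseteq> U" "homogeneous d g" "homogeneous d h"
    "V \<subseteq> nz h" "\<forall>Q\<in>V. f Q = form_value g Q / form_value h Q"
    using regular_onD[OF U(2) open_subset[OF U(1)] assms(2)] by blast
  have "nz h \<noteq> {}" using V by auto
  then have "cls U f = quot g h" unfolding quot_def
    using V by (intro cls_cong_agree[OF assms(1) quot_reps[OF V(4,5)], of V]) auto
  then show ?thesis using V by blast
qed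

lemma quot_const: "quot (single 0 c) 1 = \<iota> c"
proof -
  have "nz 1 = X" by (auto simp: nz_def)
  then show ?thesis by (simp add: quot_def \<iota>_def)
qed

text \<open>Dehomogenisation: dividing a form of degree \<open>d\<close> by \<open>l ^ d\<close>
  gives a polynomial in the affine coordinates. Stated for any \<open>S\<close> closed under the
  operations, to serve both the generators of the maximal ideal and the function field of the
  line.\<close>

lemma quot_in_subring:
  assumes S: "\<And>c. \<iota> c \<in> S" "\<And>a b. a \<in> S \<Longrightarrow> b \<in> S \<Longrightarrow> a \<oplus>\<^bsub>FF\<^esub> b \<in> S"
      "\<And>a b. a \<in> S \<Longrightarrow> b \<in> S \<Longrightarrow> a \<otimes>\<^bsub>FF\<^esub> b \<in> S"
    and l: "homogeneous 1 l" "nz l \<noteq> {}"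
    and coords: "\<And>i. quot (coord i) l \<in> S"
    and g: "homogeneous d g"
  shows "quot g (l ^ d) \<in> S"
proof -
  have ld: "homogeneous d (l ^ d)" for d using homogeneous_power[OF l(1), of d] by simp
  have nzl: "nz (l ^ d) \<noteq> {}" for d using l(2) X_nonempty by simp
  have hom_single: "homogeneous (\<Sum>i\<in>UNIV. lookup m i) (single m c)"
    for m :: "'n \<Rightarrow>\<^sub>0 nat" and c :: 'k by (auto simp: homogeneous_def)
  have mono: "quot (single m c) (l ^ d) \<in> S"
    if "(\<Sum>i\<in>UNIV. lookup m i) = d" for m d c
    using that
  proof (induction d arbitrary: m)
    case 0
    then have "m = 0" by (intro poly_mapping_eqI) simp
    then show ?case using quot_const[of c] S(1) by simp
  next
    case (Suc d)
    then obtain i where i: "lookup m i \<noteq> 0" by fastforce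
    define m' where "m' = m - single i 1"
    have m: "m = m' + single i 1"
      using i by (intro poly_mapping_eqI)
        (auto simp: m'_def lookup_add lookup_minus lookup_single when_def)
    have "(\<Sum>j\<in>UNIV. lookup m j) =
        (\<Sum>j\<in>UNIV. lookup m' j) + (\<Sum>j\<in>UNIV. if j = i then 1 else 0)"
      unfolding m sum.distrib[symmetric] by (intro sum.cong) (auto simp: lookup_add lookup_single when_def)
    then have d: "(\<Sum>j\<in>UNIV. lookup m' j) = d" using Suc.prems by simp
    have "quot (single m' c) (l ^ d) \<otimes>\<^bsub>FF\<^esub> quot (coord i) l =
        quot (single m' c * coord i) (l ^ d * l)"
      using hom_single[of m' c] unfolding d by (intro quot_mult[OF _ ld homogeneous_coord l(1) nzl l(2)])
    then have "quot (single m c) (l ^ Suc d) =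
        quot (single m' c) (l ^ d) \<otimes>\<^bsub>FF\<^esub> quot (coord i) l"
      unfolding single_mult_coord m[symmetric] by (simp add: mult.commute)
    then show ?case using S(3)[OF Suc.IH[OF d] coords] by simp
  qed
  have "quot (\<Sum>m\<in>A. single m (lookup g m)) (l ^ d) \<in> S \<and>
      homogeneous d (\<Sum>m\<in>A. single m (lookup g m))"
    if "finite A" "A \<subseteq> keys g" for A
    using that
  proof (induction A)
    case empty
    have "quot 0 (l ^ d) = \<iota> 0"
      unfolding quot_def \<iota>_def using quot_reps[of d 0 "l ^ d"] ld nzl
      by (subst cls_eq_iff) (auto simp: homogeneous_def form_value_def mpoly_eval_def)
    then show ?case using S(1)[of 0] by (simp add: homogeneous_def)
  next
    case (insert m A)
    let ?s = "single m (lookup g m)"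
    have deg: "(\<Sum>i\<in>UNIV. lookup m i) = d" using insert g by (auto simp: homogeneous_def)
    then have s: "homogeneous d ?s" using hom_single[of m] by metis
    have IH: "quot (\<Sum>m\<in>A. single m (lookup g m)) (l ^ d) \<in> S"
      "homogeneous d (\<Sum>m\<in>A. single m (lookup g m))" using insert by auto
    show ?case
      unfolding sum.insert[OF insert.hyps(1,2)] quot_add[OF s IH(2) ld nzl, symmetric]
      using S(2)[OF mono[OF deg] IH(1)] homogeneous_add[OF s IH(2)] by blast
  qed
  moreover have "g = (\<Sum>m\<in>keys g. single m (lookup g m))"
    by (rule poly_mapping_eqI) (auto simp: lookup_sum lookup_single when_def in_keys_iff)
  ultimately show ?thesis by (metis finite_keys order_refl)
qed

text \<open>Numerator and denominator are each divided by \<open>l ^ d\<close>, so that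
  \<open>quot_in_subring\<close> applies to both.\<close>

lemma quot_change_denominator:
  assumes gh: "homogeneous d g" "homogeneous d h" "nz h \<noteq> {}" and l: "homogeneous 1 l" "nz l \<noteq> {}"
  shows "quot h (l ^ d) \<noteq> \<zero>\<^bsub>FF\<^esub>"
    "quot g h = quot g (l ^ d) \<otimes>\<^bsub>FF\<^esub> inv\<^bsub>FF\<^esub> (quot h (l ^ d))"
proof -
  have ld: "homogeneous d (l ^ d)" using homogeneous_power[OF l(1), of d] by simp
  have nzl: "nz (l ^ d) \<noteq> {}" using l(2) X_nonempty by simp
  obtain P where P: "P \<in> nz (l ^ d)" "P \<in> nz h" using nz_Int_nonempty[OF ld gh(2) nzl gh(3)] by auto
  then have "form_value h P / form_value (l ^ d) P \<noteq> 0" by (simp add: nz_def)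
  then show nz0: "quot h (l ^ d) \<noteq> \<zero>\<^bsub>FF\<^esub>"
    unfolding quot_def cls_eq_zero_iff[OF quot_reps[OF gh(2) ld nzl]] using P by blast
  have car: "quot g h \<in> carrier FF" "quot h (l ^ d) \<in> carrier FF" "quot g (l ^ d) \<in> carrier FF"
    using quot_carrier gh ld nzl by blast+
  have "quot g h \<otimes>\<^bsub>FF\<^esub> quot h (l ^ d) = quot (g * h) (h * l ^ d)"
    using gh ld nzl by (intro quot_mult)
  also have "\<dots> = quot g (l ^ d)"
  proof -
    have "nz (h * l ^ d) \<noteq> {}" using P by (simp only: nz_mult) blast
    then show ?thesis
      unfolding quot_def using gh ld nzl
      by (subst cls_eq_iff[OF quot_reps quot_reps]) (auto intro: homogeneous_mult simp: nz_def)
  qed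
  finally have eq: "quot g h \<otimes>\<^bsub>FF\<^esub> quot h (l ^ d) = quot g (l ^ d)" .
  show "quot g h = quot g (l ^ d) \<otimes>\<^bsub>FF\<^esub> inv\<^bsub>FF\<^esub> (quot h (l ^ d))"
    unfolding eq[symmetric] using car nz0 by (simp add: FF.m_assoc)
qed

lemma carrier_quot:
  assumes "a \<in> carrier FF"
  shows "\<exists>d g h. homogeneous d g \<and> homogeneous d h \<and> nz h \<noteq> {} \<and> a = quot g h"
proof -
  obtain U f where U: "(U, f) \<in> reps" "a = cls U f" using carrierE[OF assms] by blast
  then obtain P where "P \<in> U" by (auto simp: reps_iff)
  from quot_eqI[OF U(1) this] show ?thesis using U(2) by blast
qed

lemma local_ring_iff:
  "a \<in> local_ring X P \<longleftrightarrow> (\<exists>U f. (U, f) \<in> reps \<and> P \<in> U \<and> a = cls U f)"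
proof
  assume "a \<in> local_ring X P"
  then obtain U f where "a \<in> carrier FF" "(U, f) \<in> a" "P \<in> U" by (auto simp: local_ring_def)
  then show "\<exists>U f. (U, f) \<in> reps \<and> P \<in> U \<and> a = cls U f"
    by (elim carrierE) (metis cls_mem_iff)
next
  assume "\<exists>U f. (U, f) \<in> reps \<and> P \<in> U \<and> a = cls U f"
  then show "a \<in> local_ring X P"
    unfolding local_ring_def using cls_mem_iff by blast
qed

lemma max_ideal_iff:
  "a \<in> max_ideal X P \<longleftrightarrow> (\<exists>U f. (U, f) \<in> reps \<and> P \<in> U \<and> f P = 0 \<and> a = cls U f)"
proof
  assume "a \<in> max_ideal X P"
  then obtain U f where "a \<in> carrier FF" "(U, f) \<in> a" "P \<in> U" "f P = 0" by (auto simp: max_ideal_def)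
  then show "\<exists>U f. (U, f) \<in> reps \<and> P \<in> U \<and> f P = 0 \<and> a = cls U f"
    by (elim carrierE) (metis cls_mem_iff)
next
  assume "\<exists>U f. (U, f) \<in> reps \<and> P \<in> U \<and> f P = 0 \<and> a = cls U f"
  then show "a \<in> max_ideal X P"
    unfolding max_ideal_def using cls_mem_iff by blast
qed

lemma cls_max_ideal_iff:
  assumes "(U, f) \<in> reps" "P \<in> U"
  shows "cls U f \<in> max_ideal X P \<longleftrightarrow> f P = 0"
proof
  assume "cls U f \<in> max_ideal X P"
  then obtain V g where "(V, g) \<in> reps" "P \<in> V" "g P = 0" "cls U f = cls V g"
    unfolding max_ideal_iff by blast
  then show "f P = 0" using cls_eq_iff[OF assms(1), of V g] assms(2) by auto
qed (use assms max_ideal_iff in blast)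

lemma local_subring_local_ring:
  assumes P: "P \<in> X"
  shows "local_subring FF \<iota> (local_ring X P) (max_ideal X P)"
proof
  show "local_ring X P \<subseteq> carrier FF" by (auto simp: local_ring_def)
  show "a \<oplus>\<^bsub>FF\<^esub> b \<in> local_ring X P" "a \<otimes>\<^bsub>FF\<^esub> b \<in> local_ring X P"
    if ab: "a \<in> local_ring X P" "b \<in> local_ring X P" for a b
  proof -
    obtain U f where 1: "(U, f) \<in> reps" "P \<in> U" "a = cls U f" using ab unfolding local_ring_iff by blast
    obtain V g where 2: "(V, g) \<in> reps" "P \<in> V" "b = cls V g" using ab unfolding local_ring_iff by blast
    show "a \<oplus>\<^bsub>FF\<^esub> b \<in> local_ring X P" "a \<otimes>\<^bsub>FF\<^esub> b \<in> local_ring X P"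
      unfolding local_ring_iff 1(3) 2(3) cls_add[OF 1(1) 2(1)] cls_mult[OF 1(1) 2(1)]
      using reps_add[OF 1(1) 2(1)] reps_mult[OF 1(1) 2(1)] 1(2) 2(2) by blast+
  qed
  show "\<iota> c \<in> local_ring X P" for c
    unfolding local_ring_iff \<iota>_def using P reps_const by blast
  show "max_ideal X P \<subseteq> local_ring X P"
  proof
    fix a assume "a \<in> max_ideal X P"
    then show "a \<in> local_ring X P" unfolding max_ideal_iff local_ring_iff by blast
  qed
  show "\<zero>\<^bsub>FF\<^esub> \<in> max_ideal X P"
    unfolding one_zero cls_max_ideal_iff[OF reps_const P] by simp
  show "a \<oplus>\<^bsub>FF\<^esub> b \<in> max_ideal X P" if ab: "a \<in> max_ideal X P" "b \<in> max_ideal X P" for a b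
  proof -
    obtain U f where 1: "(U, f) \<in> reps" "P \<in> U" "f P = 0" "a = cls U f" using ab unfolding max_ideal_iff by blast
    obtain V g where 2: "(V, g) \<in> reps" "P \<in> V" "g P = 0" "b = cls V g" using ab unfolding max_ideal_iff by blast
    show ?thesis
      unfolding 1(4) 2(4) cls_add[OF 1(1) 2(1)]
      using 1 2 cls_max_ideal_iff[OF reps_add[OF 1(1) 2(1)], of P] by simp
  qed
  show "a \<otimes>\<^bsub>FF\<^esub> b \<in> max_ideal X P" if ab: "a \<in> local_ring X P" "b \<in> max_ideal X P" for a b
  proof -
    obtain U f where 1: "(U, f) \<in> reps" "P \<in> U" "a = cls U f" using ab unfolding local_ring_iff by blast
    obtain V g where 2: "(V, g) \<in> reps" "P \<in> V" "g P = 0" "b = cls V g" using ab unfolding max_ideal_iff by blast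
    show ?thesis
      unfolding 1(3) 2(4) cls_mult[OF 1(1) 2(1)]
      using 1 2 cls_max_ideal_iff[OF reps_mult[OF 1(1) 2(1)], of P] by simp
  qed
  show "\<one>\<^bsub>FF\<^esub> \<notin> max_ideal X P"
    unfolding one_zero cls_max_ideal_iff[OF reps_const P] by simp
  show "inv\<^bsub>FF\<^esub> a \<in> local_ring X P" if a: "a \<in> local_ring X P" "a \<notin> max_ideal X P" for a
  proof -
    obtain U f where 1: "(U, f) \<in> reps" "P \<in> U" "a = cls U f" using a unfolding local_ring_iff by blast
    have f: "f P \<noteq> 0" using cls_max_ideal_iff[OF 1(1,2)] a(2) 1(3) by blast
    then have nz: "cls U f \<noteq> \<zero>\<^bsub>FF\<^esub>" using cls_eq_zero_iff[OF 1(1)] 1(2) by blast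
    note inv = cls_inverse[OF 1(1) nz]
    have "inv\<^bsub>FF\<^esub> a = cls {P \<in> U. f P \<noteq> 0} (\<lambda>P. inverse (f P))"
      using FF.comm_inv_char[OF _ _ inv(2)] inv(1) 1 by blast
    then show ?thesis using inv(1) 1(2) f unfolding local_ring_iff by blast
  qed
  show "\<exists>c. a \<ominus>\<^bsub>FF\<^esub> \<iota> c \<in> max_ideal X P" if a: "a \<in> local_ring X P" for a
  proof -
    obtain U f where 1: "(U, f) \<in> reps" "P \<in> U" "a = cls U f" using a unfolding local_ring_iff by blast
    have "a \<ominus>\<^bsub>FF\<^esub> \<iota> (f P) = a \<oplus>\<^bsub>FF\<^esub> \<iota> (- f P)"
      by (simp add: FF.minus_eq FF.const_uminus)
    also have "\<dots> = cls (U \<inter> X) (\<lambda>Q. f Q + - f P)"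
      unfolding 1(3) \<iota>_def by (rule cls_add[OF 1(1) reps_const])
    also have "\<dots> \<in> max_ideal X P"
      using cls_max_ideal_iff[OF reps_add[OF 1(1) reps_const[of "- f P"]], of P] 1(2) P by simp
    finally show ?thesis by blast
  qed
  show "\<exists>b\<in>local_ring X P. \<exists>c\<in>local_ring X P. c \<noteq> \<zero>\<^bsub>FF\<^esub> \<and> a = b \<otimes>\<^bsub>FF\<^esub> inv\<^bsub>FF\<^esub> c"
    if a: "a \<in> carrier FF" for a
  proof -
    obtain d g h where gh: "homogeneous d g" "homogeneous d h" "nz h \<noteq> {}" "a = quot g h"
      using carrier_quot[OF a] by blast
    \<comment> \<open>Dividing by a coordinate that does not vanish at \<open>P\<close> makes both
      \<open>g\<close> and \<open>h\<close> regular functions near \<open>P\<close>.\<close>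
    obtain i where i: "form_value (coord i) P \<noteq> 0" using exists_coord[OF P] by blast
    then have l: "P \<in> nz (coord i)" using P by (simp add: nz_def)
    have ld: "homogeneous d (coord i ^ d)" using homogeneous_power[OF homogeneous_coord, of d] by simp
    have Pl: "P \<in> nz (coord i ^ d)" using P i by (simp add: nz_def)
    have "quot k (coord i ^ d) \<in> local_ring X P" if "homogeneous d k" for k
      unfolding quot_def local_ring_iff using quot_reps[OF that ld] Pl by blast
    then show ?thesis
      using quot_change_denominator[OF gh(1-3) homogeneous_coord, of i] l gh by blast
  qed
qed

text \<open>The generators are the affine coordinates shifted by their values at \<open>P\<close>. A
  numerator vanishing at \<open>P\<close> then has no constant part in
  \<open>L.const_plus_Span ms\<close>, and the denominator is a unit of the local ring.\<close>

lemma max_ideal_generators: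
  assumes P: "P \<in> X"
  shows "\<exists>ms. set ms \<subseteq> max_ideal X P \<and> max_ideal X P \<subseteq> FF.Span (local_ring X P) ms"
proof -
  interpret L: local_subring FF \<iota> "local_ring X P" "max_ideal X P"
    by (rule local_subring_local_ring[OF P])
  obtain i where i: "form_value (coord i) P \<noteq> 0" using exists_coord[OF P] by blast
  define l :: "('k, 'n) mpoly" where "l = coord i"
  have l: "homogeneous 1 l" "P \<in> nz l" "nz l \<noteq> {}" and lP: "form_value l P \<noteq> 0"
    using P i homogeneous_coord by (auto simp: l_def nz_def)
  have ld: "homogeneous d (l ^ d)" "P \<in> nz (l ^ d)" for d
    using homogeneous_power[OF l(1), of d] l(2) P by auto
  have loc: "quot k (l ^ d) \<in> local_ring X P" if "homogeneous d k" for k d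
    unfolding quot_def local_ring_iff using quot_reps[OF that ld(1)] ld(2) by blast
  have yA: "quot (coord j) l \<in> local_ring X P" for j
    using loc[OF homogeneous_coord, of j] by simp
  obtain c where c: "\<And>j. quot (coord j) l \<ominus>\<^bsub>FF\<^esub> \<iota> (c j) \<in> max_ideal X P"
    using L.A_residue[OF yA] by metis
  obtain js :: "'n list" where js: "set js = UNIV" using finite_list[of "UNIV :: 'n set"] by auto
  define ms where "ms = map (\<lambda>j. quot (coord j) l \<ominus>\<^bsub>FF\<^esub> \<iota> (c j)) js"
  have ms: "set ms \<subseteq> max_ideal X P" using c by (auto simp: ms_def)
  note S = L.const_plus_Span_closed[OF ms]
  have "quot (coord j) l \<in> L.const_plus_Span ms" for j
  proof -
    have "quot (coord j) l \<ominus>\<^bsub>FF\<^esub> \<iota> (c j) \<in> FF.Span (local_ring X P) ms"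
      using ms L.m_A js by (intro L.mem_Span_A) (auto simp: ms_def)
    moreover have "quot (coord j) l = \<iota> (c j) \<oplus>\<^bsub>FF\<^esub> (quot (coord j) l \<ominus>\<^bsub>FF\<^esub> \<iota> (c j))"
      using L.A_closed[OF yA[of j]] FF.const_closed[of "c j"] by algebra
    ultimately show ?thesis unfolding L.const_plus_Span_def by blast
  qed
  then have inS: "quot g (l ^ d) \<in> L.const_plus_Span ms" if "homogeneous d g" for g d
    using quot_in_subring[OF S(1-3) l(1,3) _ that] by blast
  have "a \<in> FF.Span (local_ring X P) ms" if a: "a \<in> max_ideal X P" for a
  proof -
    obtain U f where U: "(U, f) \<in> reps" "P \<in> U" "f P = 0" "a = cls U f" using a unfolding max_ideal_iff by blast
    obtain d g h where gh: "homogeneous d g" "homogeneous d h" "P \<in> nz h" "cls U f = quot g h"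
        "f P = form_value g P / form_value h P"
      using quot_eqI[OF U(1,2)] by blast
    have hP: "form_value h P \<noteq> 0" "nz h \<noteq> {}" using gh(3) by (auto simp: nz_def)
    have gP: "form_value g P = 0" using gh(5) U(3) hP by simp
    note change = quot_change_denominator[OF gh(1,2) hP(2) l(1,3)]
    have nzl: "nz (l ^ d) \<noteq> {}" using ld(2) by blast
    have "quot g (l ^ d) \<in> max_ideal X P"
      unfolding quot_def using cls_max_ideal_iff[OF quot_reps[OF gh(1) ld(1) nzl] ld(2)] gP by simp
    then have span: "quot g (l ^ d) \<in> FF.Span (local_ring X P) ms" using S(4) inS[OF gh(1)] by blast
    have "quot h (l ^ d) \<notin> max_ideal X P"
      unfolding quot_def using cls_max_ideal_iff[OF quot_reps[OF gh(2) ld(1) nzl] ld(2)] hP lP by simp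
    then have inv: "inv\<^bsub>FF\<^esub> (quot h (l ^ d)) \<in> local_ring X P" using L.A_units loc[OF gh(2)] by blast
    have "a = inv\<^bsub>FF\<^esub> (quot h (l ^ d)) \<otimes>\<^bsub>FF\<^esub> quot g (l ^ d)"
      unfolding U(4) gh(4) change(2)
      using L.A_closed[OF inv] L.A_closed[OF loc[OF gh(1)]] by (simp add: FF.m_comm)
    then show ?thesis using L.Span_A_mult[OF _ inv span] ms L.m_A by auto
  qed
  then show ?thesis using ms by blast
qed

lemma ord_at_valuation:
  assumes P: "P \<in> X" "nonsingular_at X P" and tr: "FF.transcendence_degree_le_1"
  shows "discrete_valuation FF \<iota> (ord_at X P)"
    and "a \<in> carrier FF \<Longrightarrow> a \<noteq> \<zero>\<^bsub>FF\<^esub> \<Longrightarrow> 0 \<le> ord_at X P a \<longleftrightarrow> a \<in> local_ring X P"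
    and "a \<in> carrier FF \<Longrightarrow> a \<noteq> \<zero>\<^bsub>FF\<^esub> \<Longrightarrow> 0 < ord_at X P a \<longleftrightarrow> a \<in> max_ideal X P"
proof -
  interpret L: local_subring FF \<iota> "local_ring X P" "max_ideal X P"
    by (rule local_subring_local_ring[OF P(1)])
  obtain ms where ms: "set ms \<subseteq> max_ideal X P" "max_ideal X P \<subseteq> FF.Span (local_ring X P) ms"
    using max_ideal_generators[OF P(1)] by blast
  interpret N: nonsingular_local_ring FF \<iota> "local_ring X P" "max_ideal X P" ms
    using ms P(2) tr by unfold_locales (auto simp: nonsingular_at_def Let_def constants_eq)
  have "ord_at X P = N.valu"
    by (rule ext) (simp add: ord_at_def N.valu_def uniformizer_def N.unif_def)
  then show "discrete_valuation FF \<iota> (ord_at X P)"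
    and "a \<in> carrier FF \<Longrightarrow> a \<noteq> \<zero>\<^bsub>FF\<^esub> \<Longrightarrow> 0 \<le> ord_at X P a \<longleftrightarrow> a \<in> local_ring X P"
    and "a \<in> carrier FF \<Longrightarrow> a \<noteq> \<zero>\<^bsub>FF\<^esub> \<Longrightarrow> 0 < ord_at X P a \<longleftrightarrow> a \<in> max_ideal X P"
    using N.discrete_valuation_valu N.valu_nonneg_iff by auto
qed

text \<open>The separating function is a form \<open>g\<close> that vanishes on \<open>S\<close>
  except at \<open>P\<close>, divided by a power of a linear form avoiding \<open>S\<close>. Such a
  linear form is found because the field is infinite.\<close>

lemma curve_model_ord_at:
  assumes inf: "infinite (UNIV :: 'k set)" and ns: "\<And>P. P \<in> X \<Longrightarrow> nonsingular_at X P"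
    and tr: "FF.transcendence_degree_le_1"
  shows "curve_model FF \<iota> X (ord_at X)"
proof (intro curve_model.intro curve_model_axioms.intro)
  show "field_over FF \<iota>" by (rule FF.field_over_axioms)
  show "discrete_valuation FF \<iota> (ord_at X P)" if "P \<in> X" for P
    using ord_at_valuation(1) that ns tr by blast
  fix S P assume S: "finite S" "S \<subseteq> X" "P \<in> S"
  obtain d g where g: "homogeneous d g" "form_value g P \<noteq> 0" "\<forall>Q\<in>S - {P}. form_value g Q = 0"
    using separating_form[of "S - {P}" P] S by auto
  obtain l where l: "homogeneous 1 l" "\<forall>P\<in>S. form_value l P \<noteq> 0"
    using nonvanishing_linear_form[OF inf S(1,2)] by blast
  have ld: "homogeneous d (l ^ d)" using homogeneous_power[OF l(1), of d] by simp
  have nzS: "Q \<in> nz (l ^ d)" if "Q \<in> S" for Q using that l(2) S(2) by (auto simp: nz_def)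
  then have "nz (l ^ d) \<noteq> {}" using S(3) by blast
  note rep = quot_reps[OF g(1) ld this]
  have car: "quot g (l ^ d) \<in> carrier FF" unfolding quot_def using rep by blast
  have mi: "quot g (l ^ d) \<in> max_ideal X Q \<longleftrightarrow> form_value g Q = 0" if "Q \<in> S" for Q
    unfolding quot_def using cls_max_ideal_iff[OF rep nzS[OF that]] that l(2) by simp
  have lr: "quot g (l ^ d) \<in> local_ring X Q" if "Q \<in> S" for Q
    unfolding quot_def local_ring_iff using rep nzS[OF that] by blast
  interpret L: local_subring FF \<iota> "local_ring X P" "max_ideal X P"
    using local_subring_local_ring S by blast
  have nz0: "quot g (l ^ d) \<noteq> \<zero>\<^bsub>FF\<^esub>" using mi[OF S(3)] g(2) L.zero_m by metis
  have ord: "0 \<le> ord_at X Q (quot g (l ^ d))" "0 < ord_at X Q (quot g (l ^ d)) \<longleftrightarrow> form_value g Q = 0"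
    if Q: "Q \<in> S" for Q
    using ord_at_valuation(2,3)[OF _ ns tr car nz0, of Q] Q S(2) lr[OF Q] mi[OF Q] by auto
  show "\<exists>u\<in>carrier FF - {\<zero>\<^bsub>FF\<^esub>}. ord_at X P u = 0 \<and> (\<forall>Q\<in>S - {P}. 1 \<le> ord_at X Q u)"
    using car nz0 ord[OF S(3)] g(2,3) ord(2)
    by (intro bexI[of _ "quot g (l ^ d)"]) fastforce+
qed

end

section \<open>Dominant morphisms\<close>

lemma projective_curve_variety: "projective_curve X \<Longrightarrow> variety X"
proof
  assume X: "projective_curve X"
  then have "closedin zariski X" and irr: "irreducible_space (subtopology zariski X)"
    by (auto simp: projective_curve_def)
  then show sub: "X \<subseteq> proj_space"
    using closedin_subset[of zariski X] by (simp add: topspace_zariski)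
  then have top: "topspace (subtopology zariski X) = X"
    by (simp add: topspace_zariski inf_absorb2)
  show "X \<noteq> {}" using irr top by (simp add: irreducible_space_def)
  fix U V assume UV: "open_in X U" "open_in X V" "U \<noteq> {}" "V \<noteq> {}"
  have sub: "U \<subseteq> X" "V \<subseteq> X"
    using openin_subset[OF UV(1)] openin_subset[OF UV(2)] unfolding top by auto
  show "U \<inter> V \<noteq> {}"
  proof
    assume "U \<inter> V = {}"
    then have "(X - U) \<union> (X - V) = X" by blast
    moreover have "closedin (subtopology zariski X) (X - U)" "closedin (subtopology zariski X) (X - V)"
      using UV closedin_diff[OF closedin_topspace, of "subtopology zariski X"] unfolding top by auto
    ultimately have "X - U = X \<or> X - V = X"
      using irr unfolding irreducible_space_def top by blast
    then show False using UV sub by blast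
  qed
qed

text \<open>Two nonempty open sets of \<open>Y\<close> have nonempty open preimages, and these meet
  in \<open>X\<close>. Applied to the degree 2 map, this gives irreducibility of the projective
  line.\<close>

lemma variety_dominant_image:
  fixes X :: "('k::field, 'n::finite) point set" and Y :: "('k, 'm::finite) point set"
  assumes X: "variety X" and Y: "Y \<subseteq> proj_space" and \<phi>: "curve_morphism X Y \<phi>" "dominant X Y \<phi>"
  shows "variety Y"
proof -
  interpret X: variety X by (rule X)
  have topX: "topspace (subtopology zariski X) = X"
    using X.X_proj by (simp add: topspace_zariski inf_absorb2)
  have topY: "topspace (subtopology zariski Y) = Y"
    using Y by (simp add: topspace_zariski inf_absorb2)
  have cont: "continuous_map (subtopology zariski X) (subtopology zariski Y) \<phi>"
    using \<phi> by (simp add: curve_morphism_def)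
  have pre: "open_in X {P \<in> X. \<phi> P \<in> V}" "{P \<in> X. \<phi> P \<in> V} \<noteq> {}" if "open_in Y V" "V \<noteq> {}" for V
    using openin_continuous_map_preimage[OF cont that(1)] that \<phi>(2)
    unfolding topX dominant_def by auto
  show ?thesis
  proof
    show "Y \<subseteq> proj_space" by (rule Y)
    obtain P where "P \<in> X" using X.X_nonempty by blast
    then have "\<phi> P \<in> Y" using cont topX topY by (auto simp: continuous_map_def)
    then show "Y \<noteq> {}" by blast
    fix U V assume "open_in Y U" "open_in Y V" "U \<noteq> {}" "V \<noteq> {}"
    then have "{P \<in> X. \<phi> P \<in> U} \<inter> {P \<in> X. \<phi> P \<in> V} \<noteq> {}" using X.dense pre by meson
    then show "U \<inter> V \<noteq> {}" by blast
  qed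
qed

context discrete_valuation
begin

text \<open>Natural powers only, placed on whichever side they fit, so that a ring homomorphism can
  be applied to the equation by \<open>h_pow\<close>.\<close>

lemma val_zero_decomposition:
  assumes "a \<in> carrier R" "a \<noteq> \<zero>" "s \<in> carrier R" "s \<noteq> \<zero>" "v s = 1"
  shows "\<exists>b\<in>carrier R. \<exists>n::nat. b \<noteq> \<zero> \<and> v b = 0 \<and>
    (v a = int n \<and> a = b \<otimes> s [^] n \<or> v a = - int n \<and> b = a \<otimes> s [^] n)"
proof (cases "0 \<le> v a")
  case True
  define n where "n = nat (v a)"
  have sn: "s [^] n \<in> carrier R" "s [^] n \<noteq> \<zero>" using assms by auto
  let ?b = "a \<otimes> inv (s [^] n)"
  have "?b \<in> carrier R" "?b \<noteq> \<zero>" using assms sn by (auto simp: integral_iff)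
  moreover have "v ?b = 0" using assms sn True by (simp add: val_mult val_inv val_pow n_def del: pow_nat)
  moreover have "a = ?b \<otimes> s [^] n" using assms sn by (simp add: m_assoc)
  ultimately show ?thesis using True by (intro bexI[of _ ?b] exI[of _ n]) (auto simp: n_def)
next
  case False
  define n where "n = nat (- v a)"
  have "v (a \<otimes> s [^] n) = 0" using assms False by (simp add: val_mult val_pow n_def del: pow_nat)
  then show ?thesis using assms False
    by (intro bexI[of _ "a \<otimes> s [^] n"] exI[of _ n]) (auto simp: n_def integral_iff simp del: pow_nat)
qed

end

locale dominant_morphism = X: variety X + Y: variety Y
  for X :: "('k::field, 'n::finite) point set" and Y :: "('k, 'm::finite) point set" +
  fixes \<phi> :: "('k, 'n) point \<Rightarrow> ('k, 'm) point"
  assumes morphism: "curve_morphism X Y \<phi>" and dominant: "dominant X Y \<phi>"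
begin

abbreviation pre :: "('k, 'm) point set \<Rightarrow> ('k, 'n) point set" where
  "pre V \<equiv> {P \<in> X. \<phi> P \<in> V}"

lemma continuous: "continuous_map (subtopology zariski X) (subtopology zariski Y) \<phi>"
  using morphism by (simp add: curve_morphism_def)

lemma map_points: "P \<in> X \<Longrightarrow> \<phi> P \<in> Y"
  using continuous X.X_proj Y.X_proj by (auto simp: continuous_map_def topspace_zariski)

lemma pre_reps:
  assumes "(V, f) \<in> Y.reps"
  shows "(pre V, f \<circ> \<phi>) \<in> X.reps"
proof -
  have V: "open_in Y V" "V \<noteq> {}" "regular_on Y V f" using assms by (auto simp: Y.reps_iff)
  have "topspace (subtopology zariski X) = X" using X.X_proj by (simp add: topspace_zariski inf_absorb2)
  then have "open_in X (pre V)" using openin_continuous_map_preimage[OF continuous V(1)] by simp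
  moreover have "pre V \<noteq> {}" using dominant V by (auto simp: dominant_def)
  moreover have "regular_on X (pre V) (f \<circ> \<phi>)" using morphism V by (auto simp: curve_morphism_def)
  ultimately show ?thesis by (simp add: X.reps_iff)
qed

lemma pullback_cls:
  assumes "(V, f) \<in> Y.reps"
  shows "pullback X \<phi> (Y.cls V f) = X.cls (pre V) (f \<circ> \<phi>)"
proof -
  have "X.cls (pre W) (g \<circ> \<phi>) = X.cls (pre V) (f \<circ> \<phi>)" if "(W, g) \<in> Y.cls V f" for W g
  proof -
    have W: "(W, g) \<in> Y.reps" "Y.cls W g = Y.cls V f" using that Y.cls_mem_iff[OF assms] by auto
    then have "\<forall>P\<in>W \<inter> V. g P = f P" using Y.cls_eq_iff[OF W(1) assms] by simp
    then show ?thesis using X.cls_eq_iff[OF pre_reps[OF W(1)] pre_reps[OF assms]] by auto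
  qed
  then have "pullback X \<phi> (Y.cls V f) = (\<Union>p\<in>Y.cls V f. X.cls (pre V) (f \<circ> \<phi>))"
    unfolding pullback_def by (intro SUP_cong refl) auto
  moreover have "Y.cls V f \<noteq> {}" using assms Y.cls_mem_iff by blast
  ultimately show ?thesis by simp
qed

sublocale field_over_hom X.FF X.\<iota> Y.FF Y.\<iota> "pullback X \<phi>"
proof (intro field_over_hom.intro field_over_hom_axioms.intro)
  show "field_over X.FF X.\<iota>" "field_over Y.FF Y.\<iota>"
    by (rule X.FF.field_over_axioms Y.FF.field_over_axioms)+
  have preY: "pre Y = X" using map_points by auto
  show const: "pullback X \<phi> (Y.\<iota> c) = X.\<iota> c" for c
    using pullback_cls[OF Y.reps_const[of c]] by (simp add: Y.\<iota>_def X.\<iota>_def preY comp_def)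
  show "pullback X \<phi> \<in> ring_hom Y.FF X.FF"
  proof (rule ring_hom_memI)
    fix a assume "a \<in> carrier Y.FF"
    then obtain V f where 1: "(V, f) \<in> Y.reps" "a = Y.cls V f" by (rule Y.carrierE)
    then show "pullback X \<phi> a \<in> carrier X.FF" using pullback_cls pre_reps by auto
    fix b assume "b \<in> carrier Y.FF"
    then obtain W g where 2: "(W, g) \<in> Y.reps" "b = Y.cls W g" by (rule Y.carrierE)
    have preInt: "pre (V \<inter> W) = pre V \<inter> pre W" by auto
    show "pullback X \<phi> (a \<otimes>\<^bsub>Y.FF\<^esub> b) = pullback X \<phi> a \<otimes>\<^bsub>X.FF\<^esub> pullback X \<phi> b"
      unfolding 1(2) 2(2) Y.cls_mult[OF 1(1) 2(1)] pullback_cls[OF 1(1)] pullback_cls[OF 2(1)]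
        pullback_cls[OF Y.reps_mult[OF 1(1) 2(1)]] X.cls_mult[OF pre_reps[OF 1(1)] pre_reps[OF 2(1)]]
      by (simp only: preInt comp_def)
    show "pullback X \<phi> (a \<oplus>\<^bsub>Y.FF\<^esub> b) = pullback X \<phi> a \<oplus>\<^bsub>X.FF\<^esub> pullback X \<phi> b"
      unfolding 1(2) 2(2) Y.cls_add[OF 1(1) 2(1)] pullback_cls[OF 1(1)] pullback_cls[OF 2(1)]
        pullback_cls[OF Y.reps_add[OF 1(1) 2(1)]] X.cls_add[OF pre_reps[OF 1(1)] pre_reps[OF 2(1)]]
      by (simp only: preInt comp_def)
  next
    show "pullback X \<phi> \<one>\<^bsub>Y.FF\<^esub> = \<one>\<^bsub>X.FF\<^esub>" using const[of 1] by simp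
  qed
qed

lemma pullback_local_ring:
  assumes "P \<in> X" "a \<in> local_ring Y (\<phi> P)"
  shows "pullback X \<phi> a \<in> local_ring X P"
proof -
  obtain V f where "(V, f) \<in> Y.reps" "\<phi> P \<in> V" "a = Y.cls V f"
    using assms unfolding Y.local_ring_iff by blast
  then show ?thesis using pullback_cls pre_reps assms(1) unfolding X.local_ring_iff by blast
qed

lemma pullback_max_ideal:
  assumes "P \<in> X" "a \<in> max_ideal Y (\<phi> P)"
  shows "pullback X \<phi> a \<in> max_ideal X P"
proof -
  obtain V f where V: "(V, f) \<in> Y.reps" "\<phi> P \<in> V" "f (\<phi> P) = 0" "a = Y.cls V f"
    using assms unfolding Y.max_ideal_iff by blast
  then show ?thesis unfolding V(4) pullback_cls[OF V(1)]
    using X.cls_max_ideal_iff[OF pre_reps[OF V(1)], of P] assms(1) by simp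
qed

text \<open>The index is the order at \<open>P\<close> of the pullback of a uniformizer
  \<open>s\<close>. Functions of order 0 pull back to order 0, because they and their inverses are
  both regular at the image point; powers of \<open>s\<close> account for all other orders.\<close>

lemma ramification_index:
  assumes P: "P \<in> X" "nonsingular_at X P" "nonsingular_at Y (\<phi> P)"
    and tr: "X.FF.transcendence_degree_le_1"
  shows "\<exists>e::nat. 1 \<le> e \<and> (\<forall>a \<in> carrier Y.FF - {\<zero>\<^bsub>Y.FF\<^esub>}.
    ord_at X P (pullback X \<phi> a) = int e * ord_at Y (\<phi> P) a)"
proof -
  let ?h = "pullback X \<phi>" and ?v = "ord_at X P" and ?w = "ord_at Y (\<phi> P)"
  note ordX = X.ord_at_valuation[OF P(1,2) tr]
  note ordY = Y.ord_at_valuation[OF map_points[OF P(1)] P(3) transcendence_degree_le_1_subfield[OF tr]]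
  interpret V: discrete_valuation X.FF X.\<iota> ?v by (rule ordX(1))
  interpret W: discrete_valuation Y.FF Y.\<iota> ?w by (rule ordY(1))
  have hnz: "?h a \<in> carrier X.FF" "?h a \<noteq> \<zero>\<^bsub>X.FF\<^esub>" if "a \<in> carrier Y.FF" "a \<noteq> \<zero>\<^bsub>Y.FF\<^esub>" for a
    using that h_eq_zero_iff by auto
  have nonneg: "0 \<le> ?v (?h a)" if "a \<in> carrier Y.FF" "a \<noteq> \<zero>\<^bsub>Y.FF\<^esub>" "0 \<le> ?w a" for a
    using that hnz[OF that(1,2)] pullback_local_ring[OF P(1), of a] ordX(2) ordY(2) by blast
  have unit: "?v (?h b) = 0" if b: "b \<in> carrier Y.FF" "b \<noteq> \<zero>\<^bsub>Y.FF\<^esub>" "?w b = 0" for b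
  proof -
    have "0 \<le> ?v (?h b)" using nonneg b by simp
    moreover have "0 \<le> ?v (?h (inv\<^bsub>Y.FF\<^esub> b))" using b by (intro nonneg) (auto simp: W.val_inv)
    moreover have "?v (?h (inv\<^bsub>Y.FF\<^esub> b)) = - ?v (?h b)"
      using b hnz[OF b(1,2)] by (simp add: h_inv V.val_inv)
    ultimately show ?thesis by simp
  qed
  obtain s where s: "s \<in> carrier Y.FF" "s \<noteq> \<zero>\<^bsub>Y.FF\<^esub>" "?w s = 1" using W.val_uniformizer by auto
  then have "s \<in> max_ideal Y (\<phi> P)" using ordY(3)[OF s(1,2)] by simp
  then have pos: "0 < ?v (?h s)" using ordX(3)[OF hnz[OF s(1,2)]] pullback_max_ideal[OF P(1)] by blast
  have "?v (?h a) = ?v (?h s) * ?w a" if a: "a \<in> carrier Y.FF" "a \<noteq> \<zero>\<^bsub>Y.FF\<^esub>" for a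
  proof -
    obtain b n where b: "b \<in> carrier Y.FF" "b \<noteq> \<zero>\<^bsub>Y.FF\<^esub>" "?w b = 0"
      and cases: "?w a = int n \<and> a = b \<otimes>\<^bsub>Y.FF\<^esub> s [^]\<^bsub>Y.FF\<^esub> n \<or>
        ?w a = - int n \<and> b = a \<otimes>\<^bsub>Y.FF\<^esub> s [^]\<^bsub>Y.FF\<^esub> n"
      using W.val_zero_decomposition[OF a s] by blast
    have pow: "?h (s [^]\<^bsub>Y.FF\<^esub> n) \<in> carrier X.FF" "?h (s [^]\<^bsub>Y.FF\<^esub> n) \<noteq> \<zero>\<^bsub>X.FF\<^esub>"
        "?v (?h (s [^]\<^bsub>Y.FF\<^esub> n)) = int n * ?v (?h s)"
      using s hnz[OF s(1,2)] by (simp_all add: h_pow V.val_pow)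
    have mult: "?v (?h (c \<otimes>\<^bsub>Y.FF\<^esub> s [^]\<^bsub>Y.FF\<^esub> n)) = ?v (?h c) + int n * ?v (?h s)"
      if "c \<in> carrier Y.FF" "c \<noteq> \<zero>\<^bsub>Y.FF\<^esub>" for c
      using V.val_mult[OF hnz[OF that] pow(1,2)] that s pow(3) by simp
    from cases show ?thesis
    proof
      assume *: "?w a = int n \<and> a = b \<otimes>\<^bsub>Y.FF\<^esub> s [^]\<^bsub>Y.FF\<^esub> n"
      have "?v (?h a) = ?v (?h (b \<otimes>\<^bsub>Y.FF\<^esub> s [^]\<^bsub>Y.FF\<^esub> n))"
        by (rule arg_cong[OF conjunct2[OF *]])
      also have "\<dots> = int n * ?v (?h s)" using mult[OF b(1,2)] unit[OF b] by simp
      finally show ?thesis using conjunct1[OF *] by (simp only: mult.commute)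
    next
      assume "?w a = - int n \<and> b = a \<otimes>\<^bsub>Y.FF\<^esub> s [^]\<^bsub>Y.FF\<^esub> n"
      then show ?thesis using mult[OF a] unit[OF b] by (simp add: algebra_simps)
    qed
  qed
  then show ?thesis using pos by (intro exI[of _ "nat (?v (?h s))"]) auto
qed

end

section \<open>The projective line\<close>

text \<open>With two homogeneous coordinates there is one affine coordinate \<open>\<xi>\<close>.
  Forms divided by a power of \<open>coord i\<close> become polynomials in \<open>\<xi>\<close>, and
  a rational function is a quotient of two of these.\<close>

lemma (in variety) rational_function_field_line:
  assumes two: "UNIV = {i, j}" and nzl: "nz (coord i) \<noteq> {}"
  shows "\<exists>\<xi> \<in> carrier FF. \<forall>a \<in> carrier FF. \<exists>p q. FF.peval \<xi> q \<noteq> \<zero>\<^bsub>FF\<^esub> \<and>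
    a = FF.peval \<xi> p \<otimes>\<^bsub>FF\<^esub> inv\<^bsub>FF\<^esub> (FF.peval \<xi> q)"
proof -
  let ?l = "coord i"
  have l: "homogeneous 1 ?l" by (rule homogeneous_coord)
  define \<xi> where "\<xi> = quot (coord j) ?l"
  have \<xi>: "\<xi> \<in> carrier FF" unfolding \<xi>_def by (rule quot_carrier[OF homogeneous_coord l nzl])
  define S where "S = range (FF.peval \<xi>)"
  have S: "\<And>c. \<iota> c \<in> S" "\<And>a b. a \<in> S \<Longrightarrow> b \<in> S \<Longrightarrow> a \<oplus>\<^bsub>FF\<^esub> b \<in> S"
      "\<And>a b. a \<in> S \<Longrightarrow> b \<in> S \<Longrightarrow> a \<otimes>\<^bsub>FF\<^esub> b \<in> S"
    using FF.peval_const[OF \<xi>, symmetric] FF.peval_add[OF \<xi>, symmetric]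
      FF.peval_mult[OF \<xi>, symmetric] by (auto simp: S_def)
  have coords: "quot (coord k) ?l \<in> S" for k
  proof -
    consider "k = i" | "k = j" using two by blast
    then show ?thesis
    proof cases
      case 1
      have "quot ?l ?l = \<iota> 1"
        unfolding quot_def \<iota>_def using quot_reps[OF l l nzl] by (subst cls_eq_iff) (auto simp: nz_def)
      then show ?thesis using S(1)[of 1] 1 by simp
    next
      case 2
      then show ?thesis using FF.peval_X[OF \<xi>] unfolding S_def \<xi>_def by (metis rangeI)
    qed
  qed
  have inS: "quot g (?l ^ d) \<in> S" if "homogeneous d g" for g d
    by (rule quot_in_subring[OF S l nzl coords that])
  have "\<exists>p q. FF.peval \<xi> q \<noteq> \<zero>\<^bsub>FF\<^esub> \<and> a = FF.peval \<xi> p \<otimes>\<^bsub>FF\<^esub> inv\<^bsub>FF\<^esub> (FF.peval \<xi> q)"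
    if a: "a \<in> carrier FF" for a
  proof -
    obtain d g h where gh: "homogeneous d g" "homogeneous d h" "nz h \<noteq> {}" "a = quot g h"
      using carrier_quot[OF a] by blast
    obtain p q where "quot g (?l ^ d) = FF.peval \<xi> p" "quot h (?l ^ d) = FF.peval \<xi> q"
      using inS[OF gh(1)] inS[OF gh(2)] unfolding S_def by blast
    then show ?thesis using quot_change_denominator[OF gh(1-3) l nzl] gh(4) by metis
  qed
  then show ?thesis using \<xi> by blast
qed

lemma (in variety) nz_coord_proj_space:
  assumes "X = proj_space" shows "nz (coord i) \<noteq> {}"
proof -
  define x :: "'k ^ 'n" where "x = (\<chi> j. if j = i then 1 else 0)"
  have "x \<noteq> 0" by (auto simp: x_def vec_eq_iff)
  moreover have "x = 1 *s x" by (simp add: vec_eq_iff)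
  ultimately have "x \<in> proportional `` {x}" "proportional `` {x} \<in> proj_space"
    unfolding proportional_def proj_space_def quotient_def by blast+
  moreover from this have "form_value (coord i) (proportional `` {x}) \<noteq> 0"
    using form_value_eq_0_iff[OF homogeneous_coord, of "proportional `` {x}" x i] by (simp add: x_def)
  ultimately show ?thesis using assms unfolding nz_def by blast
qed

section \<open>From the geometric hypotheses to the function-field model of a double cover\<close>

theorem corollary2p8:
  fixes X :: "('k::alg_closed_field, 'n::finite) point set"
    and E :: "('k, 'm::finite) point set"
    and \<phi> :: "('k, 'n) point \<Rightarrow> ('k, 'm) point"
  assumes "CHAR('k) = 0 \<or> CHAR('k) \<ge> 3"
    and "nonsingular_projective_curve X" and "has_genus X 4"
    and "nonsingular_projective_curve E" and "has_genus E 1"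
    and "morphism_of_degree 2 X E \<phi>"
  shows "\<not> hyperelliptic X"
proof
  assume "hyperelliptic X"
  then obtain \<psi> where \<psi>: "morphism_of_degree 2 X (proj_space :: ('k, 2) point set) \<psi>"
    by (auto simp: hyperelliptic_def)
  have nsX: "\<And>P. P \<in> X \<Longrightarrow> nonsingular_at X P" and nsE: "\<And>P. P \<in> E \<Longrightarrow> nonsingular_at E P"
    using assms by (auto simp: nonsingular_projective_curve_def)
  have varX: "variety X" and varE: "variety E"
    using assms projective_curve_variety by (auto simp: nonsingular_projective_curve_def)
  have varL: "variety (proj_space :: ('k, 2) point set)"
    using variety_dominant_image[OF varX order_refl] \<psi> by (auto simp: morphism_of_degree_def)
  interpret phi: dominant_morphism X E \<phi>
    using varX varE assms(6) by (simp add: dominant_morphism_def dominant_morphism_axioms_def morphism_of_degree_def)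
  interpret psi: dominant_morphism X "proj_space :: ('k, 2) point set" \<psi>
    using varX varL \<psi> by (simp add: dominant_morphism_def dominant_morphism_axioms_def morphism_of_degree_def)
  define M where "M = pullback X \<psi> ` carrier psi.Y.FF"
  have M: "subfield M phi.X.FF" unfolding M_def by (rule psi.subfield_image)
  have dimM: "phi.X.FF.dimension 2 M (carrier phi.X.FF)"
    using \<psi> by (simp add: M_def morphism_of_degree_def)
  have two: "{0, 1} = (UNIV :: 2 set)" by (rule card_subset_eq) auto
  obtain \<xi> where \<xi>: "\<xi> \<in> carrier psi.Y.FF"
      "\<And>a. a \<in> carrier psi.Y.FF \<Longrightarrow> \<exists>p q. psi.Y.FF.peval \<xi> q \<noteq> \<zero>\<^bsub>psi.Y.FF\<^esub> \<and>
        a = psi.Y.FF.peval \<xi> p \<otimes>\<^bsub>psi.Y.FF\<^esub> inv\<^bsub>psi.Y.FF\<^esub> (psi.Y.FF.peval \<xi> q)"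
    using psi.Y.rational_function_field_line[OF two[symmetric] psi.Y.nz_coord_proj_space[OF refl]]
    by blast
  define x where "x = pullback X \<psi> \<xi>"
  have xM: "x \<in> M" and xR: "x \<in> carrier phi.X.FF" using \<xi>(1) by (auto simp: x_def M_def)
  have rat: "\<exists>p q. phi.X.FF.peval x q \<noteq> \<zero>\<^bsub>phi.X.FF\<^esub> \<and>
      a = phi.X.FF.peval x p \<otimes>\<^bsub>phi.X.FF\<^esub> inv\<^bsub>phi.X.FF\<^esub> (phi.X.FF.peval x q)" if a: "a \<in> M" for a
  proof -
    obtain b where b: "b \<in> carrier psi.Y.FF" "a = pullback X \<psi> b" using a by (auto simp: M_def)
    obtain p q where pq: "psi.Y.FF.peval \<xi> q \<noteq> \<zero>\<^bsub>psi.Y.FF\<^esub>"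
        "b = psi.Y.FF.peval \<xi> p \<otimes>\<^bsub>psi.Y.FF\<^esub> inv\<^bsub>psi.Y.FF\<^esub> (psi.Y.FF.peval \<xi> q)"
      using \<xi>(2)[OF b(1)] by blast
    have "phi.X.FF.peval x q \<noteq> \<zero>\<^bsub>phi.X.FF\<^esub>"
      using pq(1) \<xi>(1) by (simp add: x_def psi.h_peval[symmetric] psi.h_eq_zero_iff)
    moreover have "a = phi.X.FF.peval x p \<otimes>\<^bsub>phi.X.FF\<^esub> inv\<^bsub>phi.X.FF\<^esub> (phi.X.FF.peval x q)"
      using pq \<xi>(1) by (simp add: b(2) x_def psi.h_peval[symmetric] psi.h_inv)
    ultimately show ?thesis by blast
  qed
  \<comment> \<open>The hyperelliptic map bounds the transcendence degree for \<open>X\<close>, and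
    \<open>\<phi>\<close> passes the bound on to \<open>E\<close>; this makes \<open>ord_at\<close>
    a valuation on both curves.\<close>
  have tr: "phi.X.FF.transcendence_degree_le_1"
    by (rule phi.X.FF.transcendence_degree_le_1I[OF M dimM xR rat])
  have trE: "phi.Y.FF.transcendence_degree_le_1"
    by (rule phi.transcendence_degree_le_1_subfield[OF tr])
  interpret CX: curve_model phi.X.FF phi.X.\<iota> X "ord_at X"
    using phi.X.curve_model_ord_at[OF infinite_alg_closed nsX tr] by blast
  interpret CE: curve_model phi.Y.FF phi.Y.\<iota> E "ord_at E"
    using phi.Y.curve_model_ord_at[OF infinite_alg_closed nsE trE] by blast
  interpret C: double_cover_model phi.X.FF phi.X.\<iota> X "ord_at X" phi.Y.FF phi.Y.\<iota> E "ord_at E"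
    "pullback X \<phi>" \<phi>
  proof (intro double_cover_model.intro double_cover_model_axioms.intro)
    show "phi.X.FF.dimension 2 (pullback X \<phi> ` carrier phi.Y.FF) (carrier phi.X.FF)"
      using assms(6) by (simp add: morphism_of_degree_def)
  qed (use CX.curve_model_axioms CE.curve_model_axioms phi.field_over_hom_axioms phi.map_points
        phi.ramification_index[OF _ nsX nsE tr] in auto)
  have RRX: "riemann_roch_space X D = CX.RR D" for D
    by (auto simp: riemann_roch_space_def CX.RR_def)
  have RRE: "riemann_roch_space E D = CE.RR D" for D
    by (auto simp: riemann_roch_space_def CE.RR_def)
  \<comment> \<open>Genus 4 yields a divisor where the value 4 is attained. Genus 1 yields the
    attaining divisor \<open>D0\<close> and the upper bound at every divisor whose space has a
    dimension.\<close>
  obtain D l where D: "keys D \<subseteq> X" "phi.X.FF.dimension l (range phi.X.\<iota>) (CX.RR D)"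
      "divisor_degree D + 1 - int l = 4"
    using assms(3) by (auto simp: has_genus_def divisors_def RRX phi.X.constants_eq)
  obtain D0 l0 where D0: "keys D0 \<subseteq> E" "phi.Y.FF.dimension l0 (range phi.Y.\<iota>) (CE.RR D0)"
      "divisor_degree D0 + 1 - int l0 = 1"
    using assms(5) by (auto simp: has_genus_def divisors_def RRE phi.Y.constants_eq)
  have E: "divisor_degree A + 1 - int n \<le> 1"
    if "keys A \<subseteq> E" "phi.Y.FF.dimension n (range phi.Y.\<iota>) (CE.RR A)" for A n
    using assms(5) that by (auto simp: has_genus_def divisors_def RRE phi.Y.constants_eq)
  show False by (rule C.hyperelliptic_contradiction[OF M dimM xM rat D D0 E])
qed

end
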